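(* $(\mathbf{S},\prec,\succ)$ is, as a dendriform algebra, freely generated by the subspace of dendriform primitive elements $Prim_{Dend}(\mathbf{S}):=\mathrm{Ker}(\Delta_\prec)\cap\mathrm{Ker}(\Delta_\succ)\subseteq\mathbf{S}_+$; that is, the augmentation ideal $\mathbf{S}_+$ is the free dendriform algebra over the vector space $Prim_{Dend}(\mathbf{S})$.
   Context: The ground field is $\mathbf{Q}$, $\mathbb{N}^*=\{1,2,\dots\}$, $[k]=\{1,\dots,k\}$. Dendriform algebra: a vector space with two bilinear products $\prec,\succ$ such that, with $\ast=\prec+\succ$, $(x\prec y)\prec z=x\prec(y\ast z)$, $(x\succ y)\prec z=x\succ(y\prec z)$, $(x\ast y)\succ z=x\succ(y\succ z)$. Graded permutations: $\mathbf{S}$ is the vector space with basis the pairs $(\sigma,d)$, $\sigma\in\mathfrak{S}_k$, $d:[k]\to\mathbb{N}^*$, $k\ge 0$; $(\sigma,d)$ is written as the biword $\begin{pmatrix}\sigma(1)&\ldots&\sigma(k)\\ d(1)&\ldots&d(k)\end{pmatrix}$. $\mathbf{S}_+$ (augmentation ideal) is the span of the biwords with $k\ge 1$. For $(\sigma,d)$ of length $k\ge1$ and $(\tau,e)$ of length $l\ge1$, $$(\sigma,d)\prec(\tau,e)=\sum_{\alpha}((\sigma\otimes\tau)\circ\alpha^{-1},(d\otimes e)\circ\alpha^{-1}),$$ the sum being over permutations $\alpha\in\mathfrak{S}_{k+l}$ with $\alpha(1)<\dots<\alpha(k)$, $\alpha(k+1)<\dots<\alpha(k+l)$ and $\alpha^{-1}(1)=1$;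 $(\sigma,d)\succ(\tau,e)$ is the same sum with $\alpha^{-1}(1)=k+1$ instead. Here $(\sigma\otimes\tau)(i)=\sigma(i)$ for $i\le k$, $(\sigma\otimes\tau)(i)=\tau(i-k)+k$ for $i>k$, and $(d\otimes e)(i)=d(i)$ for $i\le k$, $(d\otimes e)(i)=e(i-k)$ for $i>k$. With these products $\mathbf{S}_+$ is a dendriform algebra. Coproducts on $\mathbf{S}_+$: for $(\sigma,d)$ with $\sigma\in\mathfrak{S}_n$, $n\ge1$, $$\Delta_\prec((\sigma,d))=\sum_{i=\sigma^{-1}(1)}^{n-1}\begin{pmatrix}std(\sigma(1),\ldots,\sigma(i))\\ d(1),\ldots,d(i)\end{pmatrix}\otimes\begin{pmatrix}std(\sigma(i+1),\ldots,\sigma(n))\\ d(i+1),\ldots,d(n)\end{pmatrix},$$ and $\Delta_\succ((\sigma,d))$ is the same sum over $1\le i\le\sigma^{-1}(1)-1$. Here $std(i_1,\dots,i_k)=(f(i_1),\dots,f(i_k))$, $f$ being the increasing bijection $\{i_1,\dots,i_k\}\to[k]$. *)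

theory Defs
  imports
    Complex_Main
    "HOL-Library.Poly_Mapping"
    "HOL-Library.FuncSet"
    "HOL-Combinatorics.Permutations"
begin

section \<open>Dendriform algebras over the rationals\<close>

text \<open>All structures live on a linear subspace \<open>A\<close> of an ambient rational vector space;
  \<open>A = UNIV\<close> is allowed. Operations are only constrained on \<open>A\<close>.\<close>

definition linear_on ::
  "(rat \<Rightarrow> 'a \<Rightarrow> 'a) \<Rightarrow> 'a set \<Rightarrow> (rat \<Rightarrow> 'b \<Rightarrow> 'b) \<Rightarrow>
    ('a::ab_group_add \<Rightarrow> 'b::ab_group_add) \<Rightarrow> bool" where
  "linear_on s V t f \<longleftrightarrow>
     (\<forall>x\<in>V. \<forall>y\<in>V. f (x + y) = f x + f y) \<and> (\<forall>c. \<forall>x\<in>V. f (s c x) = t c (f x))"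

definition bilinear_on ::
  "(rat \<Rightarrow> 'a \<Rightarrow> 'a) \<Rightarrow> 'a set \<Rightarrow> ('a::ab_group_add \<Rightarrow> 'a \<Rightarrow> 'a) \<Rightarrow> bool" where
  "bilinear_on s A m \<longleftrightarrow>
     (\<forall>x\<in>A. linear_on s A s (\<lambda>y. m x y)) \<and> (\<forall>y\<in>A. linear_on s A s (\<lambda>x. m x y))"

locale dendriform_algebra = vector_space scale
  for scale :: "rat \<Rightarrow> 'a::ab_group_add \<Rightarrow> 'a" +
  fixes A :: "'a set"
    and lprod :: "'a \<Rightarrow> 'a \<Rightarrow> 'a"  (infixl \<open>\<prec>\<close> 70)
    and rprod :: "'a \<Rightarrow> 'a \<Rightarrow> 'a"  (infixl \<open>\<succ>\<close> 70)
  assumes subspace: "subspace A"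
    and lprod_closed: "x \<in> A \<Longrightarrow> y \<in> A \<Longrightarrow> x \<prec> y \<in> A"
    and rprod_closed: "x \<in> A \<Longrightarrow> y \<in> A \<Longrightarrow> x \<succ> y \<in> A"
    and lprod_bilinear: "bilinear_on scale A (\<prec>)"
    and rprod_bilinear: "bilinear_on scale A (\<succ>)"
    and dend_left: "x \<in> A \<Longrightarrow> y \<in> A \<Longrightarrow> z \<in> A \<Longrightarrow> (x \<prec> y) \<prec> z = x \<prec> (y \<prec> z + y \<succ> z)"
    and dend_middle: "x \<in> A \<Longrightarrow> y \<in> A \<Longrightarrow> z \<in> A \<Longrightarrow> (x \<succ> y) \<prec> z = x \<succ> (y \<prec> z)"
    and dend_right: "x \<in> A \<Longrightarrow> y \<in> A \<Longrightarrow> z \<in> A \<Longrightarrow> (x \<prec> y + x \<succ> y) \<succ> z = x \<succ> (y \<succ> z)"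

definition dendriform_hom ::
  "(rat \<Rightarrow> 'a \<Rightarrow> 'a) \<Rightarrow> 'a set \<Rightarrow> ('a \<Rightarrow> 'a \<Rightarrow> 'a) \<Rightarrow> ('a \<Rightarrow> 'a \<Rightarrow> 'a) \<Rightarrow>
   (rat \<Rightarrow> 'b \<Rightarrow> 'b) \<Rightarrow> 'b set \<Rightarrow> ('b \<Rightarrow> 'b \<Rightarrow> 'b) \<Rightarrow> ('b \<Rightarrow> 'b \<Rightarrow> 'b) \<Rightarrow>
   ('a::ab_group_add \<Rightarrow> 'b::ab_group_add) \<Rightarrow> bool" where
  "dendriform_hom s A l r t B l' r' F \<longleftrightarrow>
     F \<in> A \<rightarrow> B \<and> linear_on s A t F \<and>
     (\<forall>x\<in>A. \<forall>y\<in>A. F (l x y) = l' (F x) (F y) \<and> F (r x y) = r' (F x) (F y))"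

text \<open>The universal property of the free dendriform algebra over the vector space \<open>V\<close>, with the
  inclusion of \<open>V\<close> into \<open>A\<close> as universal map. Target algebras range over all
  dendriform algebras carried by subspaces of \<open>'b\<close>; a statement that is polymorphic in \<open>'b\<close>
  expresses the full universal property. Homomorphisms are only relevant on \<open>A\<close>, hence the
  normalisation by \<open>extensional A\<close> in the uniqueness claim.\<close>

definition freely_generated_dendriform ::
  "'b::ab_group_add itself \<Rightarrow>
   (rat \<Rightarrow> 'a \<Rightarrow> 'a) \<Rightarrow> 'a set \<Rightarrow> ('a \<Rightarrow> 'a \<Rightarrow> 'a) \<Rightarrow> ('a \<Rightarrow> 'a \<Rightarrow> 'a) \<Rightarrow>
   'a::ab_group_add set \<Rightarrow> bool" where
  "freely_generated_dendriform (_ :: 'b itself) s A l r V \<longleftrightarrow>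
     dendriform_algebra s A l r \<and> module.subspace s V \<and> V \<subseteq> A \<and>
     (\<forall>(t :: rat \<Rightarrow> 'b \<Rightarrow> 'b) B l' r' f.
        dendriform_algebra t B l' r' \<longrightarrow> f \<in> V \<rightarrow> B \<longrightarrow> linear_on s V t f \<longrightarrow>
        (\<exists>!F. F \<in> extensional A \<and> dendriform_hom s A l r t B l' r' F \<and> (\<forall>v\<in>V. F v = f v)))"

section \<open>Vector spaces with a given basis\<close>

text \<open>The rational vector space with basis \<open>'i\<close> is \<open>'i \<Rightarrow>\<^sub>0 rat\<close>; the basis vector of \<open>i\<close> is
  \<open>Poly_Mapping.single i 1\<close>.\<close>

definition pm_scale :: "rat \<Rightarrow> ('i \<Rightarrow>\<^sub>0 rat) \<Rightarrow> ('i \<Rightarrow>\<^sub>0 rat)" where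
  "pm_scale c = Poly_Mapping.map ((*) c)"

lemma lookup_pm_scale [simp]: "Poly_Mapping.lookup (pm_scale c x) i = c * Poly_Mapping.lookup x i"
  by (simp add: pm_scale_def Poly_Mapping.map.rep_eq when_def)

global_interpretation pm: vector_space "pm_scale :: rat \<Rightarrow> ('i \<Rightarrow>\<^sub>0 rat) \<Rightarrow> ('i \<Rightarrow>\<^sub>0 rat)"
  by unfold_locales (auto intro!: poly_mapping_eqI simp: lookup_add algebra_simps)

definition basis_vec :: "'i \<Rightarrow> ('i \<Rightarrow>\<^sub>0 rat)" where
  "basis_vec i = Poly_Mapping.single i 1"

definition linear_ext :: "('i \<Rightarrow> ('j \<Rightarrow>\<^sub>0 rat)) \<Rightarrow> ('i \<Rightarrow>\<^sub>0 rat) \<Rightarrow> ('j \<Rightarrow>\<^sub>0 rat)" where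
  "linear_ext f x = (\<Sum>i\<in>Poly_Mapping.keys x. pm_scale (Poly_Mapping.lookup x i) (f i))"

definition bilinear_ext ::
  "('i \<Rightarrow> 'i \<Rightarrow> ('j \<Rightarrow>\<^sub>0 rat)) \<Rightarrow> ('i \<Rightarrow>\<^sub>0 rat) \<Rightarrow> ('i \<Rightarrow>\<^sub>0 rat) \<Rightarrow> ('j \<Rightarrow>\<^sub>0 rat)" where
  "bilinear_ext f x y = linear_ext (\<lambda>i. linear_ext (f i) y) x"

lemma linear_ext_basis_vec [simp]: "linear_ext f (basis_vec i) = f i"
  by (simp add: linear_ext_def basis_vec_def)

lemma bilinear_ext_basis_vec [simp]: "bilinear_ext f (basis_vec i) (basis_vec j) = f i j"
  by (simp add: bilinear_ext_def)

section \<open>Graded permutations\<close>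

text \<open>A biword is a triple \<open>(k, \<sigma>, d)\<close> of its length, a permutation of \<open>{1..k}\<close> and a map
  from \<open>{1..k}\<close> to the positive integers. To have a unique representation, \<open>\<sigma>\<close> is the identity
  and \<open>d\<close> is zero outside \<open>{1..k}\<close>.\<close>

type_synonym biword = "nat \<times> (nat \<Rightarrow> nat) \<times> (nat \<Rightarrow> nat)"

definition graded_perms :: "biword set" where
  "graded_perms = {(k, \<sigma>, d). \<sigma> permutes {1..k} \<and> (\<forall>i\<in>{1..k}. 1 \<le> d i) \<and> (\<forall>i. i \<notin> {1..k} \<longrightarrow> d i = 0)}"

text \<open>The graded permutations span the space \<open>S\<close>; its augmentation ideal is spanned by those of
  positive length, on which the dendriform products and coproducts are defined.\<close>

definition gperm_plus :: "(biword \<Rightarrow>\<^sub>0 rat) set" where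
  "gperm_plus = pm.span (basis_vec ` {b \<in> graded_perms. 1 \<le> fst b})"

definition perm_tensor :: "nat \<Rightarrow> (nat \<Rightarrow> nat) \<Rightarrow> (nat \<Rightarrow> nat) \<Rightarrow> (nat \<Rightarrow> nat)" where
  "perm_tensor k \<sigma> \<tau> i = (if i \<le> k then \<sigma> i else \<tau> (i - k) + k)"

definition deg_tensor :: "nat \<Rightarrow> (nat \<Rightarrow> nat) \<Rightarrow> (nat \<Rightarrow> nat) \<Rightarrow> (nat \<Rightarrow> nat)" where
  "deg_tensor k d e i = (if i \<le> k then d i else e (i - k))"

definition shuffles_starting :: "nat \<Rightarrow> nat \<Rightarrow> nat \<Rightarrow> (nat \<Rightarrow> nat) set" where
  "shuffles_starting k l j = {\<alpha>. \<alpha> permutes {1..k+l} \<and>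
     strict_mono_on {1..k} \<alpha> \<and> strict_mono_on {k+1..k+l} \<alpha> \<and> inv \<alpha> 1 = j}"

definition shuffle_term :: "biword \<Rightarrow> biword \<Rightarrow> (nat \<Rightarrow> nat) \<Rightarrow> biword" where
  "shuffle_term = (\<lambda>(k, \<sigma>, d) (l, \<tau>, e) \<alpha>.
     (k + l, perm_tensor k \<sigma> \<tau> \<circ> inv \<alpha>, deg_tensor k d e \<circ> inv \<alpha>))"

definition gperm_prec :: "(biword \<Rightarrow>\<^sub>0 rat) \<Rightarrow> (biword \<Rightarrow>\<^sub>0 rat) \<Rightarrow> (biword \<Rightarrow>\<^sub>0 rat)" where
  "gperm_prec = bilinear_ext (\<lambda>a b.
     \<Sum>\<alpha> \<in> shuffles_starting (fst a) (fst b) 1. basis_vec (shuffle_term a b \<alpha>))"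

definition gperm_succ :: "(biword \<Rightarrow>\<^sub>0 rat) \<Rightarrow> (biword \<Rightarrow>\<^sub>0 rat) \<Rightarrow> (biword \<Rightarrow>\<^sub>0 rat)" where
  "gperm_succ = bilinear_ext (\<lambda>a b.
     \<Sum>\<alpha> \<in> shuffles_starting (fst a) (fst b) (fst a + 1). basis_vec (shuffle_term a b \<alpha>))"

text \<open>The increasing bijection from a finite set \<open>I\<close> onto \<open>{1..card I}\<close>.\<close>

definition incr_bij :: "nat set \<Rightarrow> nat \<Rightarrow> nat" where
  "incr_bij I x = card {y \<in> I. y \<le> x}"

lemma incr_bij_strict_mono_on:
  assumes "finite I" shows "strict_mono_on I (incr_bij I)"
proof (rule strict_mono_onI)
  fix x y assume "x \<in> I" "y \<in> I" "x < y"
  then have "{z \<in> I. z \<le> x} \<subseteq> {z \<in> I. z \<le> y}" "y \<in> {z \<in> I. z \<le> y} - {z \<in> I. z \<le> x}" by auto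
  then have "{z \<in> I. z \<le> x} \<subset> {z \<in> I. z \<le> y}" by blast
  then show "incr_bij I x < incr_bij I y"
    unfolding incr_bij_def using assms by (intro psubset_card_mono) auto
qed

lemma incr_bij_bij_betw:
  assumes "finite I" shows "bij_betw (incr_bij I) I {1..card I}"
proof -
  have inj: "inj_on (incr_bij I) I"
    using incr_bij_strict_mono_on[OF assms] by (rule strict_mono_on_imp_inj_on)
  have "incr_bij I ` I \<subseteq> {1..card I}"
  proof (rule image_subsetI)
    fix x assume "x \<in> I"
    then have "0 < card {y \<in> I. y \<le> x}" using assms by (subst card_gt_0_iff) auto
    moreover have "card {y \<in> I. y \<le> x} \<le> card I" using assms by (intro card_mono) auto
    ultimately show "incr_bij I x \<in> {1..card I}" by (simp add: incr_bij_def)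
  qed
  moreover have "card (incr_bij I ` I) = card {1..card I}" using inj by (simp add: card_image)
  ultimately have "incr_bij I ` I = {1..card I}" by (intro card_subset_eq) auto
  with inj show ?thesis by (simp add: bij_betw_def)
qed

text \<open>Standardisation of the word \<open>w 1, \<dots>, w n\<close>, as a permutation of \<open>{1..n}\<close>.\<close>

definition std :: "nat \<Rightarrow> (nat \<Rightarrow> nat) \<Rightarrow> (nat \<Rightarrow> nat)" where
  "std n w i = (if i \<in> {1..n} then incr_bij (w ` {1..n}) (w i) else i)"

text \<open>The biword with word \<open>std (\<sigma> (m + 1), \<dots>, \<sigma> (m + n))\<close> and degrees
  \<open>d (m + 1), \<dots>, d (m + n)\<close>.\<close>

definition std_segment :: "nat \<Rightarrow> nat \<Rightarrow> (nat \<Rightarrow> nat) \<Rightarrow> (nat \<Rightarrow> nat) \<Rightarrow> biword" where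
  "std_segment m n \<sigma> d =
     (n, std n (\<lambda>j. \<sigma> (m + j)), (\<lambda>j. if j \<in> {1..n} then d (m + j) else 0))"

text \<open>The tensor square is represented as the vector space whose basis consists of the pairs of
  basis elements, the pair \<open>(a, b)\<close> standing for \<open>a \<otimes> b\<close>.\<close>

definition gperm_coprec :: "(biword \<Rightarrow>\<^sub>0 rat) \<Rightarrow> (biword \<times> biword \<Rightarrow>\<^sub>0 rat)" where
  "gperm_coprec = linear_ext (\<lambda>(n, \<sigma>, d).
     \<Sum>i = inv \<sigma> 1..n - 1. basis_vec (std_segment 0 i \<sigma> d, std_segment i (n - i) \<sigma> d))"

definition gperm_cosucc :: "(biword \<Rightarrow>\<^sub>0 rat) \<Rightarrow> (biword \<times> biword \<Rightarrow>\<^sub>0 rat)" where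
  "gperm_cosucc = linear_ext (\<lambda>(n, \<sigma>, d).
     \<Sum>i = 1..inv \<sigma> 1 - 1. basis_vec (std_segment 0 i \<sigma> d, std_segment i (n - i) \<sigma> d))"

definition prim_dend :: "(biword \<Rightarrow>\<^sub>0 rat) set" where
  "prim_dend = {x \<in> gperm_plus. gperm_coprec x = 0 \<and> gperm_cosucc x = 0}"

text \<open>The operations above produce graded permutations in the chosen representation.\<close>

lemma std_permutes:
  assumes "inj_on w {1..n}" shows "std n w permutes {1..n}"
proof (rule bij_imp_permutes)
  have "bij_betw w {1..n} (w ` {1..n})" using assms by (rule inj_on_imp_bij_betw)
  moreover have "bij_betw (incr_bij (w ` {1..n})) (w ` {1..n}) {1..n}"
    using incr_bij_bij_betw[of "w ` {1..n}"] assms by (simp add: card_image)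
  ultimately have "bij_betw (incr_bij (w ` {1..n}) \<circ> w) {1..n} {1..n}"
    by (rule bij_betw_trans)
  then show "bij_betw (std n w) {1..n} {1..n}"
    by (rule bij_betw_cong[THEN iffD1, rotated]) (simp add: std_def)
qed (auto simp: std_def)

lemma std_segment_graded_perms:
  assumes "(n, \<sigma>, d) \<in> graded_perms" "m + k \<le> n"
  shows "std_segment m k \<sigma> d \<in> graded_perms"
proof -
  have "inj \<sigma>" using assms(1) by (auto simp: graded_perms_def permutes_inj)
  then have "inj_on (\<lambda>j. \<sigma> (m + j)) {1..k}" by (metis (mono_tags, lifting) add_left_cancel injD inj_onI)
  from std_permutes[OF this] show ?thesis
    using assms by (auto simp: graded_perms_def std_segment_def)
qed

lemma perm_tensor_permutes:
  assumes "\<sigma> permutes {1..k}" "\<tau> permutes {1..l}"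
  shows "perm_tensor k \<sigma> \<tau> permutes {1..k+l}"
proof (rule bij_imp_permutes)
  have s: "\<sigma> i \<in> {1..k} \<longleftrightarrow> i \<in> {1..k}" for i using permutes_in_image[OF assms(1)] .
  have t: "\<tau> i \<in> {1..l} \<longleftrightarrow> i \<in> {1..l}" for i using permutes_in_image[OF assms(2)] .
  have "inj_on (perm_tensor k \<sigma> \<tau>) {1..k+l}"
  proof (rule inj_onI)
    fix x y assume xy: "x \<in> {1..k+l}" "y \<in> {1..k+l}" "perm_tensor k \<sigma> \<tau> x = perm_tensor k \<sigma> \<tau> y"
    show "x = y"
    proof (cases "x \<le> k \<longleftrightarrow> y \<le> k")
      case True
      have "\<sigma> x = \<sigma> y \<Longrightarrow> x = y" "\<tau> (x - k) = \<tau> (y - k) \<Longrightarrow> x - k = y - k"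
        using permutes_inj[OF assms(1)] permutes_inj[OF assms(2)] by (auto dest: injD)
      with True xy(3) show ?thesis by (cases "x \<le> k") (auto simp: perm_tensor_def)
    next
      case False
      have "\<sigma> z \<noteq> \<tau> (w - k) + k" if "z \<in> {1..k}" "w \<in> {k+1..k+l}" for z w
      proof -
        have "\<sigma> z \<le> k" using that s[of z] by simp
        moreover have "w - k \<in> {1..l}" using that by auto
        then have "1 \<le> \<tau> (w - k)" using t[of "w - k"] by simp
        ultimately show ?thesis by linarith
      qed
      from this[of x y] this[of y x] False xy show ?thesis
        by (cases "x \<le> k") (simp_all add: perm_tensor_def)
    qed
  qed
  moreover have "perm_tensor k \<sigma> \<tau> ` {1..k+l} \<subseteq> {1..k+l}"
  proof (rule image_subsetI)
    fix x assume "x \<in> {1..k+l}"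
    then show "perm_tensor k \<sigma> \<tau> x \<in> {1..k+l}"
      using s[of x] t[of "x - k"] by (auto simp: perm_tensor_def)
  qed
  ultimately show "bij_betw (perm_tensor k \<sigma> \<tau>) {1..k+l} {1..k+l}"
    by (simp add: bij_betw_def endo_inj_surj)
next
  fix x assume "x \<notin> {1..k+l}"
  then consider "x = 0" | "\<not> x \<le> k" "x - k \<notin> {1..l}" by fastforce
  then show "perm_tensor k \<sigma> \<tau> x = x"
    using permutes_not_in[OF assms(1), of x] permutes_not_in[OF assms(2), of "x - k"]
    by cases (simp_all add: perm_tensor_def)
qed

lemma shuffle_term_graded_perms:
  assumes "a \<in> graded_perms" "b \<in> graded_perms" "\<alpha> permutes {1..fst a + fst b}"
  shows "shuffle_term a b \<alpha> \<in> graded_perms"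
proof -
  obtain k \<sigma> d l \<tau> e where ab: "a = (k, \<sigma>, d)" "b = (l, \<tau>, e)" by (metis prod_cases3)
  have p: "inv \<alpha> permutes {1..k+l}" using assms(3) ab by (simp add: permutes_inv)
  have "perm_tensor k \<sigma> \<tau> \<circ> inv \<alpha> permutes {1..k+l}"
    using assms(1,2) ab p by (intro permutes_compose perm_tensor_permutes) (auto simp: graded_perms_def)
  moreover have "1 \<le> deg_tensor k d e i" if "i \<in> {1..k+l}" for i
  proof (cases "i \<le> k")
    case False
    with that have "i - k \<in> {1..l}" by auto
    with False show ?thesis using assms(2) ab by (simp add: graded_perms_def deg_tensor_def)
  qed (use assms(1) ab that in \<open>auto simp: graded_perms_def deg_tensor_def\<close>)
  moreover have "deg_tensor k d e i = 0" if "i \<notin> {1..k+l}" for i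
  proof -
    from that consider "i = 0" | "\<not> i \<le> k" "i - k \<notin> {1..l}" by fastforce
    then show ?thesis
      using assms(1,2) ab by cases (simp_all add: graded_perms_def deg_tensor_def)
  qed
  ultimately show ?thesis
    using permutes_in_image[OF p] unfolding ab shuffle_term_def graded_perms_def
    by (simp del: atLeastAtMost_iff)
qed

end

theory Submission
  imports Defs
begin

text \<open>
  Both products split by the first letter and both coproducts by the position of the smallest letter,
  which makes \<open>A = S\<^sub>+\<close> a Hopf module over \<open>S\<close> in two ways. For \<open>x \<in> A\<close> and \<open>h \<in> S\<close>,
  the right action \<open>x \<prec> h\<close> and the coaction \<open>x \<otimes> 1 + \<Delta>\<^sub>\<prec> x\<close> form a Hopf module, so there is a
  projection \<open>e\<close> of \<open>A\<close> onto \<open>Ker \<Delta>\<^sub>\<prec>\<close> with kernel \<open>A \<prec> A\<close>; likewise \<open>h \<succ> x\<close> and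
  \<open>x \<otimes> 1 + \<Delta>\<^sub>\<prec> x + \<Delta>\<^sub>\<succ> x\<close> give a projection \<open>e'\<close> onto \<open>Ker (\<Delta>\<^sub>\<prec> + \<Delta>\<^sub>\<succ>)\<close> with kernel \<open>A \<succ> A\<close>.
  Since \<open>e' (Ker \<Delta>\<^sub>\<prec>) \<subseteq> Ker \<Delta>\<^sub>\<prec>\<close> and \<open>e (A \<succ> A) \<subseteq> A \<succ> A\<close>, the composition \<open>q = e' \<circ> e\<close> is a projection
  onto the primitive elements \<open>V\<close> that vanishes on \<open>A \<prec> A + A \<succ> A\<close>.
  It follows that \<open>A\<close> is spanned by the \<open>l \<succ> (v \<prec> r)\<close> with \<open>v \<in> V\<close> and \<open>l\<close>, \<open>r\<close> in \<open>S\<close>, and that \<open>v\<close>, \<open>r\<close>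
  and \<open>l\<close> can be recovered from such an element by cutting it into pieces and applying \<open>q\<close> and the
  antipode. Hence a linear map \<open>f\<close> on \<open>V\<close> extends by recursion on the length to a map \<open>F\<close> with
  \<open>F (l \<succ> (v \<prec> r)) = F l \<succ> (f v \<prec> F r)\<close>, and the dendriform axioms make \<open>F\<close> a homomorphism.
\<close>

section \<open>Linear maps on spaces with a basis\<close>

text \<open>No free dendriform algebra is built for comparison. The elements
  \<open>l \<succ> (v \<prec> r)\<close> are only known to span \<open>A\<close>, so prescribing
  \<open>F\<close> on them would raise the question of well-definedness. Instead \<open>F\<close> is
  a formula in the coproducts, \<open>q\<close> and the antipode, defined on every element and only
  afterwards evaluated on the spanning elements; their linear independence is never discussed. The
  map \<open>e'\<close> preserves the kernel of \<open>\<Delta>\<^sub>\<prec>\<close> because the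
  two iterated cuts of a word into three factors with the smallest letter in the middle one agree,
  and \<open>e\<close> preserves \<open>A \<succ> A\<close> because
  \<open>(x \<succ> y) \<prec> h = x \<succ> (y \<prec> h)\<close>. Three obstacles shape the
  details. Standardisation after every cut hides the combinatorics, hence words over arbitrary
  letters. The unit of \<open>S\<close> has no image in the target, hence actions that treat it
  separately. The target lives on a subspace of a type, hence its products are extended to the whole
  type along a linear projection.\<close>

type_synonym gperm_vec = "biword \<Rightarrow>\<^sub>0 rat"
type_synonym gperm_tensor = "biword \<times> biword \<Rightarrow>\<^sub>0 rat"

abbreviation bv :: "'i \<Rightarrow> ('i \<Rightarrow>\<^sub>0 rat)" where
  "bv \<equiv> basis_vec"

abbreviation lin :: "(rat \<Rightarrow> 'c \<Rightarrow> 'c) \<Rightarrow> (('i \<Rightarrow>\<^sub>0 rat) \<Rightarrow> 'c::ab_group_add) \<Rightarrow> bool" where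
  "lin t f \<equiv> linear_on pm_scale UNIV t f"

lemma linI:
  assumes "\<And>x y. f (x + y) = f x + f y" "\<And>c x. f (pm_scale c x) = t c (f x)"
  shows "lin t f"
  using assms by (simp add: linear_on_def)

lemma lin_plus: "lin t f \<Longrightarrow> f (x + y) = f x + f y"
  by (simp add: linear_on_def)

lemma lin_smult: "lin t f \<Longrightarrow> f (pm_scale c x) = t c (f x)"
  by (simp add: linear_on_def)

lemma lin_0: "lin t f \<Longrightarrow> f 0 = 0"
  using lin_plus[of t f 0 0] by simp

lemma lin_minus: "lin t f \<Longrightarrow> f (- x) = - f x"
  by (metis add.inverse_unique add.right_inverse lin_0 lin_plus)

lemma lin_sub: "lin t f \<Longrightarrow> f (x - y) = f x - f y"
  using lin_plus[of t f x "- y"] lin_minus[of t f y] by simp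

lemma lin_sum: "lin t f \<Longrightarrow> f (sum g I) = (\<Sum>i\<in>I. f (g i))"
  by (induction I rule: infinite_finite_induct) (simp_all add: lin_0 lin_plus)

text \<open>Unlike for \<open>linear_ext\<close>, the target is any rational vector space with
  scaling \<open>t\<close>, since homomorphisms into arbitrary dendriform algebras are built in this
  way as well.\<close>

definition lext :: "(rat \<Rightarrow> 'c \<Rightarrow> 'c) \<Rightarrow> ('i \<Rightarrow> 'c) \<Rightarrow> ('i \<Rightarrow>\<^sub>0 rat) \<Rightarrow> 'c::ab_group_add" where
  "lext t f x = (\<Sum>i\<in>Poly_Mapping.keys x. t (Poly_Mapping.lookup x i) (f i))"

lemma linear_ext_eq_lext: "linear_ext f = lext pm_scale f"
  by (simp add: linear_ext_def lext_def fun_eq_iff)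

lemma pm_vector_space [simp]: "vector_space pm_scale"
  by (rule pm.vector_space_axioms)

lemma lext_superset:
  assumes "vector_space t" "finite I" "Poly_Mapping.keys x \<subseteq> I"
  shows "lext t f x = (\<Sum>i\<in>I. t (Poly_Mapping.lookup x i) (f i))"
proof -
  interpret vector_space t by fact
  show ?thesis unfolding lext_def
    by (rule sum.mono_neutral_left) (use assms in \<open>auto simp: in_keys_iff\<close>)
qed

lemma lin_lext:
  fixes f :: "'i \<Rightarrow> 'c::ab_group_add"
  assumes "vector_space t" shows "lin t (lext t f)"
proof (rule linI)
  interpret vector_space t by fact
  fix x y :: "'i \<Rightarrow>\<^sub>0 rat" and c
  let ?I = "Poly_Mapping.keys x \<union> Poly_Mapping.keys y \<union> Poly_Mapping.keys (x + y)"
  show "lext t f (x + y) = lext t f x + lext t f y"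
    by (subst (1 2 3) lext_superset[OF assms, of ?I])
       (auto simp: lookup_add scale_left_distrib sum.distrib)
  let ?J = "Poly_Mapping.keys x \<union> Poly_Mapping.keys (pm_scale c x)"
  show "lext t f (pm_scale c x) = t c (lext t f x)"
    by (subst (1 2) lext_superset[OF assms, of ?J]) (auto simp: scale_sum_right)
qed

lemma lext_basis_vec [simp]: assumes "vector_space t" shows "lext t f (bv i) = f i"
proof -
  interpret vector_space t by fact
  show ?thesis by (simp add: lext_def basis_vec_def)
qed

lemma basis_expansion: "(x :: 'i \<Rightarrow>\<^sub>0 rat) =
    (\<Sum>i\<in>Poly_Mapping.keys x. pm_scale (Poly_Mapping.lookup x i) (bv i))"
proof (rule poly_mapping_eqI)
  fix k
  show "Poly_Mapping.lookup x k = Poly_Mapping.lookup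
      (\<Sum>i\<in>Poly_Mapping.keys x. pm_scale (Poly_Mapping.lookup x i) (bv i)) k"
    by (simp add: lookup_sum basis_vec_def lookup_single when_def in_keys_iff if_distrib cong: if_cong)
qed

lemma lin_eqI:
  assumes "lin t f" "lin t g" "\<And>i. f (bv i) = g (bv i)"
  shows "f x = g x"
  by (subst (1 2) basis_expansion) (simp add: lin_sum[OF assms(1)] lin_sum[OF assms(2)]
      lin_smult[OF assms(1)] lin_smult[OF assms(2)] assms(3))

lemma lin_eq_on_span:
  assumes "lin t f" "lin t g" "x \<in> pm.span X" "\<And>i. i \<in> X \<Longrightarrow> f i = g i"
  shows "f x = g x"
  using assms(3)
proof (induction rule: pm.span_induct_alt)
  case base show ?case using assms by (simp add: lin_0)
next
  case (step c x y) then show ?case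
    by (simp add: lin_plus[OF assms(1)] lin_plus[OF assms(2)] lin_smult[OF assms(1)] lin_smult[OF assms(2)] assms(4))
qed

lemma lin_in_subspace:
  assumes "module.subspace t U" "vector_space t" "lin t f" "x \<in> pm.span X" "\<And>i. i \<in> X \<Longrightarrow> f i \<in> U"
  shows "f x \<in> U"
proof -
  interpret vector_space t by fact
  show ?thesis using assms(4)
  proof (induction rule: pm.span_induct_alt)
    case base show ?case using assms by (simp add: lin_0 subspace_0)
  next
    case (step c x y) then show ?case using assms
      by (simp add: lin_plus[OF assms(3)] lin_smult[OF assms(3)] subspace_add subspace_scale)
  qed
qed

lemma in_span_keys: "(\<And>i. i \<in> Poly_Mapping.keys x \<Longrightarrow> bv i \<in> X) \<Longrightarrow> x \<in> pm.span X"
  by (subst basis_expansion) (intro pm.span_sum pm.span_scale pm.span_base)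

lemma span_basis_lookup:
  assumes "x \<in> pm.span (bv ` I)" "i \<notin> I" shows "Poly_Mapping.lookup x i = 0"
  using assms(1)
  by (induction rule: pm.span_induct_alt)
     (use assms(2) in \<open>auto simp: lookup_add basis_vec_def lookup_single when_def split: if_splits\<close>)

text \<open>Serves the definitions by recursion on the length: functions that agree on shorter basis
  elements have the same extension to combinations of these.\<close>

lemma lext_cong_on:
  assumes "x \<in> pm.span (bv ` I)" "\<And>i. i \<in> I \<Longrightarrow> f i = g i"
  shows "lext t f x = lext t g x"
  unfolding lext_def
  by (rule sum.cong[OF refl]) (metis assms in_keys_iff span_basis_lookup)

named_theorems lin_intros

lemma lin_id [lin_intros]: "lin pm_scale (\<lambda>x. x)"
  by (rule linI) auto

lemma lin_compose: "lin t f \<Longrightarrow> lin pm_scale g \<Longrightarrow> lin t (\<lambda>x. f (g x))"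
  by (rule linI) (simp_all add: lin_plus lin_smult)

lemma lin_lext1 [lin_intros]: "vector_space t \<Longrightarrow> lin pm_scale g \<Longrightarrow> lin t (\<lambda>x. lext t f (g x))"
  by (rule lin_compose[OF lin_lext])

lemma lin_zero [lin_intros]: assumes "vector_space t" shows "lin t (\<lambda>x. 0)"
proof -
  interpret vector_space t by fact
  show ?thesis by (rule linI) auto
qed

lemma lin_add [lin_intros]:
  assumes "vector_space t" "lin t f" "lin t g" shows "lin t (\<lambda>x. f x + g x)"
proof -
  interpret vector_space t by fact
  show ?thesis using assms by (intro linI) (simp_all add: lin_plus lin_smult scale_right_distrib)
qed

lemma lin_diff [lin_intros]:
  assumes "vector_space t" "lin t f" "lin t g" shows "lin t (\<lambda>x. f x - g x)"
proof -
  interpret vector_space t by fact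
  show ?thesis using assms by (intro linI) (simp_all add: lin_plus lin_smult scale_right_diff_distrib)
qed

lemma lin_sum_fun:
  assumes "vector_space t" "\<And>i. i \<in> I \<Longrightarrow> lin t (f i)" shows "lin t (\<lambda>x. \<Sum>i\<in>I. f i x)"
  using assms(2) by (induction I rule: infinite_finite_induct) (simp_all add: lin_zero lin_add assms(1))

lemma lin_scale [lin_intros]:
  assumes "vector_space t" "lin t f" shows "lin t (\<lambda>x. t c (f x))"
proof -
  interpret vector_space t by fact
  show ?thesis using assms by (intro linI) (simp_all add: lin_plus lin_smult scale_right_distrib scale_left_commute)
qed

text \<open>Here the variable sits in the function; the index set \<open>keys x\<close> stays fixed,
  so the map is a finite sum of linear ones.\<close>

lemma lin_lext2 [lin_intros]:
  assumes "vector_space t" "\<And>i. lin t (\<lambda>z. f z i)" shows "lin t (\<lambda>z. lext t (f z) x)"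
  unfolding lext_def by (intro lin_sum_fun lin_scale assms)

section \<open>Bilinear maps, tensors and Sweedler sums\<close>

definition bilin :: "(rat \<Rightarrow> 'c \<Rightarrow> 'c) \<Rightarrow> (('i \<Rightarrow>\<^sub>0 rat) \<Rightarrow> ('j \<Rightarrow>\<^sub>0 rat) \<Rightarrow> 'c::ab_group_add) \<Rightarrow> bool" where
  "bilin t B \<longleftrightarrow> (\<forall>x. lin t (\<lambda>y. B x y)) \<and> (\<forall>y. lin t (\<lambda>x. B x y))"

lemma bilinI [intro?]: "(\<And>x. lin t (\<lambda>y. B x y)) \<Longrightarrow> (\<And>y. lin t (\<lambda>x. B x y)) \<Longrightarrow> bilin t B"
  by (simp add: bilin_def)

lemma bilin_eqI:
  assumes "bilin t B" "bilin t C" "\<And>i j. B (bv i) (bv j) = C (bv i) (bv j)"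
  shows "B x y = C x y"
proof -
  have "B (bv i) y = C (bv i) y" for i
    by (rule lin_eqI[of t "B (bv i)"]) (use assms in \<open>simp_all add: bilin_def\<close>)
  then show ?thesis
    by (rule lin_eqI[of t "\<lambda>x. B x y" "\<lambda>x. C x y", rotated 2]) (use assms in \<open>simp_all add: bilin_def\<close>)
qed

definition tens :: "('i \<Rightarrow>\<^sub>0 rat) \<Rightarrow> ('j \<Rightarrow>\<^sub>0 rat) \<Rightarrow> ('i \<times> 'j \<Rightarrow>\<^sub>0 rat)" where
  "tens x y = lext pm_scale (\<lambda>i. lext pm_scale (\<lambda>j. bv (i, j)) y) x"

text \<open>For a tensor \<open>z = \<Sum> u \<otimes> v\<close>, the sum of the \<open>B u v\<close>, as in Sweedler's notation. Since only basis
  vectors are inserted into \<open>B\<close>, it need not be bilinear.\<close>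

definition sw :: "(rat \<Rightarrow> 'c \<Rightarrow> 'c) \<Rightarrow> ('i \<times> 'j \<Rightarrow>\<^sub>0 rat) \<Rightarrow>
    (('i \<Rightarrow>\<^sub>0 rat) \<Rightarrow> ('j \<Rightarrow>\<^sub>0 rat) \<Rightarrow> 'c::ab_group_add) \<Rightarrow> 'c" where
  "sw t z B = lext t (\<lambda>(i, j). B (bv i) (bv j)) z"

abbreviation psw :: "('i \<times> 'j \<Rightarrow>\<^sub>0 rat) \<Rightarrow> (('i \<Rightarrow>\<^sub>0 rat) \<Rightarrow> ('j \<Rightarrow>\<^sub>0 rat) \<Rightarrow> ('k \<Rightarrow>\<^sub>0 rat)) \<Rightarrow> ('k \<Rightarrow>\<^sub>0 rat)" where
  "psw \<equiv> sw pm_scale"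

lemma lin_tens1 [lin_intros]: "lin pm_scale f \<Longrightarrow> lin pm_scale (\<lambda>x. tens (f x) y)"
  unfolding tens_def by (intro lin_intros) auto

lemma lin_tens2 [lin_intros]: "lin pm_scale f \<Longrightarrow> lin pm_scale (\<lambda>x. tens y (f x))"
  unfolding tens_def by (intro lin_intros) auto

lemma tens_basis_vec [simp]: "tens (bv i) (bv j) = bv (i, j)"
  by (simp add: tens_def)

lemma lin_sw1 [lin_intros]: "vector_space t \<Longrightarrow> lin pm_scale f \<Longrightarrow> lin t (\<lambda>x. sw t (f x) B)"
  unfolding sw_def by (intro lin_intros)

lemma lin_sw2 [lin_intros]:
  assumes "vector_space t" "\<And>i j. lin t (\<lambda>x. B x (bv i) (bv j))"
  shows "lin t (\<lambda>x. sw t z (B x))"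
  unfolding sw_def by (intro lin_intros assms(1)) (simp add: case_prod_beta assms(2))

lemma sw_basis_vec [simp]: "vector_space t \<Longrightarrow> sw t (bv (i, j)) B = B (bv i) (bv j)"
  by (simp add: sw_def)

lemma sw_0 [simp]: "sw t 0 B = 0"
  by (simp add: sw_def lext_def)

lemma sw_add: "vector_space t \<Longrightarrow> sw t (y + z) B = sw t y B + sw t z B"
  by (rule lin_plus[of t "\<lambda>z. sw t z B"]) (intro lin_intros)

lemma sw_sum: "vector_space t \<Longrightarrow> sw t (sum f I) B = (\<Sum>i\<in>I. sw t (f i) B)"
  by (rule lin_sum[of t "\<lambda>z. sw t z B"]) (intro lin_intros)

lemma sw_tens:
  assumes "vector_space t" "bilin t B" shows "sw t (tens x y) B = B x y"
proof (rule bilin_eqI[of t "\<lambda>x y. sw t (tens x y) B" B, OF _ assms(2)])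
  show "bilin t (\<lambda>x y. sw t (tens x y) B)"
    by (intro bilinI lin_intros assms(1))
qed (simp add: assms)

lemma sw_tens_self [simp]: "psw z tens = z"
  by (rule lin_eqI[of pm_scale "\<lambda>z. psw z tens" "\<lambda>z. z"]) (auto intro!: lin_intros)

lemma sw_fun_add: "vector_space t \<Longrightarrow> sw t z (\<lambda>u v. B u v + C u v) = sw t z B + sw t z C"
proof -
  assume "vector_space t" then interpret vector_space t .
  show ?thesis by (simp add: sw_def lext_def scale_right_distrib sum.distrib case_prod_beta)
qed

lemma lin_sw: 
  assumes "vector_space s" "vector_space t" "lin t f"
  shows "f (psw z B) = sw t z (\<lambda>u v. f (B u v))"
  unfolding sw_def lext_def lin_sum[OF assms(3)] lin_smult[OF assms(3)]
  by (rule sum.cong) (auto simp: lin_smult[OF assms(3)])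

lemma sw_sw: "vector_space t \<Longrightarrow> sw t (psw z B) C = sw t z (\<lambda>u v. sw t (B u v) C)"
  by (rule lin_sw[of pm_scale t "\<lambda>x. sw t x C"]) (auto intro: lin_sw1 lin_id)

text \<open>Unit laws and coinvariance hold on certain basis vectors only. They can still be applied
  under a Sweedler sum, because \<open>B\<close> and \<open>C\<close> are compared just on the basis
  pairs that can occur in \<open>z\<close>.\<close>

lemma sw_cong:
  assumes "z \<in> pm.span (bv ` K)"
    "\<And>i j. (i, j) \<in> K \<Longrightarrow> B (bv i) (bv j) = C (bv i) (bv j)"
  shows "sw t z B = sw t z C"
  unfolding sw_def by (rule lext_cong_on[OF assms(1)]) (use assms(2) in auto)

lemma sw_in_subspace:
  assumes "module.subspace t U" "vector_space t" "z \<in> pm.span (bv ` K)"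
    "\<And>i j. (i, j) \<in> K \<Longrightarrow> B (bv i) (bv j) \<in> U"
  shows "sw t z B \<in> U"
  by (rule lin_in_subspace[of t U "\<lambda>z. sw t z B", OF assms(1,2) _ assms(3)])
     (use assms(2,4) in \<open>auto intro!: lin_intros\<close>)

section \<open>Words\<close>

text \<open>Over disjoint alphabets a shuffle shows which of its letters come from \<open>a\<close>,
  so both constituents are recovered by filtering.\<close>

lemma shuffles_iff_filter:
  assumes "set a \<inter> set b = {}"
  shows "w \<in> shuffles a b \<longleftrightarrow> filter (\<lambda>x. x \<in> set a) w = a \<and> filter (\<lambda>x. x \<notin> set a) w = b"
proof -
  have "w \<in> shuffles a b \<longleftrightarrow> partition (\<lambda>x. x \<in> set a) w = (a, b)"
    using inv_image_partition[of a "\<lambda>x. x \<in> set a" b] assms by blast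
  then show ?thesis by (simp add: o_def)
qed

lemma image_shuffles: "map f ` shuffles a b = shuffles (map f a) (map f b)"
proof (induction a b rule: shuffles.induct)
  case (3 x xs y ys)
  have "map f ` shuffles (x # xs) (y # ys) =
      (#) (f x) ` (map f ` shuffles xs (y # ys)) \<union> (#) (f y) ` (map f ` shuffles (x # xs) ys)"
    by (simp add: image_Un image_image)
  then show ?case by (simp only: 3) simp
qed simp_all

text \<open>A biword is handled through the words of (letter, degree) pairs that represent it. The letters
  need not be \<open>1, \<dots>, n\<close>, so that factors of a word and shuffles of two words are words again
  without standardisation.\<close>

type_synonym word = "(nat \<times> nat) list"

definition valid :: "word \<Rightarrow> bool" where
  "valid w \<longleftrightarrow> distinct (map fst w) \<and> (\<forall>p\<in>set w. 1 \<le> snd p)"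

text \<open>The biword that a word stands for, obtained by standardising its letters. Lists count
  from 0 and biwords from 1, hence \<open>i - 1\<close>.\<close>

definition nrm :: "word \<Rightarrow> biword" where
  "nrm w = std_segment 0 (length w) (\<lambda>i. fst (w ! (i - 1))) (\<lambda>i. snd (w ! (i - 1)))"

definition enc :: "biword \<Rightarrow> word" where
  "enc = (\<lambda>(n, \<sigma>, d). map (\<lambda>i. (\<sigma> i, d i)) [1..<Suc n])"

definition relabel :: "(nat \<Rightarrow> nat) \<Rightarrow> word \<Rightarrow> word" where
  "relabel \<phi> = map (apfst \<phi>)"

abbreviation letters :: "word \<Rightarrow> nat set" where
  "letters w \<equiv> fst ` set w"

abbreviation wv :: "word \<Rightarrow> gperm_vec" where
  "wv w \<equiv> bv (nrm w)"

lemma fst_nrm [simp]: "fst (nrm w) = length w"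
  by (simp add: nrm_def std_segment_def)

lemma length_enc [simp]: "length (enc b) = fst b"
  by (simp add: enc_def case_prod_beta)

lemma length_relabel [simp]: "length (relabel \<phi> w) = length w"
  by (simp add: relabel_def)

lemma relabel_Nil [simp]: "relabel \<phi> [] = []" "relabel \<phi> w = [] \<longleftrightarrow> w = []"
  by (simp_all add: relabel_def)

lemma relabel_append [simp]: "relabel \<phi> (u @ v) = relabel \<phi> u @ relabel \<phi> v"
  by (simp add: relabel_def)

lemma set_relabel: "set (relabel \<phi> w) = apfst \<phi> ` set w"
  by (simp add: relabel_def)

lemma letters_relabel: "letters (relabel \<phi> w) = \<phi> ` letters w"
  by (force simp: set_relabel)

lemma relabel_cong: "(\<And>x. x \<in> letters w \<Longrightarrow> \<phi> x = \<psi> x) \<Longrightarrow> relabel \<phi> w = relabel \<psi> w"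
  by (force simp: relabel_def intro!: prod_eqI)

lemma relabel_relabel: "relabel \<phi> (relabel \<psi> w) = relabel (\<lambda>x. \<phi> (\<psi> x)) w"
  by (auto simp: relabel_def)

lemma nth_relabel: "i < length w \<Longrightarrow> relabel \<phi> w ! i = (\<phi> (fst (w ! i)), snd (w ! i))"
  by (simp add: relabel_def apfst_def map_prod_def case_prod_beta)

lemma inj_on_apfst: "inj_on \<phi> (fst ` X) \<Longrightarrow> inj_on (apfst \<phi>) X"
  by (auto simp: inj_on_def)

lemma valid_append: "valid (u @ v) \<longleftrightarrow> valid u \<and> valid v \<and> letters u \<inter> letters v = {}"
  by (auto simp: valid_def)

lemma valid_imp_inj: "valid w \<Longrightarrow> i < length w \<Longrightarrow> j < length w \<Longrightarrow> fst (w ! i) = fst (w ! j) \<longleftrightarrow> i = j"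
  unfolding valid_def by (metis length_map nth_eq_iff_index_eq nth_map)

lemma valid_distinct: "valid w \<Longrightarrow> distinct w"
  by (simp add: valid_def distinct_map)

lemma valid_relabel:
  assumes "inj_on \<phi> (letters w)" "valid w" shows "valid (relabel \<phi> w)"
proof -
  have "map fst (relabel \<phi> w) = map \<phi> (map fst w)" by (simp add: relabel_def)
  moreover have "distinct (map \<phi> (map fst w))"
    using assms by (subst distinct_map) (simp add: valid_def)
  ultimately show ?thesis using assms(2) by (auto simp: valid_def set_relabel)
qed

lemma valid_shuffle: "valid (a @ b) \<Longrightarrow> w \<in> shuffles a b \<Longrightarrow> valid w"
proof -
  assume v: "valid (a @ b)" and w: "w \<in> shuffles a b"
  have "set a \<inter> set b = {}" using v by (auto simp: valid_append)
  with v w have "distinct w" by (metis distinct_disjoint_shuffles distinct_append valid_distinct)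
  moreover have "set w = set (a @ b)" using w by (simp add: set_shuffles)
  ultimately show "valid w"
    using v by (metis distinct_map valid_def)
qed

lemma word_as_letters: "(\<lambda>i. fst (w ! (i - 1))) ` {1..length w} = letters w"
proof -
  have "letters w = (\<lambda>i. fst (w ! i)) ` {..<length w}" by (force simp: set_conv_nth)
  also have "{..<length w} = (\<lambda>i. i - 1) ` {1..length w}"
    by (auto simp: image_iff intro!: bexI[of _ "Suc _"])
  finally show ?thesis by (simp add: image_image)
qed

lemma nrm_graded_perms: assumes "valid w" shows "nrm w \<in> graded_perms"
proof -
  have "std (length w) (\<lambda>j. fst (w ! (0 + j - 1))) permutes {1..length w}"
  proof (rule std_permutes, rule inj_onI)
    fix x y assume x: "x \<in> {1..length w}" and y: "y \<in> {1..length w}"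
      and "fst (w ! (0 + x - 1)) = fst (w ! (0 + y - 1))"
    then have "x - 1 = y - 1" by (subst valid_imp_inj[OF assms, symmetric]) auto
    with x y show "x = y" by (simp add: eq_diff_iff)
  qed
  moreover have "1 \<le> snd (w ! (j - 1))" if "j \<in> {1..length w}" for j
    using that nth_mem[of "j - 1" w] assms by (cases j) (auto simp: valid_def)
  ultimately show ?thesis by (auto simp: nrm_def std_segment_def graded_perms_def)
qed

lemma incr_bij_image:
  assumes "strict_mono_on I \<phi>" "x \<in> I"
  shows "incr_bij (\<phi> ` I) (\<phi> x) = incr_bij I x"
proof -
  have "{y \<in> \<phi> ` I. y \<le> \<phi> x} = \<phi> ` {y \<in> I. y \<le> x}"
    using assms by (auto simp: strict_mono_on_less_eq)
  moreover have "inj_on \<phi> {y \<in> I. y \<le> x}"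
    using assms by (metis (no_types, lifting) inj_on_subset mem_Collect_eq strict_mono_on_imp_inj_on subsetI)
  ultimately show ?thesis by (simp add: incr_bij_def card_image)
qed

lemma nrm_eqI:
  assumes "length u = length w"
    "\<And>i. i < length w \<Longrightarrow> incr_bij (letters u) (fst (u ! i)) = incr_bij (letters w) (fst (w ! i))"
    "\<And>i. i < length w \<Longrightarrow> snd (u ! i) = snd (w ! i)"
  shows "nrm u = nrm w"
proof -
  have "(\<lambda>j. fst (u ! (j - Suc 0))) ` {Suc 0..length w} = letters u"
    "(\<lambda>j. fst (w ! (j - Suc 0))) ` {Suc 0..length w} = letters w"
    using word_as_letters[of u] word_as_letters[of w] assms(1) by simp_all
  then show ?thesis using assms
    by (auto simp: nrm_def std_segment_def std_def fun_eq_iff)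
qed

text \<open>An order-preserving renaming changes no rank. This is the freedom that allows words over
  arbitrary letters to represent biwords.\<close>

lemma nrm_relabel:
  assumes "strict_mono_on (letters w) \<phi>" shows "nrm (relabel \<phi> w) = nrm w"
  by (rule nrm_eqI) (simp_all add: letters_relabel nth_relabel incr_bij_image[OF assms])

lemma nth_enc: "i < n \<Longrightarrow> enc (n, \<sigma>, d) ! i = (\<sigma> (Suc i), d (Suc i))"
  by (simp add: enc_def del: upt_Suc)

lemma enc_nrm: "enc (nrm w) = relabel (incr_bij (letters w)) w"
proof (rule nth_equalityI)
  fix i assume i: "i < length (enc (nrm w))"
  have "(\<lambda>j. fst (w ! (j - Suc 0))) ` {Suc 0..length w} = letters w"
    using word_as_letters[of w] by simp
  with i show "enc (nrm w) ! i = relabel (incr_bij (letters w)) w ! i"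
    by (simp add: nrm_def std_segment_def nth_enc nth_relabel std_def)
qed simp

lemma strict_mono_incr_bij: "strict_mono_on (letters w) (incr_bij (letters w))"
  by (rule incr_bij_strict_mono_on) simp

lemma letters_enc:
  assumes "b \<in> graded_perms" shows "letters (enc b) = {1..fst b}"
proof -
  obtain n \<sigma> d where b: "b = (n, \<sigma>, d)" by (metis prod_cases3)
  with assms have "\<sigma> ` {1..n} = {1..n}" by (simp add: graded_perms_def permutes_image)
  then show ?thesis by (simp add: b enc_def image_image atLeastLessThanSuc_atLeastAtMost del: upt_Suc)
qed

lemma valid_enc: assumes "b \<in> graded_perms" shows "valid (enc b)"
proof -
  obtain n \<sigma> d where b: "b = (n, \<sigma>, d)" by (metis prod_cases3)
  then have s: "\<sigma> permutes {1..n}" and d: "\<And>i. i \<in> {1..n} \<Longrightarrow> 1 \<le> d i"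
    using assms by (auto simp: graded_perms_def)
  have "distinct (map \<sigma> [1..<Suc n])"
    using permutes_inj_on[OF s] by (simp add: distinct_map del: upt_Suc)
  then show ?thesis using d by (auto simp: valid_def b enc_def o_def simp del: upt_Suc)
qed

lemma nrm_enc: assumes "b \<in> graded_perms" shows "nrm (enc b) = b"
proof -
  obtain n \<sigma> d where b: "b = (n, \<sigma>, d)" by (metis prod_cases3)
  then have s: "\<sigma> permutes {1..n}" and d: "\<And>i. i \<notin> {1..n} \<Longrightarrow> d i = 0"
    using assms by (auto simp: graded_perms_def)
  have "incr_bij {1..n} x = x" if "x \<in> {1..n}" for x
  proof -
    have "{y \<in> {1..n}. y \<le> x} = {1..x}" using that by auto
    then show ?thesis by (simp add: incr_bij_def)
  qed
  moreover have "\<sigma> i \<in> {1..n}" if "i \<in> {1..n}" for i using permutes_in_image[OF s] that by simp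
  moreover have "(\<lambda>j. fst (enc b ! (j - 1))) ` {1..n} = {1..n}"
    using word_as_letters[of "enc b"] letters_enc[OF assms] by (simp add: b)
  ultimately show ?thesis
    using permutes_not_in[OF s] d
    by (auto simp: b nrm_def std_segment_def std_def fun_eq_iff nth_enc)
qed

text \<open>The bound \<open>N\<close> lets representatives of several biwords be chosen one above
  the other, so that the concatenation of two of them represents their tensor product without
  further renaming.\<close>

lemma graded_perm_word:
  assumes "b \<in> graded_perms"
  obtains w where "valid w" "nrm w = b" "\<And>x. x \<in> letters w \<Longrightarrow> N < x" "length w = fst b"
proof
  let ?w = "relabel (\<lambda>x. x + N) (enc b)"
  have m: "strict_mono_on (letters (enc b)) (\<lambda>x. x + N)" by (simp add: strict_mono_on_def)
  then show "valid ?w"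
    by (intro valid_relabel strict_mono_on_imp_inj_on valid_enc assms)
  show "nrm ?w = b" using nrm_relabel[OF m] nrm_enc[OF assms] by simp
  show "N < x" if "x \<in> letters ?w" for x
    using that letters_enc[OF assms] by (auto simp: letters_relabel)
qed simp

lemma std_segment_eq_nrm:
  assumes "m + k \<le> n"
  shows "std_segment m k \<sigma> d = nrm (take k (drop m (enc (n, \<sigma>, d))))"
proof -
  have l: "length (take k (drop m (enc (n, \<sigma>, d)))) = k" using assms by simp
  have "take k (drop m (enc (n, \<sigma>, d))) ! (j - 1) = (\<sigma> (m + j), d (m + j))" if "j \<in> {1..k}" for j
    using that assms by (cases j) (simp_all add: nth_enc)
  then show ?thesis
    unfolding nrm_def l std_segment_def by (auto simp: std_def fun_eq_iff image_def intro!: arg_cong2[of _ _ _ _ incr_bij])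
qed

section \<open>Products and coproducts\<close>

definition splits :: "word \<Rightarrow> (word \<times> word) set" where
  "splits w = {(u, v). u @ v = w}"

lemma splits_eq: "splits w = (\<lambda>i. (take i w, drop i w)) ` {..length w}"
proof -
  have "(u, v) = (take (length u) w, drop (length u) w)" if "u @ v = w" for u v
    using that by auto
  then show ?thesis unfolding splits_def image_def
    by (auto intro!: bexI[of _ "length _"])
qed

lemma finite_splits [simp]: "finite (splits w)"
  by (simp add: splits_eq)

text \<open>Conditions on words that depend only on the relative order of the letters. Invariance is
  what makes a coproduct or, with \<open>invariant3\<close>, a product computable on any
  representing words.\<close>

definition invariant2 :: "(word \<Rightarrow> word \<Rightarrow> bool) \<Rightarrow> bool" where
  "invariant2 Q \<longleftrightarrow> (\<forall>\<phi> u v. strict_mono_on (letters (u @ v)) \<phi> \<longrightarrow>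
     Q (relabel \<phi> u) (relabel \<phi> v) = Q u v)"

definition invariant3 :: "(word \<Rightarrow> word \<Rightarrow> word \<Rightarrow> bool) \<Rightarrow> bool" where
  "invariant3 R \<longleftrightarrow> (\<forall>\<phi> a b w. strict_mono_on (letters (a @ b)) \<phi> \<longrightarrow> w \<in> shuffles a b \<longrightarrow>
     R (relabel \<phi> a) (relabel \<phi> b) (relabel \<phi> w) = R a b w)"

text \<open>All products and coproducts that occur are instances of \<open>prd\<close> and \<open>cop\<close>. They vanish on basis
  vectors outside of \<^const>\<open>graded_perms\<close>, which makes their identities hold unconditionally.\<close>

definition cop :: "(word \<Rightarrow> word \<Rightarrow> bool) \<Rightarrow> gperm_vec \<Rightarrow> gperm_tensor" where
  "cop Q = lext pm_scale (\<lambda>b. if b \<in> graded_perms then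
     \<Sum>(u, v)\<in>{(u, v). (u, v) \<in> splits (enc b) \<and> Q u v}. bv (nrm u, nrm v) else 0)"

definition prd :: "(word \<Rightarrow> word \<Rightarrow> word \<Rightarrow> bool) \<Rightarrow>
    gperm_vec \<Rightarrow> gperm_vec \<Rightarrow> gperm_vec" where
  "prd R x y = lext pm_scale (\<lambda>i. lext pm_scale (\<lambda>j. if i \<in> graded_perms \<and> j \<in> graded_perms then
     \<Sum>w\<in>{w \<in> shuffles (enc i) (relabel (\<lambda>x. x + fst i) (enc j)).
            R (enc i) (relabel (\<lambda>x. x + fst i) (enc j)) w}. wv w else 0) y) x"

lemma lin_cop [lin_intros]: "lin pm_scale f \<Longrightarrow> lin pm_scale (\<lambda>x. cop Q (f x))"
  unfolding cop_def by (intro lin_intros) auto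

lemma lin_prd1 [lin_intros]: "lin pm_scale f \<Longrightarrow> lin pm_scale (\<lambda>x. prd R (f x) y)"
  unfolding prd_def by (intro lin_intros) auto

lemma lin_prd2 [lin_intros]: "lin pm_scale f \<Longrightarrow> lin pm_scale (\<lambda>x. prd R y (f x))"
  unfolding prd_def by (intro lin_intros) auto

lemma cop_outside [simp]: "b \<notin> graded_perms \<Longrightarrow> cop Q (bv b) = 0"
  by (simp add: cop_def)

lemma prd_outside1 [simp]: assumes "i \<notin> graded_perms" shows "prd R (bv i) y = 0"
  by (rule lin_eqI[of pm_scale "\<lambda>y. prd R (bv i) y" "\<lambda>y. 0"])
     (use assms in \<open>auto intro!: lin_intros simp: prd_def\<close>)

lemma prd_outside2 [simp]: assumes "j \<notin> graded_perms" shows "prd R x (bv j) = 0"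
  by (rule lin_eqI[of pm_scale "\<lambda>x. prd R x (bv j)" "\<lambda>y. 0"])
     (use assms in \<open>auto intro!: lin_intros simp: prd_def\<close>)

lemma prd_0 [simp]: "prd R 0 y = 0" "prd R x 0 = 0"
  by (rule lin_0[of pm_scale "\<lambda>x. prd R x y"], intro lin_intros)
     (rule lin_0[of pm_scale "\<lambda>y. prd R x y"], intro lin_intros)

lemma cop_0 [simp]: "cop Q 0 = 0"
  by (rule lin_0[of pm_scale "\<lambda>x. cop Q x"], intro lin_intros)

lemma prd_sum: "prd R (sum f I) y = (\<Sum>i\<in>I. prd R (f i) y)" "prd R x (sum f I) = (\<Sum>i\<in>I. prd R x (f i))"
  by (rule lin_sum[of pm_scale "\<lambda>x. prd R x y"], intro lin_intros)
     (rule lin_sum[of pm_scale "\<lambda>y. prd R x y"], intro lin_intros)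

lemma cop_sum: "cop Q (sum f I) = (\<Sum>i\<in>I. cop Q (f i))"
  by (rule lin_sum[of pm_scale "\<lambda>x. cop Q x"], intro lin_intros)

lemma strict_mono_on_subset': "strict_mono_on B f \<Longrightarrow> A \<subseteq> B \<Longrightarrow> strict_mono_on A f"
  by (auto simp: strict_mono_on_def)

text \<open>Replacing letters by their ranks turns \<open>w\<close> into \<open>enc (nrm w)\<close>.
  It maps the cuts of the one bijectively to the cuts of the other, keeps \<open>Q\<close> by
  invariance and keeps the standardisation of both factors.\<close>

lemma cop_word:
  assumes "valid w" "invariant2 Q"
  shows "cop Q (wv w) = (\<Sum>(u, v)\<in>{(u, v). (u, v) \<in> splits w \<and> Q u v}. bv (nrm u, nrm v))"
proof -
  let ?f = "incr_bij (letters w)"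
  have m: "strict_mono_on (letters (u @ v)) ?f" if "u @ v = w" for u v
    using strict_mono_incr_bij that by simp
  have inj: "inj_on (apfst ?f) (set w)"
    by (intro inj_on_apfst strict_mono_on_imp_inj_on strict_mono_incr_bij)
  have Q: "Q (relabel ?f u) (relabel ?f v) = Q u v" if "u @ v = w" for u v
    using assms(2) m[OF that] by (simp add: invariant2_def)
  have n: "nrm (relabel ?f u) = nrm u \<and> nrm (relabel ?f v) = nrm v" if "u @ v = w" for u v
    using m[OF that] by (auto intro!: nrm_relabel elim!: strict_mono_on_subset')
  have preimage: "\<exists>u' v'. u' @ v' = w \<and> u = relabel ?f u' \<and> v = relabel ?f v'" if "u @ v = relabel ?f w" for u v
    using that unfolding relabel_def append_eq_map_conv by blast
  have "(\<Sum>(u, v)\<in>{(u, v). (u, v) \<in> splits w \<and> Q u v}. bv (nrm u, nrm v)) =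
        (\<Sum>(u, v)\<in>{(u, v). (u, v) \<in> splits (relabel ?f w) \<and> Q u v}. bv (nrm u, nrm v) :: _ \<Rightarrow>\<^sub>0 rat)"
  proof (rule sum.reindex_cong[symmetric, where l = "map_prod (relabel ?f) (relabel ?f)"])
    show "inj_on (map_prod (relabel ?f) (relabel ?f)) {(u, v). (u, v) \<in> splits w \<and> Q u v}"
    proof (rule inj_onI)
      fix p q assume *: "p \<in> {(u, v). (u, v) \<in> splits w \<and> Q u v}" "q \<in> {(u, v). (u, v) \<in> splits w \<and> Q u v}"
        "map_prod (relabel ?f) (relabel ?f) p = map_prod (relabel ?f) (relabel ?f) q"
      then have "relabel ?f (fst p) = relabel ?f (fst q)" by (auto simp: map_prod_def case_prod_beta)
      from arg_cong[where f = length, OF this] have "length (fst p) = length (fst q)" by simp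
      moreover have "fst p @ snd p = fst q @ snd q" using * by (auto simp: splits_def)
      ultimately show "p = q" by (simp add: prod_eq_iff)
    qed
    show "{(u, v). (u, v) \<in> splits (relabel ?f w) \<and> Q u v} =
        map_prod (relabel ?f) (relabel ?f) ` {(u, v). (u, v) \<in> splits w \<and> Q u v}"
    proof (intro equalityI subsetI)
      fix p assume "p \<in> {(u, v). (u, v) \<in> splits (relabel ?f w) \<and> Q u v}"
      then obtain u v where p: "p = (u, v)" "u @ v = relabel ?f w" "Q u v" by (auto simp: splits_def)
      from preimage[OF p(2)] obtain u' v' where
        "u' @ v' = w" "u = relabel ?f u'" "v = relabel ?f v'" by blast
      with p Q show "p \<in> map_prod (relabel ?f) (relabel ?f) ` {(u, v). (u, v) \<in> splits w \<and> Q u v}"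
        by (intro image_eqI[of _ _ "(u', v')"]) (auto simp: splits_def)
    next
      fix p assume "p \<in> map_prod (relabel ?f) (relabel ?f) ` {(u, v). (u, v) \<in> splits w \<and> Q u v}"
      then obtain u v where "p = (relabel ?f u, relabel ?f v)" "u @ v = w" "Q u v" by (auto simp: splits_def)
      with Q[of u v] show "p \<in> {(u, v). (u, v) \<in> splits (relabel ?f w) \<and> Q u v}"
        by (auto simp: splits_def simp flip: relabel_append)
    qed
  qed (use n in \<open>auto simp: splits_def\<close>)
  then show ?thesis
    by (simp add: cop_def nrm_graded_perms[OF assms(1)] enc_nrm)
qed

abbreviation below :: "word \<Rightarrow> word \<Rightarrow> bool" where
  "below a b \<equiv> \<forall>p\<in>set a. \<forall>q\<in>set b. fst p < fst q"

text \<open>When all letters of \<open>a\<close> lie below those of \<open>b\<close>, the rank of a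
  letter in \<open>a @ b\<close> is its rank in \<open>a\<close>, or its rank in \<open>b\<close>
  plus the length of \<open>a\<close>. This is exactly the shift in \<sigma> \<otimes> \<tau>, so
  the shuffles in the definition are the shuffles of \<open>a\<close> and \<open>b\<close> up to
  renaming.\<close>

lemma prd_word:
  assumes v: "valid (a @ b)" and ab: "below a b" and R: "invariant3 R"
  shows "prd R (wv a) (wv b) = (\<Sum>w\<in>{w \<in> shuffles a b. R a b w}. wv w)"
proof -
  let ?f = "incr_bij (letters (a @ b))"
  have va: "valid a" and vb: "valid b" using v by (auto simp: valid_append)
  have m: "strict_mono_on (letters (a @ b)) ?f" by (rule strict_mono_incr_bij)
  have fa: "?f x = incr_bij (letters a) x" if "x \<in> letters a" for x
  proof -
    have "{y \<in> letters (a @ b). y \<le> x} = {y \<in> letters a. y \<le> x}" using that ab by fastforce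
    then show ?thesis by (simp add: incr_bij_def)
  qed
  have fb: "?f x = incr_bij (letters b) x + length a" if "x \<in> letters b" for x
  proof -
    have "{y \<in> letters (a @ b). y \<le> x} = letters a \<union> {y \<in> letters b. y \<le> x}" using that ab by fastforce
    moreover have "letters a \<inter> {y \<in> letters b. y \<le> x} = {}" using v by (auto simp: valid_append)
    moreover have "card (letters a) = length a"
      using va unfolding valid_def by (metis distinct_card length_map list.set_map)
    ultimately show ?thesis by (simp add: incr_bij_def card_Un_disjoint)
  qed
  have ea: "enc (nrm a) = relabel ?f a" unfolding enc_nrm by (rule relabel_cong) (rule fa[symmetric])
  have eb: "relabel (\<lambda>x. x + length a) (enc (nrm b)) = relabel ?f b"
    unfolding enc_nrm relabel_relabel by (rule relabel_cong) (rule fb[symmetric])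
  have inj: "inj_on (apfst ?f) (set (a @ b))"
    by (intro inj_on_apfst strict_mono_on_imp_inj_on m)
  have "prd R (wv a) (wv b) =
    (\<Sum>w\<in>{w \<in> shuffles (relabel ?f a) (relabel ?f b). R (relabel ?f a) (relabel ?f b) w}. wv w)"
    using nrm_graded_perms[OF va] nrm_graded_perms[OF vb] by (simp add: prd_def ea eb)
  also have "{w \<in> shuffles (relabel ?f a) (relabel ?f b). R (relabel ?f a) (relabel ?f b) w} =
      relabel ?f ` {w \<in> shuffles a b. R a b w}"
    using R m unfolding invariant3_def
    by (auto simp: relabel_def image_shuffles[symmetric])
  also have "(\<Sum>w\<in>relabel ?f ` {w \<in> shuffles a b. R a b w}. wv w) =
      (\<Sum>w\<in>{w \<in> shuffles a b. R a b w}. wv (relabel ?f w))"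
  proof (rule sum.reindex_cong[OF _ refl refl], rule inj_onI)
    fix x y assume "x \<in> {w \<in> shuffles a b. R a b w}" "y \<in> {w \<in> shuffles a b. R a b w}"
      "relabel ?f x = relabel ?f y"
    moreover from this have "set x \<union> set y = set (a @ b)" by (auto dest: set_shuffles)
    ultimately show "x = y" using inj by (simp add: relabel_def inj_on_map_eq_map)
  qed
  also have "\<dots> = (\<Sum>w\<in>{w \<in> shuffles a b. R a b w}. wv w)"
  proof (rule sum.cong[OF refl])
    fix w assume "w \<in> {w \<in> shuffles a b. R a b w}"
    then have "letters w = letters (a @ b)" by (auto simp: set_shuffles)
    then show "wv (relabel ?f w) = wv w" using m by (simp add: nrm_relabel)
  qed
  finally show ?thesis .
qed

section \<open>Associativity of shuffle products with side conditions\<close>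

lemma shuffles_iff_filters:
  assumes "set a \<inter> set b = {}"
  shows "w \<in> shuffles a b \<longleftrightarrow> set w \<subseteq> set a \<union> set b \<and>
    filter (\<lambda>x. x \<in> set a) w = a \<and> filter (\<lambda>x. x \<in> set b) w = b"
proof
  assume w: "w \<in> shuffles a b"
  show "set w \<subseteq> set a \<union> set b \<and> filter (\<lambda>x. x \<in> set a) w = a \<and> filter (\<lambda>x. x \<in> set b) w = b"
    using filter_shuffles_disjoint1(1)[OF assms w] filter_shuffles_disjoint2(1)[OF assms w] set_shuffles[OF w]
    by simp
next
  assume w: "set w \<subseteq> set a \<union> set b \<and> filter (\<lambda>x. x \<in> set a) w = a \<and> filter (\<lambda>x. x \<in> set b) w = b"
  then have "filter (\<lambda>x. x \<notin> set a) w = filter (\<lambda>x. x \<in> set b) w"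
    using assms by (intro filter_cong) auto
  with w show "w \<in> shuffles a b" using partition_in_shuffles[of w "\<lambda>x. x \<in> set a"] by simp
qed

text \<open>A shuffle \<open>w\<close> of three words determines the intermediate shuffle
  \<open>u\<close> by deleting one alphabet. The remaining conditions are symmetric in the three
  words, so the other bracketing is indexed by the same \<open>w\<close>.\<close>

lemma shuffles_left_assoc:
  assumes d: "set a \<inter> set b = {}" "set a \<inter> set c = {}" "set b \<inter> set c = {}"
  shows "u \<in> shuffles a b \<and> w \<in> shuffles u c \<longleftrightarrow> set w \<subseteq> set a \<union> set b \<union> set c \<and>
    filter (\<lambda>x. x \<in> set a) w = a \<and> filter (\<lambda>x. x \<in> set b) w = b \<and> filter (\<lambda>x. x \<in> set c) w = c \<and>
    u = filter (\<lambda>x. x \<notin> set c) w" (is "?L \<longleftrightarrow> ?R")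
proof -
  have f: "filter (\<lambda>x. x \<in> set a) (filter (\<lambda>x. x \<notin> set c) w) = filter (\<lambda>x. x \<in> set a) w"
    "filter (\<lambda>x. x \<in> set b) (filter (\<lambda>x. x \<notin> set c) w) = filter (\<lambda>x. x \<in> set b) w"
    using d by (auto intro!: filter_cong)
  show ?thesis
  proof
    assume L: ?L
    then have su: "set u = set a \<union> set b" by (auto simp: set_shuffles)
    then have uc: "set u \<inter> set c = {}" using d by auto
    have u: "u = filter (\<lambda>x. x \<notin> set c) w" using filter_shuffles_disjoint2(2)[OF uc] L by simp
    moreover have "set w = set u \<union> set c" "filter (\<lambda>x. x \<in> set c) w = c"
      using L filter_shuffles_disjoint2(1)[OF uc] by (auto simp: set_shuffles)
    ultimately show ?R using L f su by (simp add: shuffles_iff_filters[OF d(1)])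
  next
    assume R: ?R
    then have u: "u \<in> shuffles a b" using f by (auto simp: shuffles_iff_filters[OF d(1)])
    then have su: "set u = set a \<union> set b" by (auto simp: set_shuffles)
    then have uc: "set u \<inter> set c = {}" using d by auto
    have "filter (\<lambda>x. x \<in> set u) w = filter (\<lambda>x. x \<notin> set c) w"
      using R su uc by (intro filter_cong) auto
    also have "\<dots> = u" using R by blast
    finally have "filter (\<lambda>x. x \<in> set u) w = u" .
    moreover have "set w \<subseteq> set u \<union> set c" using R unfolding su by blast
    ultimately have "set w \<subseteq> set u \<union> set c \<and> filter (\<lambda>x. x \<in> set u) w = u \<and> filter (\<lambda>x. x \<in> set c) w = c"
      using R by blast
    then show ?L using u shuffles_iff_filters[OF uc, of w] by blast
  qed
qed

lemma shuffles_right_assoc: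
  assumes d: "set a \<inter> set b = {}" "set a \<inter> set c = {}" "set b \<inter> set c = {}"
  shows "u \<in> shuffles b c \<and> w \<in> shuffles a u \<longleftrightarrow> set w \<subseteq> set a \<union> set b \<union> set c \<and>
    filter (\<lambda>x. x \<in> set a) w = a \<and> filter (\<lambda>x. x \<in> set b) w = b \<and> filter (\<lambda>x. x \<in> set c) w = c \<and>
    u = filter (\<lambda>x. x \<notin> set a) w"
  using shuffles_left_assoc[of b c a u w] d by (auto simp: shuffles_commutes[of a])

lemma below_disjoint: "below a b \<Longrightarrow> letters a \<inter> letters b = {}"
proof (rule equals0I)
  fix x assume "below a b" "x \<in> letters a \<inter> letters b"
  then obtain p q where "p \<in> set a" "x = fst p" "q \<in> set b" "x = fst q" by blast
  with \<open>below a b\<close> show False by force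
qed

lemma trilin_eqI:
  assumes "\<And>y z. lin t (\<lambda>x. B x y z)" "\<And>x z. lin t (\<lambda>y. B x y z)" "\<And>x y. lin t (\<lambda>z. B x y z)"
    "\<And>y z. lin t (\<lambda>x. C x y z)" "\<And>x z. lin t (\<lambda>y. C x y z)" "\<And>x y. lin t (\<lambda>z. C x y z)"
    "\<And>i j k. B (bv i) (bv j) (bv k) = C (bv i) (bv j) (bv k)"
  shows "B x y z = C x y z"
proof -
  have "B (bv i) y z = C (bv i) y z" for i
    by (rule bilin_eqI[of t "B (bv i)"]) (use assms in \<open>auto intro: bilinI\<close>)
  then show ?thesis by (rule lin_eqI[of t "\<lambda>x. B x y z" "\<lambda>x. C x y z", OF assms(1,4)])
qed

text \<open>Both sides are sums over shuffles \<open>w\<close> of three words, and the intermediate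
  words are functions of \<open>w\<close>. An identity of this form therefore reduces to an
  equivalence of side conditions for each single \<open>w\<close>; the three dendriform axioms and
  the associativity of \<open>mul\<close> are all instances.\<close>

lemma prd_assoc:
  assumes inv: "invariant3 R1" "invariant3 R2" "invariant3 R3" "invariant3 R4"
    and R: "\<And>a b c u u' w. valid (a @ b @ c) \<Longrightarrow> u \<in> shuffles a b \<Longrightarrow> w \<in> shuffles u c \<Longrightarrow>
      u' \<in> shuffles b c \<Longrightarrow> w \<in> shuffles a u' \<Longrightarrow> R1 a b u \<and> R2 u c w \<longleftrightarrow> R3 b c u' \<and> R4 a u' w"
  shows "prd R2 (prd R1 x y) z = prd R4 x (prd R3 y z)"
proof -
  have *: "prd R2 (prd R1 (bv i) (bv j)) (bv k) =
      prd R4 (bv i) (prd R3 (bv j) (bv k))" for i j k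
  proof (cases "i \<in> graded_perms \<and> j \<in> graded_perms \<and> k \<in> graded_perms")
    case False then show ?thesis by auto
  next
    case True
    obtain a where a: "valid a" "nrm a = i" using True graded_perm_word by metis
    obtain N where N: "\<And>x. x \<in> letters a \<Longrightarrow> x \<le> N" using finite_nat_set_iff_bounded_le[of "letters a"] by auto
    obtain b where b: "valid b" "nrm b = j" "\<And>x. x \<in> letters b \<Longrightarrow> N < x" using True graded_perm_word by metis
    obtain M where M: "\<And>x. x \<in> letters (a @ b) \<Longrightarrow> x \<le> M" using finite_nat_set_iff_bounded_le[of "letters (a @ b)"] by auto
    obtain c where c: "valid c" "nrm c = k" "\<And>x. x \<in> letters c \<Longrightarrow> M < x" using True graded_perm_word by metis
    have ab: "below a b" using N b(3) by (meson imageI le_less_trans)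
    have "below (a @ b) c" using M c(3) by (meson imageI le_less_trans)
    then have ac: "below a c" and bc: "below b c" by auto
    have v: "valid (a @ b @ c)"
      using a b c below_disjoint[OF ab] below_disjoint[OF ac] below_disjoint[OF bc]
      by (simp add: valid_append image_Un Int_Un_distrib)
    have d: "set a \<inter> set b = {}" "set a \<inter> set c = {}" "set b \<inter> set c = {}"
      using valid_distinct[OF v] by auto
    have vab: "valid (a @ b)" and vbc: "valid (b @ c)" using v by (auto simp: valid_append)
    have 1: "prd R2 (wv u) (wv c) = (\<Sum>w\<in>{w \<in> shuffles u c. R2 u c w}. wv w)" if "u \<in> shuffles a b" for u
    proof (rule prd_word[OF _ _ inv(2)])
      show "below u c" using ac bc that by (auto simp: set_shuffles)
      show "valid (u @ c)" using valid_shuffle[OF vab that] v that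
        by (auto simp: valid_append set_shuffles image_Un)
    qed
    have 2: "prd R4 (wv a) (wv u) = (\<Sum>w\<in>{w \<in> shuffles a u. R4 a u w}. wv w)" if "u \<in> shuffles b c" for u
    proof (rule prd_word[OF _ _ inv(4)])
      show "below a u" using ab ac that by (auto simp: set_shuffles)
      show "valid (a @ u)" using valid_shuffle[OF vbc that] v that
        by (auto simp: valid_append set_shuffles image_Un)
    qed
    \<comment> \<open>The index pairs consist of an intermediate and a final word. Projection to the
      final word is injective on both sets and has the same image.\<close>
    let ?L = "SIGMA u:{u \<in> shuffles a b. R1 a b u}. {w \<in> shuffles u c. R2 u c w}"
    let ?R = "SIGMA u:{u \<in> shuffles b c. R3 b c u}. {w \<in> shuffles a u. R4 a u w}"
    note s3 = shuffles_left_assoc[OF d] shuffles_right_assoc[OF d]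
    have "u = filter (\<lambda>x. x \<notin> set c) w" if "u \<in> shuffles a b" "w \<in> shuffles u c" for u w
      using s3(1) that by blast
    then have inj1: "inj_on snd ?L" by (intro inj_onI, clarsimp) metis
    have "u = filter (\<lambda>x. x \<notin> set a) w" if "u \<in> shuffles b c" "w \<in> shuffles a u" for u w
      using s3(2) that by blast
    then have inj2: "inj_on snd ?R" by (intro inj_onI, clarsimp) metis
    have eq: "snd ` ?L = snd ` ?R"
    proof -
      have RR: "R1 a b u \<and> R2 u c w \<longleftrightarrow> R3 b c u' \<and> R4 a u' w"
        if "u \<in> shuffles a b \<and> w \<in> shuffles u c" "u' \<in> shuffles b c \<and> w \<in> shuffles a u'" for u u' w
        using R[OF v] that by blast
      have ex: "(\<exists>u. u \<in> shuffles a b \<and> w \<in> shuffles u c) \<longleftrightarrow> (\<exists>u. u \<in> shuffles b c \<and> w \<in> shuffles a u)" for w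
        unfolding s3 by blast
      have L: "w \<in> snd ` ?L \<longleftrightarrow> (\<exists>u. u \<in> shuffles a b \<and> w \<in> shuffles u c \<and> R1 a b u \<and> R2 u c w)" for w by force
      have R: "w \<in> snd ` ?R \<longleftrightarrow> (\<exists>u. u \<in> shuffles b c \<and> w \<in> shuffles a u \<and> R3 b c u \<and> R4 a u w)" for w by force
      show ?thesis unfolding set_eq_iff L R using RR ex by metis
    qed
    have "prd R2 (prd R1 (wv a) (wv b)) (wv c) =
        (\<Sum>u\<in>{u \<in> shuffles a b. R1 a b u}. \<Sum>w\<in>{w \<in> shuffles u c. R2 u c w}. wv w)"
      by (simp add: prd_word[OF vab ab inv(1)] prd_sum 1)
    also have "\<dots> = (\<Sum>(u, w)\<in>?L. wv w)" by (rule sum.Sigma) auto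
    also have "\<dots> = (\<Sum>(u, w)\<in>?R. wv w)"
      using sum.reindex[OF inj1, of wv] sum.reindex[OF inj2, of wv] eq by (simp add: case_prod_beta o_def)
    also have "\<dots> = (\<Sum>u\<in>{u \<in> shuffles b c. R3 b c u}. \<Sum>w\<in>{w \<in> shuffles a u. R4 a u w}. wv w)"
      by (rule sum.Sigma[symmetric]) auto
    also have "\<dots> = prd R4 (wv a) (prd R3 (wv b) (wv c))"
      by (simp add: prd_word[OF vbc bc inv(3)] prd_sum 2)
    finally show ?thesis using a b c by simp
  qed
  show ?thesis by (rule trilin_eqI[of pm_scale "\<lambda>x y z. prd R2 (prd R1 x y) z"]) (intro lin_intros *)+
qed

section \<open>Coassociativity of coproducts with side conditions\<close>

lemma sw_cop_word:
  assumes "vector_space t" "valid w" "invariant2 Q"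
  shows "sw t (cop Q (wv w)) B = (\<Sum>(u, v)\<in>{(u, v). (u, v) \<in> splits w \<and> Q u v}. B (wv u) (wv v))"
  unfolding cop_word[OF assms(2,3)] sw_sum[OF assms(1)]
  by (rule sum.cong) (auto simp: assms(1))

text \<open>Both sides sum over factorisations of a word into three pieces, so only the side
  conditions have to be matched. Inserting an arbitrary \<open>B\<close> takes the place of a triple
  tensor product; \<open>B\<close> need not be trilinear.\<close>

lemma cop_coassoc:
  fixes B :: "_ \<Rightarrow> _ \<Rightarrow> _ \<Rightarrow> 'c::ab_group_add"
  assumes t: "vector_space t" and inv: "invariant2 Q1" "invariant2 Q2" "invariant2 Q3" "invariant2 Q4"
    and Q: "\<And>u v w. valid (u @ v @ w) \<Longrightarrow> Q1 (u @ v) w \<and> Q2 u v \<longleftrightarrow> Q3 u (v @ w) \<and> Q4 v w"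
  shows "sw t (cop Q1 x) (\<lambda>u v. sw t (cop Q2 u) (\<lambda>u1 u2. B u1 u2 v)) =
         sw t (cop Q3 x) (\<lambda>u v. sw t (cop Q4 v) (\<lambda>v1 v2. B u v1 v2))"
proof (rule lin_eqI[of t "\<lambda>x. sw t (cop Q1 x) (\<lambda>u v. sw t (cop Q2 u) (\<lambda>u1 u2. B u1 u2 v))"
      "\<lambda>x. sw t (cop Q3 x) (\<lambda>u v. sw t (cop Q4 v) (\<lambda>v1 v2. B u v1 v2))"])
  fix b
  let ?goal = "sw t (cop Q1 (bv b)) (\<lambda>u v. sw t (cop Q2 u) (\<lambda>u1 u2. B u1 u2 v)) =
         sw t (cop Q3 (bv b)) (\<lambda>u v. sw t (cop Q4 v) (\<lambda>v1 v2. B u v1 v2))"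
  show ?goal
  proof (cases "b \<in> graded_perms")
    case False then show ?thesis by simp
  next
    case True
    define w where "w = enc b"
    have w: "valid w" "b = nrm w" using valid_enc nrm_enc True by (simp_all add: w_def)
    have Q': "Q3 u (v @ w) \<longleftrightarrow> True" "Q4 v w \<longleftrightarrow> True" if "valid (u @ v @ w)" "Q1 (u @ v) w" "Q2 u v" for u v w
      using Q that by blast+
    have Q'': "Q1 (u @ v) w \<longleftrightarrow> True" "Q2 u v \<longleftrightarrow> True" if "valid (u @ v @ w)" "Q3 u (v @ w)" "Q4 v w" for u v w
      using Q that by blast+
    have v: "valid u \<and> valid v" if "(u, v) \<in> splits w" for u v
      using that w by (auto simp: splits_def valid_append)
    have "sw t (cop Q1 (wv w)) (\<lambda>u v. sw t (cop Q2 u) (\<lambda>u1 u2. B u1 u2 v)) =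
      (\<Sum>(u, v)\<in>{(u, v). (u, v) \<in> splits w \<and> Q1 u v}.
        \<Sum>(u1, u2)\<in>{(u1, u2). (u1, u2) \<in> splits u \<and> Q2 u1 u2}. B (wv u1) (wv u2) (wv v))"
      unfolding sw_cop_word[OF t w(1) inv(1)] using v
      by (intro sum.cong refl) (auto simp: sw_cop_word[OF t _ inv(2)])
    also have "\<dots> = (\<Sum>(p, q)\<in>(SIGMA p:{(u, v). (u, v) \<in> splits w \<and> Q1 u v}.
        {(u1, u2). (u1, u2) \<in> splits (fst p) \<and> Q2 u1 u2}). B (wv (fst q)) (wv (snd q)) (wv (snd p)))"
      by (subst sum.Sigma[symmetric]) (auto simp: case_prod_beta intro!: finite_subset[OF _ finite_splits] sum.cong)
    also have "\<dots> = (\<Sum>(p, q)\<in>(SIGMA p:{(u, v). (u, v) \<in> splits w \<and> Q3 u v}.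
        {(v1, v2). (v1, v2) \<in> splits (snd p) \<and> Q4 v1 v2}). B (wv (fst p)) (wv (fst q)) (wv (snd q)))"
      by (rule sum.reindex_bij_witness[of _ "\<lambda>(p, q). ((fst p @ fst q, snd q), (fst p, fst q))"
            "\<lambda>(p, q). ((fst q, snd q @ snd p), (snd q, snd p))"])
         (use Q' Q'' w(1) in \<open>auto simp: splits_def\<close>)
    also have "\<dots> = (\<Sum>(u, v)\<in>{(u, v). (u, v) \<in> splits w \<and> Q3 u v}.
        \<Sum>(v1, v2)\<in>{(v1, v2). (v1, v2) \<in> splits v \<and> Q4 v1 v2}. B (wv u) (wv v1) (wv v2))"
      by (subst sum.Sigma[symmetric]) (auto simp: case_prod_beta intro!: finite_subset[OF _ finite_splits] sum.cong)
    also have "\<dots> = sw t (cop Q3 (wv w)) (\<lambda>u v. sw t (cop Q4 v) (\<lambda>v1 v2. B u v1 v2))"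
      unfolding sw_cop_word[OF t w(1) inv(3)] using v
      by (intro sum.cong refl) (auto simp: sw_cop_word[OF t _ inv(4)])
    finally show ?thesis using w by simp
  qed
qed (rule lin_sw1[OF t], intro lin_intros)+

section \<open>Compatibility of products with coproducts\<close>

lemma tens_sum: "tens (sum f I) y = (\<Sum>i\<in>I. tens (f i) y)" "tens x (sum g J) = (\<Sum>j\<in>J. tens x (g j))"
  by (rule lin_sum[of pm_scale "\<lambda>x. tens x y"], intro lin_intros)
     (rule lin_sum[of pm_scale "\<lambda>y. tens x y"], intro lin_intros)

abbreviation mul :: "gperm_vec \<Rightarrow> gperm_vec \<Rightarrow> gperm_vec" where
  "mul \<equiv> prd (\<lambda>_ _ _. True)"

text \<open>A cut of a shuffle induces a cut of each constituent, namely into the letters before and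
  after it. This is the combinatorial core of the bialgebra law.\<close>

lemma append_in_shuffles_iff:
  assumes "set a \<inter> set b = {}"
  shows "u @ v \<in> shuffles a b \<longleftrightarrow>
    (\<exists>a1 a2 b1 b2. a = a1 @ a2 \<and> b = b1 @ b2 \<and> u \<in> shuffles a1 b1 \<and> v \<in> shuffles a2 b2)"
proof
  assume "u @ v \<in> shuffles a b"
  then have "a = filter (\<lambda>x. x \<in> set a) u @ filter (\<lambda>x. x \<in> set a) v"
    "b = filter (\<lambda>x. x \<notin> set a) u @ filter (\<lambda>x. x \<notin> set a) v"
    by (simp_all add: shuffles_iff_filter[OF assms])
  with partition_in_shuffles[of u "\<lambda>x. x \<in> set a"] partition_in_shuffles[of v "\<lambda>x. x \<in> set a"]
  show "\<exists>a1 a2 b1 b2. a = a1 @ a2 \<and> b = b1 @ b2 \<and> u \<in> shuffles a1 b1 \<and> v \<in> shuffles a2 b2"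
    by blast
next
  assume "\<exists>a1 a2 b1 b2. a = a1 @ a2 \<and> b = b1 @ b2 \<and> u \<in> shuffles a1 b1 \<and> v \<in> shuffles a2 b2"
  then obtain a1 a2 b1 b2 where *: "a = a1 @ a2" "b = b1 @ b2" "u \<in> shuffles a1 b1" "v \<in> shuffles a2 b2"
    by blast
  with assms have d: "set a1 \<inter> set b1 = {}" "set a2 \<inter> set b2 = {}" by auto
  have s: "set u = set a1 \<union> set b1" "set v = set a2 \<union> set b2" using * by (simp_all add: set_shuffles)
  have "filter (\<lambda>x. x \<in> set a) u = filter (\<lambda>x. x \<in> set a1) u" "filter (\<lambda>x. x \<notin> set a) u = filter (\<lambda>x. x \<notin> set a1) u"
    "filter (\<lambda>x. x \<in> set a) v = filter (\<lambda>x. x \<in> set a2) v" "filter (\<lambda>x. x \<notin> set a) v = filter (\<lambda>x. x \<notin> set a2) v"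
    by (rule filter_cong[OF refl]; use s * assms in auto)+
  then have "filter (\<lambda>x. x \<in> set a) (u @ v) = a \<and> filter (\<lambda>x. x \<notin> set a) (u @ v) = b"
    using *(3,4) unfolding filter_append shuffles_iff_filter[OF d(1)] shuffles_iff_filter[OF d(2)] *(1,2) by simp
  then show "u @ v \<in> shuffles a b" using shuffles_iff_filter[OF assms] by blast
qed

text \<open>Cutting a shuffle amounts to cutting both words and shuffling the left pieces and the
  right pieces separately. The product condition must be expressible by the left pieces alone; the
  right pieces are shuffled freely, whence \<open>mul\<close>.\<close>

lemma cop_prd:
  assumes inv: "invariant2 Q" "invariant2 Q1" "invariant2 Q2" "invariant3 R" "invariant3 R'"
    and Q: "\<And>a1 a2 b1 b2 u v. valid (a1 @ a2) \<Longrightarrow> below (a1 @ a2) (b1 @ b2) \<Longrightarrow>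
      u \<in> shuffles a1 b1 \<Longrightarrow> v \<in> shuffles a2 b2 \<Longrightarrow>
      R (a1 @ a2) (b1 @ b2) (u @ v) \<and> Q u v \<longleftrightarrow> Q1 a1 a2 \<and> Q2 b1 b2 \<and> R' a1 b1 u"
  shows "cop Q (prd R x y) = psw (cop Q1 x) (\<lambda>x1 x2. psw (cop Q2 y)
    (\<lambda>y1 y2. tens (prd R' x1 y1) (mul x2 y2)))" (is "?L x y = ?R x y")
proof (rule bilin_eqI[of pm_scale ?L ?R])
  fix i j
  show "?L (bv i) (bv j) = ?R (bv i) (bv j)"
  proof (cases "i \<in> graded_perms \<and> j \<in> graded_perms")
    case False
    have "psw z (\<lambda>x1 x2. 0 :: gperm_tensor) = 0" for z :: "gperm_tensor"
      by (simp add: sw_def lext_def)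
    with False show ?thesis by auto
  next
    case True
    obtain a where a: "valid a" "nrm a = i" using True graded_perm_word by metis
    obtain N where N: "\<And>x. x \<in> letters a \<Longrightarrow> x \<le> N" using finite_nat_set_iff_bounded_le[of "letters a"] by auto
    obtain b where b: "valid b" "nrm b = j" "\<And>x. x \<in> letters b \<Longrightarrow> N < x" using True graded_perm_word by metis
    have ab: "below a b" using N b(3) by (meson imageI le_less_trans)
    have v: "valid (a @ b)" using a b below_disjoint[OF ab] by (simp add: valid_append)
    then have d: "set a \<inter> set b = {}" by (auto simp: valid_append)
    have inv': "invariant3 (\<lambda>_ _ _. True)" by (simp add: invariant3_def)
    let ?h = "\<lambda>p :: word \<times> word. bv (nrm (fst p), nrm (snd p))"
    let ?SL = "SIGMA w:{w \<in> shuffles a b. R a b w}. {(u, v). (u, v) \<in> splits w \<and> Q u v}"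
    let ?A = "{(a1, a2). (a1, a2) \<in> splits a \<and> Q1 a1 a2}"
    let ?B = "{(b1, b2). (b1, b2) \<in> splits b \<and> Q2 b1 b2}"
    let ?U = "\<lambda>p. {u \<in> shuffles (fst (fst p)) (fst (snd p)). R' (fst (fst p)) (fst (snd p)) u} \<times> shuffles (snd (fst p)) (snd (snd p))"
    let ?SR = "SIGMA p:?A \<times> ?B. ?U p"
    have "?L (wv a) (wv b) = (\<Sum>w\<in>{w \<in> shuffles a b. R a b w}. cop Q (wv w))"
      by (simp add: prd_word[OF v ab inv(4)] cop_sum)
    also have "\<dots> = (\<Sum>w\<in>{w \<in> shuffles a b. R a b w}.
        \<Sum>(u, v)\<in>{(u, v). (u, v) \<in> splits w \<and> Q u v}. bv (nrm u, nrm v))"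
      using valid_shuffle[OF v] by (intro sum.cong refl cop_word inv(1)) auto
    also have "\<dots> = (\<Sum>(w, p)\<in>?SL. ?h p)"
      by (subst sum.Sigma[symmetric]) (auto simp: case_prod_beta intro!: finite_subset[OF _ finite_splits])
    also have "\<dots> = (\<Sum>(p, w)\<in>?SR. ?h w)"
    proof -
      have "inj_on snd ?SL" by (auto simp: inj_on_def splits_def)
      \<comment> \<open>Filtering the left part of the cut recovers the left pieces of
        \<open>a\<close> and \<open>b\<close>; cancellation in \<open>a\<close> and \<open>b\<close>
        then gives the right pieces.\<close>
      moreover have "inj_on snd ?SR"
      proof (rule inj_onI)
        have fil: "a1 = filter (\<lambda>x. x \<in> set a) u" "b1 = filter (\<lambda>x. x \<notin> set a) u"
          if "a = a1 @ a2" "b = b1 @ b2" "u \<in> shuffles a1 b1" for a1 a2 b1 b2 u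
        proof -
          have d': "set a1 \<inter> set b1 = {}" using d that by auto
          have "filter (\<lambda>x. x \<in> set a) u = filter (\<lambda>x. x \<in> set a1) u" "filter (\<lambda>x. x \<notin> set a) u = filter (\<lambda>x. x \<notin> set a1) u"
            by (rule filter_cong[OF refl]; use set_shuffles[OF that(3)] that d in auto)+
          then show "a1 = filter (\<lambda>x. x \<in> set a) u" "b1 = filter (\<lambda>x. x \<notin> set a) u"
            using that(3) shuffles_iff_filter[OF d'] by simp_all
        qed
        have mem: "a = fst (fst (fst x)) @ snd (fst (fst x))" "b = fst (snd (fst x)) @ snd (snd (fst x))"
          "fst (snd x) \<in> shuffles (fst (fst (fst x))) (fst (snd (fst x)))" if "x \<in> ?SR" for x
          using that by (auto simp: splits_def)
        fix x y assume x: "x \<in> ?SR" and y: "y \<in> ?SR" and xy: "snd x = snd y"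
        have f: "fst (fst (fst x)) = fst (fst (fst y))" "fst (snd (fst x)) = fst (snd (fst y))"
          using fil[OF mem[OF x]] fil[OF mem[OF y]] xy by (simp_all only:)
        then have "snd (fst (fst x)) = snd (fst (fst y))" "snd (snd (fst x)) = snd (snd (fst y))"
          using mem(1,2)[OF x] mem(1,2)[OF y] by (metis same_append_eq)+
        with f xy show "x = y" by (simp add: prod_eq_iff)
      qed
      moreover have "snd ` ?SL = snd ` ?SR"
      proof -
        have L: "(u, v') \<in> snd ` ?SL \<longleftrightarrow> u @ v' \<in> shuffles a b \<and> R a b (u @ v') \<and> Q u v'" for u v'
          by (force simp: splits_def)
        have R: "x \<in> snd ` ?SR \<longleftrightarrow> (\<exists>p\<in>?A \<times> ?B. x \<in> ?U p)" for x by force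
        have "(u, v') \<in> snd ` ?SL \<longleftrightarrow> (u, v') \<in> snd ` ?SR" for u v'
        proof
          assume uv: "(u, v') \<in> snd ` ?SL"
          then obtain a1 a2 b1 b2 where *: "a = a1 @ a2" "b = b1 @ b2" "u \<in> shuffles a1 b1" "v' \<in> shuffles a2 b2"
            unfolding L append_in_shuffles_iff[OF d] by blast
          have "Q1 a1 a2 \<and> Q2 b1 b2 \<and> R' a1 b1 u"
            using uv Q[OF _ _ *(3,4), folded *(1,2), OF a(1) ab] unfolding L by blast
          then show "(u, v') \<in> snd ` ?SR"
            unfolding R using * by (intro bexI[of _ "((a1, a2), (b1, b2))"]) (simp_all add: splits_def)
        next
          assume "(u, v') \<in> snd ` ?SR"
          then obtain p where p: "p \<in> ?A \<times> ?B" "(u, v') \<in> ?U p" unfolding R by blast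
          have *: "a = fst (fst p) @ snd (fst p)" "b = fst (snd p) @ snd (snd p)"
            "u \<in> shuffles (fst (fst p)) (fst (snd p))" "v' \<in> shuffles (snd (fst p)) (snd (snd p))"
            "Q1 (fst (fst p)) (snd (fst p)) \<and> Q2 (fst (snd p)) (snd (snd p)) \<and> R' (fst (fst p)) (fst (snd p)) u"
            using p by (auto simp: splits_def)
          then show "(u, v') \<in> snd ` ?SL"
            using Q[OF _ _ *(3,4), folded *(1,2), OF a(1) ab] unfolding L append_in_shuffles_iff[OF d] by blast
        qed
        then show ?thesis by (intro set_eqI) (simp only: split_paired_all)
      qed
      ultimately show ?thesis
        using sum.reindex[of snd ?SL ?h] sum.reindex[of snd ?SR ?h] by (simp add: case_prod_beta o_def)
    qed
    also have "\<dots> = (\<Sum>p\<in>?A \<times> ?B. \<Sum>w\<in>?U p. bv (nrm (fst w), nrm (snd w)))"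
      by (rule sum.Sigma[symmetric]) (auto intro!: finite_subset[OF _ finite_splits] finite_cartesian_product)
    also have "\<dots> = (\<Sum>p\<in>?A \<times> ?B. tens (prd R' (wv (fst (fst p))) (wv (fst (snd p)))) (mul (wv (snd (fst p))) (wv (snd (snd p)))))"
    proof (rule sum.cong[OF refl])
      fix p assume "p \<in> ?A \<times> ?B"
      then obtain a1 a2 b1 b2 where p: "p = ((a1, a2), (b1, b2))" "a = a1 @ a2" "b = b1 @ b2"
        by (auto simp: splits_def)
      have v1: "valid (a1 @ b1)" "valid (a2 @ b2)" "below a1 b1" "below a2 b2"
        using v ab p by (auto simp: valid_append)
      show "(\<Sum>w\<in>?U p. bv (nrm (fst w), nrm (snd w))) =
          tens (prd R' (wv (fst (fst p))) (wv (fst (snd p)))) (mul (wv (snd (fst p))) (wv (snd (snd p))))"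
        by (simp add: p prd_word[OF v1(1,3) inv(5)] prd_word[OF v1(2,4) inv'] tens_sum(1))
           (simp add: tens_sum(2) sum.cartesian_product case_prod_beta)
    qed
    also have "\<dots> = (\<Sum>p\<in>?A. \<Sum>q\<in>?B. tens (prd R' (wv (fst p)) (wv (fst q))) (mul (wv (snd p)) (wv (snd q))))"
      by (simp add: sum.cartesian_product case_prod_beta)
    also have "\<dots> = ?R (wv a) (wv b)"
      by (simp add: sw_cop_word[OF _ a(1) inv(2)] sw_cop_word[OF _ b(1) inv(3)] case_prod_beta)
    finally show ?thesis using a b by simp
  qed
qed (intro bilinI lin_intros; simp)+

text \<open>For words with distinct letters, equality of the heads says that the first letter of the
  shuffle comes from \<open>a\<close>, that is \<open>inv \<alpha> 1 = 1\<close>. The guard excludes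
  the unspecified \<open>hd []\<close> and produces the conventions \<open>x \<prec> 1 = x\<close>
  and \<open>1 \<prec> h = 0\<close>.\<close>

definition startl :: "word \<Rightarrow> word \<Rightarrow> word \<Rightarrow> bool" where
  "startl a b w \<longleftrightarrow> a \<noteq> [] \<and> hd w = hd a"

definition startr :: "word \<Rightarrow> word \<Rightarrow> word \<Rightarrow> bool" where
  "startr a b w \<longleftrightarrow> b \<noteq> [] \<and> hd w = hd b"

text \<open>Formula \<open>min_cop_succ\<close> below fails for an empty left factor, as the smallest letter then comes
  from the right one.\<close>

definition startr' :: "word \<Rightarrow> word \<Rightarrow> word \<Rightarrow> bool" where
  "startr' a b w \<longleftrightarrow> a \<noteq> [] \<and> startr a b w"

text \<open>On \<open>x \<in> A\<close> the coproducts for \<open>ne_left\<close>,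
  \<open>ne_both\<close>, \<open>min_left\<close>, \<open>min_left_ne\<close> and
  \<open>min_right\<close> are, in turn, \<open>x \<otimes> 1 + \<Delta>\<^sub>\<prec> x +
  \<Delta>\<^sub>\<succ> x\<close>,
  \<open>\<Delta>\<^sub>\<prec> x + \<Delta>\<^sub>\<succ> x\<close>,
  \<open>x \<otimes> 1 + \<Delta>\<^sub>\<prec> x\<close>, \<open>\<Delta>\<^sub>\<prec> x\<close>
  and \<open>\<Delta>\<^sub>\<succ> x\<close>.\<close>

definition ne_left :: "word \<Rightarrow> word \<Rightarrow> bool" where
  "ne_left u v \<longleftrightarrow> u \<noteq> []"

definition ne_both :: "word \<Rightarrow> word \<Rightarrow> bool" where
  "ne_both u v \<longleftrightarrow> u \<noteq> [] \<and> v \<noteq> []"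

text \<open>The smallest letter lies in the left factor. Avoiding \<open>Min\<close> makes an empty
  right factor acceptable without a separate case.\<close>

definition min_left :: "word \<Rightarrow> word \<Rightarrow> bool" where
  "min_left u v \<longleftrightarrow> u \<noteq> [] \<and> (\<forall>p\<in>set v. \<exists>q\<in>set u. fst q < fst p)"

definition min_left_ne :: "word \<Rightarrow> word \<Rightarrow> bool" where
  "min_left_ne u v \<longleftrightarrow> min_left u v \<and> v \<noteq> []"

definition min_right :: "word \<Rightarrow> word \<Rightarrow> bool" where
  "min_right u v \<longleftrightarrow> u \<noteq> [] \<and> v \<noteq> [] \<and> (\<forall>p\<in>set u. \<exists>q\<in>set v. fst q < fst p)"

lemma hd_relabel: "w \<noteq> [] \<Longrightarrow> hd (relabel \<phi> w) = apfst \<phi> (hd w)"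
  by (simp add: relabel_def hd_map)

lemma hd_relabel_eq_iff:
  assumes "strict_mono_on (letters (a @ b)) \<phi>" "w \<in> shuffles a b" "w \<noteq> []" "c \<noteq> []" "set c \<subseteq> set (a @ b)"
  shows "hd (relabel \<phi> w) = hd (relabel \<phi> c) \<longleftrightarrow> hd w = hd c"
proof -
  have "inj_on (apfst \<phi>) (set (a @ b))"
    using assms(1) by (intro inj_on_apfst strict_mono_on_imp_inj_on)
  moreover have "hd w \<in> set (a @ b)" using assms(2,3) hd_in_set[of w] by (simp add: set_shuffles)
  moreover have "hd c \<in> set (a @ b)" using assms(4,5) hd_in_set[of c] by blast
  ultimately show ?thesis using assms(3,4) by (simp add: hd_relabel inj_on_eq_iff)
qed

lemma invariant_start [simp]:
  "invariant3 startl" "invariant3 startr" "invariant3 startr'" "invariant3 (\<lambda>_ _ _. True)"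
proof -
  show "invariant3 startl" unfolding invariant3_def
  proof (intro allI impI)
    fix \<phi> :: "nat \<Rightarrow> nat" and a b w assume *: "strict_mono_on (letters (a @ b)) \<phi>" "w \<in> shuffles a b"
    show "startl (relabel \<phi> a) (relabel \<phi> b) (relabel \<phi> w) = startl a b w"
    proof (cases "a = []")
      case False
      with *(2) have "w \<noteq> []" by auto
      from hd_relabel_eq_iff[OF * this False] show ?thesis by (simp add: startl_def)
    qed (simp add: startl_def)
  qed
  show r: "invariant3 startr" unfolding invariant3_def
  proof (intro allI impI)
    fix \<phi> :: "nat \<Rightarrow> nat" and a b w assume *: "strict_mono_on (letters (a @ b)) \<phi>" "w \<in> shuffles a b"
    show "startr (relabel \<phi> a) (relabel \<phi> b) (relabel \<phi> w) = startr a b w"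
    proof (cases "b = []")
      case False
      with *(2) have "w \<noteq> []" by auto
      from hd_relabel_eq_iff[OF * this False] show ?thesis by (simp add: startr_def)
    qed (simp add: startr_def)
  qed
  from r show "invariant3 startr'" by (simp add: invariant3_def startr'_def)
qed (simp add: invariant3_def)

lemma invariant_min [simp]:
  "invariant2 ne_left" "invariant2 ne_both" "invariant2 min_left" "invariant2 min_left_ne" "invariant2 min_right"
  "invariant2 (\<lambda>_ _. True)"
proof -
  have *: "\<phi> (fst p) < \<phi> (fst q) \<longleftrightarrow> fst p < fst q"
    if "strict_mono_on (letters (u @ v)) \<phi>" "p \<in> set u \<union> set v" "q \<in> set u \<union> set v" for u v p q and \<phi> :: "nat \<Rightarrow> nat"
    by (rule strict_mono_on_less[OF that(1)]) (use that in auto)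
  show "invariant2 ne_left" "invariant2 ne_both" by (simp_all add: invariant2_def ne_left_def ne_both_def)
  show "invariant2 min_left" unfolding invariant2_def
  proof (intro allI impI)
    fix \<phi> :: "nat \<Rightarrow> nat" and u v assume m: "strict_mono_on (letters (u @ v)) \<phi>"
    show "min_left (relabel \<phi> u) (relabel \<phi> v) = min_left u v"
      by (simp add: min_left_def set_relabel *[OF m])
  qed
  then show "invariant2 min_left_ne" by (simp add: invariant2_def min_left_ne_def)
  show "invariant2 min_right" unfolding invariant2_def
  proof (intro allI impI)
    fix \<phi> :: "nat \<Rightarrow> nat" and u v assume m: "strict_mono_on (letters (u @ v)) \<phi>"
    show "min_right (relabel \<phi> u) (relabel \<phi> v) = min_right u v"
      by (simp add: min_right_def set_relabel *[OF m])
  qed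
qed (simp add: invariant2_def)

section \<open>The dendriform axioms on the whole space\<close>

abbreviation prec (infixl \<open>\<lhd>\<close> 70) where "prec \<equiv> prd startl"
abbreviation succ (infixl \<open>\<rhd>\<close> 70) where "succ \<equiv> prd startr"
abbreviation full_cop :: "gperm_vec \<Rightarrow> gperm_tensor" where "full_cop \<equiv> cop (\<lambda>_ _. True)"

lemma start_cases:
  assumes "w \<in> shuffles a b" "w \<noteq> []" "set a \<inter> set b = {}"
  shows "startl a b w \<longleftrightarrow> hd w \<in> set a" "startr a b w \<longleftrightarrow> hd w \<in> set b" "hd w \<in> set a \<union> set b"
proof -
  obtain x xs where w: "w = x # xs" using assms(2) by (cases w) auto
  then have "a \<noteq> [] \<and> hd a = x \<or> b \<noteq> [] \<and> hd b = x" using assms(1) by (auto simp: Cons_in_shuffles_iff)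
  moreover have "a \<noteq> [] \<Longrightarrow> hd a \<notin> set b" "b \<noteq> [] \<Longrightarrow> hd b \<notin> set a"
    using assms(3) hd_in_set[of a] hd_in_set[of b] by blast+
  ultimately show "startl a b w \<longleftrightarrow> hd w \<in> set a" "startr a b w \<longleftrightarrow> hd w \<in> set b" "hd w \<in> set a \<union> set b"
    using w hd_in_set[of a] hd_in_set[of b] by (auto simp: startl_def startr_def)
qed

text \<open>In each equivalence both sides say where the first letter of \<open>w\<close> comes
  from: from \<open>a\<close>, from \<open>b\<close> and from \<open>c\<close> respectively. This is
  the content of the three dendriform axioms.\<close>

lemma start_assoc_aux:
  assumes v: "valid (a @ b @ c)" and s: "u \<in> shuffles a b" "w \<in> shuffles u c" "u' \<in> shuffles b c" "w \<in> shuffles a u'"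
  shows "startl a b u \<and> startl u c w \<longleftrightarrow> startl a u' w"
    "startr a b u \<and> startl u c w \<longleftrightarrow> startl b c u' \<and> startr a u' w"
    "startr u c w \<longleftrightarrow> startr b c u' \<and> startr a u' w"
proof -
  have d: "set a \<inter> set b = {}" "set a \<inter> set c = {}" "set b \<inter> set c = {}"
    using valid_distinct[OF v] by auto
  have su: "set u = set a \<union> set b" "set u' = set b \<union> set c" "set w = set a \<union> set b \<union> set c"
    using s by (auto simp: set_shuffles)
  have d': "set u \<inter> set c = {}" "set a \<inter> set u' = {}" using d su by auto
  have 1: "startl u c w \<Longrightarrow> hd w = hd u" "startr a u' w \<Longrightarrow> hd w = hd u'" by (simp_all add: startl_def startr_def)
  have "(startl a b u \<and> startl u c w \<longleftrightarrow> startl a u' w) \<and>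
    (startr a b u \<and> startl u c w \<longleftrightarrow> startl b c u' \<and> startr a u' w) \<and>
    (startr u c w \<longleftrightarrow> startr b c u' \<and> startr a u' w)"
  proof (cases "w = []")
    case True
    with su show ?thesis by (auto simp: startl_def startr_def)
  next
    case False
    note w1 = start_cases[OF s(2) False d'(1)] and w2 = start_cases[OF s(4) False d'(2)]
    have ul: "startl a b u \<longleftrightarrow> hd u \<in> set a" "startr a b u \<longleftrightarrow> hd u \<in> set b" if "hd w \<in> set u"
      using start_cases[OF s(1) _ d(1)] that by (cases "u = []"; simp)+
    have ur: "startl b c u' \<longleftrightarrow> hd u' \<in> set b" "startr b c u' \<longleftrightarrow> hd u' \<in> set c" if "hd w \<in> set u'"
      using start_cases[OF s(3) _ d(3)] that by (cases "u' = []"; simp)+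
    consider "hd w \<in> set a" | "hd w \<in> set b" | "hd w \<in> set c" using w1(3) su by blast
    then show ?thesis
    proof cases
      case 1 then show ?thesis using w1 w2 ul ur d su \<open>startl u c w \<Longrightarrow> hd w = hd u\<close> by auto
    next
      case 2
      then have "startl u c w" "startr a u' w" "hd w \<in> set u" "hd w \<in> set u'" using w1 w2 su by auto
      with 1 ul ur 2 d w1 w2 su show ?thesis by auto
    next
      case 3
      then have "startr a u' w" "hd w \<in> set u'" using w1 w2 su by auto
      with 1 ur 3 d w1 w2 su show ?thesis by auto
    qed
  qed
  then show "startl a b u \<and> startl u c w \<longleftrightarrow> startl a u' w"
    "startr a b u \<and> startl u c w \<longleftrightarrow> startl b c u' \<and> startr a u' w"
    "startr u c w \<longleftrightarrow> startr b c u' \<and> startr a u' w" by blast+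
qed

text \<open>Using \<open>mul\<close> instead of the sum of \<prec> and \<succ> keeps the axiom valid
  for units: \<open>mul one one\<close> is \<open>one\<close>, whereas both half products of
  \<open>one\<close> with itself vanish.\<close>

lemma prec_prec: "(x \<lhd> y) \<lhd> z = x \<lhd> mul y z"
  by (rule prd_assoc) (simp_all add: start_assoc_aux)

lemma succ_prec: "(x \<rhd> y) \<lhd> z = x \<rhd> (y \<lhd> z)"
  by (rule prd_assoc) (simp_all add: start_assoc_aux)

lemma mul_succ: "mul x y \<rhd> z = x \<rhd> (y \<rhd> z)"
  by (rule prd_assoc) (simp_all add: start_assoc_aux)

lemma mul_assoc: "mul (mul x y) z = mul x (mul y z)"
  by (rule prd_assoc) simp_all

section \<open>Coproducts of the half products\<close>

lemma start_append_aux: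
  assumes "below (a1 @ a2) (b1 @ b2)" "u \<in> shuffles a1 b1" "v \<in> shuffles a2 b2"
  shows "startl (a1 @ a2) (b1 @ b2) (u @ v) \<and> u \<noteq> [] \<longleftrightarrow> startl a1 b1 u \<and> a1 \<noteq> []"
    "startr (a1 @ a2) (b1 @ b2) (u @ v) \<and> u \<noteq> [] \<longleftrightarrow> startr a1 b1 u \<and> b1 \<noteq> []"
proof -
  have d: "set (a1 @ a2) \<inter> set (b1 @ b2) = {}" using below_disjoint[OF assms(1)] by auto
  then have d1: "set a1 \<inter> set b1 = {}" by auto
  have w: "u @ v \<in> shuffles (a1 @ a2) (b1 @ b2)" using assms append_in_shuffles_iff[OF d] by blast
  have "set u = set a1 \<union> set b1" using assms by (simp add: set_shuffles)
  with start_cases[OF w _ d] start_cases[OF assms(2) _ d1] d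
  show "startl (a1 @ a2) (b1 @ b2) (u @ v) \<and> u \<noteq> [] \<longleftrightarrow> startl a1 b1 u \<and> a1 \<noteq> []"
    "startr (a1 @ a2) (b1 @ b2) (u @ v) \<and> u \<noteq> [] \<longleftrightarrow> startr a1 b1 u \<and> b1 \<noteq> []"
    by (cases "u = []"; auto simp: startl_def startr_def)+
qed

text \<open>The letters of the first word lie below those of the second, so the smallest letter of
  the shuffle is that of the first word, provided this is nonempty.\<close>

lemma min_left_append_aux:
  assumes "below (a1 @ a2) (b1 @ b2)" "u \<in> shuffles a1 b1" "v \<in> shuffles a2 b2" "a1 @ a2 \<noteq> []"
  shows "min_left u v \<longleftrightarrow> min_left a1 a2"
proof -
  have s: "set u = set a1 \<union> set b1" "set v = set a2 \<union> set b2" using assms by (simp_all add: set_shuffles)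
  have ba: "\<not> fst q < fst p" if "q \<in> set b1 \<union> set b2" "p \<in> set a1 \<union> set a2" for p q
  proof -
    have "fst p < fst q" using assms(1) that unfolding set_append by blast
    then show ?thesis by simp
  qed
  show ?thesis
  proof
    assume m: "min_left u v"
    have *: "\<exists>q\<in>set a1. fst q < fst p" if p: "p \<in> set a2" for p
    proof -
      have "p \<in> set v" using p s by simp
      then obtain q where "q \<in> set u" "fst q < fst p" using m unfolding min_left_def by blast
      with ba[of q p] p s show ?thesis by auto
    qed
    have "a1 \<noteq> []"
    proof
      assume "a1 = []"
      with * assms(4) show False by (cases a2) auto
    qed
    with * show "min_left a1 a2" by (auto simp: min_left_def)
  next
    assume m: "min_left a1 a2"
    then have q: "hd a1 \<in> set a1" by (simp add: min_left_def)
    then have "u \<noteq> []" using s by auto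
    moreover have "fst (hd a1) < fst p" if "p \<in> set b2" for p using assms(1) q that by simp
    ultimately show "min_left u v" using m q s unfolding min_left_def by (metis Un_iff)
  qed
qed

text \<open>The first letter of \<open>u @ v\<close> is that of \<open>u\<close> if \<open>u\<close>
  is nonempty, so the product condition passes to the left tensor factor. The left piece of
  \<open>y\<close> must be nonempty, as it supplies the first letter, while that of \<open>x\<close>
  may be empty.\<close>

lemma cop_succ: "cop ne_left (x \<rhd> y) = psw (full_cop x) (\<lambda>x1 x2. psw (cop ne_left y)
    (\<lambda>y1 y2. tens (x1 \<rhd> y1) (mul x2 y2)))"
proof (rule cop_prd)
  fix a1 a2 b1 b2 u v :: word
  assume *: "below (a1 @ a2) (b1 @ b2)" "u \<in> shuffles a1 b1" "v \<in> shuffles a2 b2"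
  from start_append_aux(2)[OF *]
  show "startr (a1 @ a2) (b1 @ b2) (u @ v) \<and> ne_left u v \<longleftrightarrow> True \<and> ne_left b1 b2 \<and> startr a1 b1 u"
    by (auto simp: ne_left_def)
qed simp_all

lemma cop_prec: "cop ne_left (x \<lhd> y) = psw (cop ne_left x) (\<lambda>x1 x2. psw (full_cop y)
    (\<lambda>y1 y2. tens (x1 \<lhd> y1) (mul x2 y2)))"
proof (rule cop_prd)
  fix a1 a2 b1 b2 u v :: word
  assume *: "below (a1 @ a2) (b1 @ b2)" "u \<in> shuffles a1 b1" "v \<in> shuffles a2 b2"
  from start_append_aux(1)[OF *]
  show "startl (a1 @ a2) (b1 @ b2) (u @ v) \<and> ne_left u v \<longleftrightarrow> ne_left a1 a2 \<and> True \<and> startl a1 b1 u"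
    by (auto simp: ne_left_def)
qed simp_all

lemma min_cop_prec: "cop min_left (x \<lhd> y) = psw (cop min_left x) (\<lambda>x1 x2. psw (full_cop y)
    (\<lambda>y1 y2. tens (x1 \<lhd> y1) (mul x2 y2)))"
proof (rule cop_prd)
  fix a1 a2 b1 b2 u v :: word
  assume *: "below (a1 @ a2) (b1 @ b2)" "u \<in> shuffles a1 b1" "v \<in> shuffles a2 b2"
  show "startl (a1 @ a2) (b1 @ b2) (u @ v) \<and> min_left u v \<longleftrightarrow> min_left a1 a2 \<and> True \<and> startl a1 b1 u"
  proof (cases "a1 @ a2 = []")
    case False
    from start_append_aux(1)[OF *] min_left_append_aux[OF * False] show ?thesis
      by (auto simp: min_left_def)
  qed (simp add: startl_def)
qed simp_all

lemma min_cop_succ: "cop min_left (prd startr' x y) = psw (cop min_left x) (\<lambda>x1 x2. psw (cop ne_left y)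
    (\<lambda>y1 y2. tens (x1 \<rhd> y1) (mul x2 y2)))"
proof (rule cop_prd)
  fix a1 a2 b1 b2 u v :: word
  assume *: "below (a1 @ a2) (b1 @ b2)" "u \<in> shuffles a1 b1" "v \<in> shuffles a2 b2"
  show "startr' (a1 @ a2) (b1 @ b2) (u @ v) \<and> min_left u v \<longleftrightarrow> min_left a1 a2 \<and> ne_left b1 b2 \<and> startr a1 b1 u"
  proof (cases "a1 @ a2 = []")
    case False
    from start_append_aux(2)[OF *] min_left_append_aux[OF * False] False show ?thesis
      by (auto simp: min_left_def ne_left_def startr'_def)
  qed (simp add: startr'_def min_left_def)
qed simp_all

section \<open>Coassociativity of the coactions\<close>

lemma ne_left_coassoc:
  fixes B :: "_ \<Rightarrow> _ \<Rightarrow> _ \<Rightarrow> 'c::ab_group_add"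
  assumes "vector_space t"
  shows "sw t (cop ne_left x) (\<lambda>u v. sw t (cop ne_left u) (\<lambda>u1 u2. B u1 u2 v)) =
         sw t (cop ne_left x) (\<lambda>u v. sw t (full_cop v) (\<lambda>v1 v2. B u v1 v2))"
  by (rule cop_coassoc[OF assms]) (auto simp: ne_left_def)

lemma full_coassoc:
  fixes B :: "_ \<Rightarrow> _ \<Rightarrow> _ \<Rightarrow> 'c::ab_group_add"
  assumes "vector_space t"
  shows "sw t (full_cop x) (\<lambda>u v. sw t (full_cop u) (\<lambda>u1 u2. B u1 u2 v)) =
         sw t (full_cop x) (\<lambda>u v. sw t (full_cop v) (\<lambda>v1 v2. B u v1 v2))"
  by (rule cop_coassoc[OF assms]) auto

lemma dominates_trans:
  fixes f :: "'a \<Rightarrow> nat"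
  assumes "\<forall>p\<in>W. \<exists>q\<in>U \<union> V. f q < f p" "\<forall>p\<in>V. \<exists>q\<in>U. f q < f p"
  shows "\<forall>p\<in>W. \<exists>q\<in>U. f q < f p"
proof
  fix p assume "p \<in> W"
  then obtain q where q: "q \<in> U \<union> V" "f q < f p" using assms(1) by blast
  show "\<exists>q\<in>U. f q < f p"
  proof (cases "q \<in> U")
    case False
    then obtain r where "r \<in> U" "f r < f q" using q assms(2) by blast
    with q show ?thesis by (meson less_trans)
  qed (use q in blast)
qed

lemma min_left_coassoc:
  fixes B :: "_ \<Rightarrow> _ \<Rightarrow> _ \<Rightarrow> 'c::ab_group_add"
  assumes "vector_space t"
  shows "sw t (cop min_left x) (\<lambda>u v. sw t (cop min_left u) (\<lambda>u1 u2. B u1 u2 v)) =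
         sw t (cop min_left x) (\<lambda>u v. sw t (full_cop v) (\<lambda>v1 v2. B u v1 v2))"
proof (rule cop_coassoc[OF assms])
  fix u v w :: word
  show "min_left (u @ v) w \<and> min_left u v \<longleftrightarrow> min_left u (v @ w) \<and> True"
    using dominates_trans[of "set w" "set u" "set v" fst]
    by (auto simp: min_left_def)
qed simp_all

text \<open>Both sides describe the factorisations into three nonempty words with the smallest
  letter in the middle one.\<close>

lemma min_right_coassoc:
  fixes B :: "_ \<Rightarrow> _ \<Rightarrow> _ \<Rightarrow> 'c::ab_group_add"
  assumes "vector_space t"
  shows "sw t (cop min_left_ne x) (\<lambda>u v. sw t (cop min_right u) (\<lambda>u1 u2. B u1 u2 v)) =
         sw t (cop min_right x) (\<lambda>u v. sw t (cop min_left_ne v) (\<lambda>v1 v2. B u v1 v2))"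
proof (rule cop_coassoc[OF assms])
  fix u v w :: word
  define L :: "word \<Rightarrow> word \<Rightarrow> bool" where "L x y \<longleftrightarrow> (\<forall>p\<in>set y. \<exists>q\<in>set x. fst q < fst p)" for x y
  have "L v w" if "L (u @ v) w" "L v u"
    using that unfolding L_def by (intro dominates_trans[of "set w" "set v" "set u" fst]) auto
  moreover have "L v u" if "L (v @ w) u" "L v w"
    using that unfolding L_def by (intro dominates_trans[of "set u" "set v" "set w" fst]) auto
  moreover have "L v w \<Longrightarrow> L (u @ v) w" "L v u \<Longrightarrow> L (v @ w) u" unfolding L_def by auto
  ultimately show "min_left_ne (u @ v) w \<and> min_right u v \<longleftrightarrow> min_right u (v @ w) \<and> min_left_ne v w"
    unfolding min_left_ne_def min_left_def min_right_def L_def[symmetric] by auto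
qed simp_all

section \<open>Units and gradings\<close>

abbreviation plus_basis :: "biword set" where
  "plus_basis \<equiv> {b \<in> graded_perms. 1 \<le> fst b}"

abbreviation unit_word :: biword where "unit_word \<equiv> nrm []"
abbreviation one :: "gperm_vec" where "one \<equiv> bv unit_word"

definition graded :: "nat \<Rightarrow> gperm_vec set" where
  "graded n = pm.span (bv ` {b \<in> graded_perms. fst b = n})"

text \<open>Both components have positive length, so each is shorter than \<open>n\<close>. The
  inductions on the length rest on the fact that reduced coproducts only involve such pairs.\<close>

definition proper_pairs :: "nat \<Rightarrow> (biword \<times> biword) set" where
  "proper_pairs n = {(i, j). i \<in> plus_basis \<and> j \<in> plus_basis \<and> fst i + fst j = n}"

lemma valid_Nil [simp]: "valid []"
  by (simp add: valid_def)

lemma unit_word_graded_perms [simp]: "unit_word \<in> graded_perms"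
  by (rule nrm_graded_perms) simp

lemma nrm_in_plus_basis: "valid w \<Longrightarrow> nrm w \<in> plus_basis \<longleftrightarrow> w \<noteq> []"
  by (auto simp: nrm_graded_perms Suc_le_eq)

lemma graded_perms_cases:
  assumes "b \<in> graded_perms" obtains "b = unit_word" | "b \<in> plus_basis"
  using assms nrm_enc[OF assms] by (cases "fst b = 0") (auto simp: enc_def case_prod_beta)

lemma plus_basis_word:
  assumes "b \<in> plus_basis" obtains w where "valid w" "nrm w = b" "w \<noteq> []"
  using assms graded_perm_word[of b 0] by (metis (no_types, lifting) list.size(3) mem_Collect_eq not_one_le_zero)

lemma mul_one [simp]:
  assumes "b \<in> graded_perms"
  shows "mul (bv b) one = bv b" "mul one (bv b) = bv b"
proof -
  obtain w where w: "valid w" "nrm w = b" using assms graded_perm_word by metis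
  show "mul (bv b) one = bv b" using prd_word[of w "[]" "\<lambda>_ _ _. True"] w by simp
  show "mul one (bv b) = bv b" using prd_word[of "[]" w "\<lambda>_ _ _. True"] w by simp
qed

lemma prec_one [simp]: assumes "b \<in> plus_basis" shows "bv b \<lhd> one = bv b"
proof -
  obtain w where w: "valid w" "nrm w = b" "w \<noteq> []" by (rule plus_basis_word[OF assms])
  have "{x. x = w \<and> startl w [] x} = {w}" using w by (auto simp: startl_def)
  then show ?thesis using prd_word[of w "[]" startl] w by simp
qed

lemma one_succ [simp]: assumes "b \<in> plus_basis" shows "one \<rhd> bv b = bv b"
proof -
  obtain w where w: "valid w" "nrm w = b" "w \<noteq> []" by (rule plus_basis_word[OF assms])
  have "{x. x = w \<and> startr [] w x} = {w}" using w by (auto simp: startr_def)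
  then show ?thesis using prd_word[of "[]" w startr] w by simp
qed

lemma prec_outside: assumes "b \<notin> plus_basis" shows "bv b \<lhd> y = 0"
proof (rule lin_eqI[of pm_scale "\<lambda>y. bv b \<lhd> y" "\<lambda>y. 0"])
  fix j :: biword
  show "bv b \<lhd> bv j = 0"
  proof (cases "b \<in> graded_perms \<and> j \<in> graded_perms")
    case True
    then have b: "b = unit_word" using assms graded_perms_cases by blast
    obtain w where "valid w" "nrm w = j" using True graded_perm_word by metis
    then show ?thesis using prd_word[of "[]" w startl] b by (simp add: startl_def)
  qed auto
qed (intro lin_intros; simp)+

lemma succ_outside: assumes "b \<notin> plus_basis" shows "x \<rhd> bv b = 0"
proof (rule lin_eqI[of pm_scale "\<lambda>x. x \<rhd> bv b" "\<lambda>y. 0"])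
  fix j :: biword
  show "bv j \<rhd> bv b = 0"
  proof (cases "b \<in> graded_perms \<and> j \<in> graded_perms")
    case True
    then have b: "b = unit_word" using assms graded_perms_cases by blast
    obtain w where "valid w" "nrm w = j" using True graded_perm_word by metis
    then show ?thesis using prd_word[of w "[]" startr] b by (simp add: startr_def)
  qed auto
qed (intro lin_intros; simp)+

lemma below_pair:
  assumes "i \<in> graded_perms" "j \<in> graded_perms"
  obtains a b where "valid (a @ b)" "below a b" "nrm a = i" "nrm b = j"
proof -
  obtain a where a: "valid a" "nrm a = i" using assms graded_perm_word by metis
  obtain N where N: "\<And>x. x \<in> letters a \<Longrightarrow> x \<le> N" using finite_nat_set_iff_bounded_le[of "letters a"] by auto
  obtain b where b: "valid b" "nrm b = j" "\<And>x. x \<in> letters b \<Longrightarrow> N < x" using assms graded_perm_word by metis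
  have ab: "below a b" using N b(3) by (meson imageI le_less_trans)
  have "valid (a @ b)" using a b below_disjoint[OF ab] by (simp add: valid_append)
  with ab a b that show ?thesis by blast
qed

lemma mul_eq_prec_succ:
  assumes "i \<in> plus_basis" shows "mul (bv i) y = bv i \<lhd> y + bv i \<rhd> y"
proof (rule lin_eqI[of pm_scale "\<lambda>y. mul (bv i) y" "\<lambda>y. bv i \<lhd> y + bv i \<rhd> y"])
  fix j :: biword
  show "mul (bv i) (bv j) = bv i \<lhd> bv j + bv i \<rhd> bv j"
  proof (cases "j \<in> graded_perms")
    case True
    have i: "i \<in> graded_perms" using assms by simp
    obtain a b where ab: "valid (a @ b)" "below a b" "nrm a = i" "nrm b = j"
      by (rule below_pair[OF i True])
    have d: "set a \<inter> set b = {}" using below_disjoint[OF ab(2)] by auto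
    have "a \<noteq> []" using ab assms by auto
    then have w: "w \<noteq> []" if "w \<in> shuffles a b" for w using that by auto
    have "shuffles a b = {w \<in> shuffles a b. startl a b w} \<union> {w \<in> shuffles a b. startr a b w}"
      using start_cases[OF _ w d] by auto
    moreover have "{w \<in> shuffles a b. startl a b w} \<inter> {w \<in> shuffles a b. startr a b w} = {}"
      using start_cases[OF _ w d] d by auto
    ultimately have "sum wv (shuffles a b) = sum wv {w \<in> shuffles a b. startl a b w} + sum wv {w \<in> shuffles a b. startr a b w}"
      by (metis (no_types, lifting) finite_Un finite_shuffles sum.union_disjoint)
    then show ?thesis
      using prd_word[OF ab(1,2), of "\<lambda>_ _ _. True"] prd_word[OF ab(1,2), of startl] prd_word[OF ab(1,2), of startr] ab(3,4)
      by simp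
  qed auto
qed (intro lin_intros; simp)+

lemma succ_startr':
  assumes "i \<in> plus_basis" shows "prd startr' (bv i) y = bv i \<rhd> y"
proof (rule lin_eqI[of pm_scale "\<lambda>y. prd startr' (bv i) y" "\<lambda>y. bv i \<rhd> y"])
  fix j :: biword
  show "prd startr' (bv i) (bv j) = bv i \<rhd> bv j"
  proof (cases "j \<in> graded_perms")
    case True
    have i: "i \<in> graded_perms" using assms by simp
    obtain a b where ab: "valid (a @ b)" "below a b" "nrm a = i" "nrm b = j"
      by (rule below_pair[OF i True])
    have "a \<noteq> []" using ab assms by auto
    then have "startr' a b = startr a b" by (auto simp: startr'_def)
    then show ?thesis
      using prd_word[OF ab(1,2), of startr'] prd_word[OF ab(1,2), of startr] ab(3,4) by simp
  qed auto
qed (intro lin_intros; simp)+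

lemma prd_graded:
  assumes "i \<in> graded_perms" "j \<in> graded_perms"
  shows "prd R (bv i) (bv j) \<in> graded (fst i + fst j)"
proof -
  let ?b = "relabel (\<lambda>x. x + fst i) (enc j)"
  have m: "strict_mono_on (letters (enc j)) (\<lambda>x. x + fst i)" by (simp add: strict_mono_on_def)
  have "valid ?b" using m by (intro valid_relabel valid_enc assms strict_mono_on_imp_inj_on)
  moreover have "letters (enc i) \<inter> letters ?b = {}"
    using letters_enc[OF assms(1)] letters_enc[OF assms(2)] by (auto simp: letters_relabel)
  ultimately have v: "valid (enc i @ ?b)" using valid_enc[OF assms(1)] by (simp add: valid_append)
  have "wv w \<in> graded (fst i + fst j)" if "w \<in> shuffles (enc i) ?b" for w
    unfolding graded_def using that nrm_graded_perms[OF valid_shuffle[OF v that]]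
    by (intro pm.span_base) (auto simp: length_shuffles)
  then show ?thesis unfolding graded_def by (simp add: prd_def assms) (intro pm.span_sum, auto)
qed

lemma cop_eq_word:
  assumes "b \<in> graded_perms"
  shows "cop Q (bv b) = (\<Sum>(u, v)\<in>{(u, v). (u, v) \<in> splits (enc b) \<and> Q u v}. bv (nrm u, nrm v))"
  using assms by (simp add: cop_def)

lemma splits_valid: "valid w \<Longrightarrow> (u, v) \<in> splits w \<Longrightarrow> valid u \<and> valid v \<and> length u + length v = length w"
  by (auto simp: splits_def valid_append)

lemma cop_span:
  assumes "b \<in> graded_perms"
  shows "cop Q (bv b) \<in> pm.span (bv ` {(i, j). i \<in> graded_perms \<and> j \<in> graded_perms \<and> fst i + fst j = fst b})"
  unfolding cop_eq_word[OF assms]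
  by (intro pm.span_sum) (use splits_valid[OF valid_enc[OF assms]] nrm_graded_perms in
    \<open>auto intro!: pm.span_base imageI\<close>)

lemma cop_proper_span:
  assumes "b \<in> graded_perms" "\<And>u v. Q u v \<Longrightarrow> u \<noteq> [] \<and> v \<noteq> []"
  shows "cop Q (bv b) \<in> pm.span (bv ` proper_pairs (fst b))"
  unfolding cop_eq_word[OF assms(1)]
proof (intro pm.span_sum, clarify)
  fix u v assume uv: "(u, v) \<in> splits (enc b)" "Q u v"
  show "bv (nrm u, nrm v) \<in> pm.span (bv ` proper_pairs (fst b))"
    unfolding proper_pairs_def
    using splits_valid[OF valid_enc[OF assms(1)] uv(1)] assms(2)[OF uv(2)] nrm_in_plus_basis
    by (intro pm.span_base imageI) simp
qed

lemma cop_unit_right: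
  assumes "b \<in> plus_basis" "\<And>u v. Q u v \<longleftrightarrow> Q' u v \<or> u \<noteq> [] \<and> v = []" "\<And>u v. Q' u v \<Longrightarrow> v \<noteq> []"
  shows "cop Q (bv b) = bv (b, unit_word) + cop Q' (bv b)"
proof -
  have b: "b \<in> graded_perms" using assms by simp
  have ne: "enc b \<noteq> []" using assms(1) by (metis (no_types, lifting) length_enc list.size(3) mem_Collect_eq not_one_le_zero)
  have "{(u, v). (u, v) \<in> splits (enc b) \<and> Q u v} = insert (enc b, []) {(u, v). (u, v) \<in> splits (enc b) \<and> Q' u v}"
    using assms(2) ne by (auto simp: splits_def)
  moreover have "finite {(u, v). (u, v) \<in> splits (enc b) \<and> Q' u v}"
    by (rule finite_subset[OF _ finite_splits]) auto
  moreover have "\<not> Q' (enc b) []" using assms(3) by blast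
  ultimately show ?thesis using nrm_enc[OF b] by (auto simp: cop_eq_word[OF b])
qed

lemma ne_left_cop: "b \<in> plus_basis \<Longrightarrow> cop ne_left (bv b) = bv (b, unit_word) + cop ne_both (bv b)"
  by (rule cop_unit_right) (auto simp: ne_left_def ne_both_def)

lemma min_left_cop: "b \<in> plus_basis \<Longrightarrow> cop min_left (bv b) = bv (b, unit_word) + cop min_left_ne (bv b)"
  by (rule cop_unit_right) (auto simp: min_left_def min_left_ne_def)

lemma ne_left_outside: assumes "b \<notin> plus_basis" shows "cop ne_left (bv b) = 0" "cop min_left (bv b) = 0"
proof -
  have "cop Q (bv b) = 0" if Q: "\<And>u v. Q u v \<Longrightarrow> u \<noteq> []" "invariant2 Q" for Q
  proof (cases "b \<in> graded_perms")
    case True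
    then have "b = unit_word" using assms graded_perms_cases by blast
    moreover have "{(u, v). (u, v) \<in> splits [] \<and> Q u v} = {}" using Q by (auto simp: splits_def)
    ultimately show ?thesis by (simp only: cop_word[OF valid_Nil Q(2)] sum.empty)
  qed simp
  from this[of ne_left] this[of min_left]
  show "cop ne_left (bv b) = 0" "cop min_left (bv b) = 0"
    by (simp_all add: ne_left_def min_left_def)
qed

lemma full_cop_eq:
  assumes "b \<in> graded_perms"
  shows "full_cop (bv b) = bv (unit_word, b) + cop ne_left (bv b)"
proof -
  have *: "{(u, v). (u, v) \<in> splits (enc b) \<and> True} = insert ([], enc b) {(u, v). (u, v) \<in> splits (enc b) \<and> ne_left u v}"
    by (auto simp: splits_def ne_left_def)
  have "finite {(u, v). (u, v) \<in> splits (enc b) \<and> ne_left u v}"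
    by (rule finite_subset[OF _ finite_splits]) auto
  moreover have "([], enc b) \<notin> {(u, v). (u, v) \<in> splits (enc b) \<and> ne_left u v}" by (simp add: ne_left_def)
  ultimately show ?thesis unfolding cop_eq_word[OF assms] * using nrm_enc[OF assms] by (subst sum.insert) simp_all
qed

lemma full_cop_one: "full_cop one = bv (unit_word, unit_word)"
  by (simp add: full_cop_eq ne_left_outside)

text \<open>The letters are distinct, so each cut into two nonempty factors has the smallest letter
  in exactly one of them.\<close>

lemma ne_both_cop: "cop ne_both x = cop min_left_ne x + cop min_right x"
proof (rule lin_eqI[of pm_scale "\<lambda>x. cop ne_both x" "\<lambda>x. cop min_left_ne x + cop min_right x"])
  fix b :: biword
  show "cop ne_both (bv b) = cop min_left_ne (bv b) + cop min_right (bv b)"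
  proof (cases "b \<in> graded_perms")
    case True
    have *: "ne_both u v \<longleftrightarrow> min_left_ne u v \<or> min_right u v" "\<not> (min_left_ne u v \<and> min_right u v)"
      if "(u, v) \<in> splits (enc b)" for u v
    proof -
      have uv: "letters u \<inter> letters v = {}" using valid_enc[OF True] that valid_append[of u v] by (simp add: splits_def)
      have A: "(\<forall>p\<in>set y. \<exists>q\<in>set x. fst q < fst p) \<longleftrightarrow> Min (letters x) < Min (letters y)"
        if "x \<noteq> []" "y \<noteq> []" for x y :: word
        using that by (auto simp: Min_less_iff Min_gr_iff)
      have "(ne_both u v \<longleftrightarrow> min_left_ne u v \<or> min_right u v) \<and> \<not> (min_left_ne u v \<and> min_right u v)"
      proof (cases "u = [] \<or> v = []")
        case True
        then show ?thesis by (auto simp: ne_both_def min_left_ne_def min_left_def min_right_def)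
      next
        case False
        then have ne: "u \<noteq> []" "v \<noteq> []" by auto
        have "Min (letters u) \<in> letters u" "Min (letters v) \<in> letters v" using ne by (intro Min_in; simp)+
        with uv have "Min (letters u) \<noteq> Min (letters v)" by (metis disjoint_iff)
        then show ?thesis
          unfolding ne_both_def min_left_ne_def min_left_def min_right_def A[OF ne] A[OF ne(2,1)]
          using ne by linarith
      qed
      then show "ne_both u v \<longleftrightarrow> min_left_ne u v \<or> min_right u v" "\<not> (min_left_ne u v \<and> min_right u v)"
        by blast+
    qed
    have "{(u, v). (u, v) \<in> splits (enc b) \<and> ne_both u v} = {(u, v). (u, v) \<in> splits (enc b) \<and> min_left_ne u v} \<union>
        {(u, v). (u, v) \<in> splits (enc b) \<and> min_right u v}"
      using *(1) by blast
    moreover have "{(u, v). (u, v) \<in> splits (enc b) \<and> min_left_ne u v} \<inter>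
        {(u, v). (u, v) \<in> splits (enc b) \<and> min_right u v} = {}" using *(2) by blast
    moreover have "finite {(u, v). (u, v) \<in> splits (enc b) \<and> Q u v}" for Q
      by (rule finite_subset[OF _ finite_splits]) auto
    ultimately show ?thesis by (simp add: cop_eq_word[OF True] sum.union_disjoint)
  qed simp
qed (intro lin_intros; simp)+

lemma sw_swap:
  fixes y :: "'i \<times> 'j \<Rightarrow>\<^sub>0 rat" and z :: "'k \<times> 'l \<Rightarrow>\<^sub>0 rat"
  assumes "vector_space t"
  shows "sw t y (\<lambda>a b. sw t z (\<lambda>c d. B a b c d)) = sw t z (\<lambda>c d. sw t y (\<lambda>a b. B a b c d))"
proof (rule bilin_eqI[of t "\<lambda>y z. sw t y (\<lambda>a b. sw t z (\<lambda>c d. B a b c d))" "\<lambda>y z. sw t z (\<lambda>c d. sw t y (\<lambda>a b. B a b c d))"])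
  fix i :: "'i \<times> 'j" and j :: "'k \<times> 'l"
  show "sw t (bv i) (\<lambda>a b. sw t (bv j) (\<lambda>c d. B a b c d)) = sw t (bv j) (\<lambda>c d. sw t (bv i) (\<lambda>a b. B a b c d))"
    using assms by (cases i; cases j) simp
qed (intro bilinI lin_intros assms)+

section \<open>The fundamental theorem of Hopf modules\<close>

lemma gperm_plus_eq: "gperm_plus = pm.span (bv ` plus_basis)"
  by (simp add: gperm_plus_def)

lemma graded_subset: "1 \<le> n \<Longrightarrow> graded n \<subseteq> gperm_plus"
  unfolding graded_def gperm_plus_eq by (rule pm.span_mono) auto

lemma subspace_graded [simp]: "pm.subspace (graded n)"
  unfolding graded_def by simp

lemma subspace_gperm_plus [simp]: "pm.subspace gperm_plus"
  unfolding gperm_plus_eq by simp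

lemma basis_in_graded: "b \<in> graded_perms \<Longrightarrow> bv b \<in> graded (fst b)"
  unfolding graded_def by (rule pm.span_base) auto

lemma lin_eq_on_plus:
  assumes "lin t f" "lin t g" "x \<in> gperm_plus" "\<And>b. b \<in> plus_basis \<Longrightarrow> f (bv b) = g (bv b)"
  shows "f x = g x"
  by (rule lin_eq_on_span[OF assms(1,2) assms(3)[unfolded gperm_plus_eq]]) (use assms(4) in auto)

lemma lin_in_subspace_graded:
  assumes "pm.subspace U" "lin pm_scale f" "x \<in> graded n" "\<And>b. b \<in> graded_perms \<Longrightarrow> fst b = n \<Longrightarrow> f (bv b) \<in> U"
  shows "f x \<in> U"
  by (rule lin_in_subspace[OF assms(1) pm_vector_space assms(2) assms(3)[unfolded graded_def]]) (use assms(4) in auto)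

lemma proper_pairsD:
  "(i, j) \<in> proper_pairs n \<Longrightarrow> i \<in> plus_basis \<and> j \<in> plus_basis \<and> fst i < n \<and> fst j < n \<and> fst i + fst j = n"
  by (auto simp: proper_pairs_def)

text \<open>A right Hopf module structure on \<open>A\<close>. The product \<open>mu\<close> is a
  parameter because it will be \<open>mul\<close> for \<prec> and the opposite product for \<succ>.
  The map \<open>red\<close> is the coaction without the summand x \<otimes> 1. Several laws are
  imposed on basis vectors of \<open>A\<close> or \<open>S\<close> only, since all operations vanish
  on the remaining basis vectors of the ambient space and unit laws fail there.\<close>

locale hopf_module =
  fixes act mu :: "gperm_vec \<Rightarrow> gperm_vec \<Rightarrow> gperm_vec"
    and coact red :: "gperm_vec \<Rightarrow> gperm_tensor"
  assumes bilin_act: "bilin pm_scale act"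
    and bilin_mu: "bilin pm_scale mu"
    and coact_linear: "lin pm_scale coact"
    and act_act: "act (act m h) k = act m (mu h k)"
    and coact_act: "coact (act m h) = psw (coact m) (\<lambda>m1 m2. psw (full_cop h)
          (\<lambda>h1 h2. tens (act m1 h1) (mu m2 h2)))"
    and coact_coassoc: "psw (coact x) (\<lambda>u v. psw (coact u) (\<lambda>u1 u2. B u1 u2 v)) =
          psw (coact x) (\<lambda>u v. psw (full_cop v) (\<lambda>v1 v2. B u v1 v2 :: gperm_tensor))"
    and mu_one: "b \<in> graded_perms \<Longrightarrow> mu (bv b) one = bv b"
    and one_mu: "b \<in> graded_perms \<Longrightarrow> mu one (bv b) = bv b"
    and act_one: "b \<in> plus_basis \<Longrightarrow> act (bv b) one = bv b"
    and act_graded: "i \<in> plus_basis \<Longrightarrow> j \<in> graded_perms \<Longrightarrow> act (bv i) (bv j) \<in> graded (fst i + fst j)"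
    and coact_basis: "b \<in> plus_basis \<Longrightarrow> coact (bv b) = bv (b, unit_word) + red (bv b)"
    and red_span: "b \<in> plus_basis \<Longrightarrow> red (bv b) \<in> pm.span (bv ` proper_pairs (fst b))"
begin

lemma lin_act1 [lin_intros]: "lin pm_scale f \<Longrightarrow> lin pm_scale (\<lambda>x. act (f x) y)"
  by (rule lin_compose[of _ "\<lambda>x. act x y"]) (use bilin_act in \<open>simp_all add: bilin_def\<close>)

lemma lin_act2 [lin_intros]: "lin pm_scale f \<Longrightarrow> lin pm_scale (\<lambda>x. act y (f x))"
  by (rule lin_compose[of _ "\<lambda>x. act y x"]) (use bilin_act in \<open>simp_all add: bilin_def\<close>)

lemma lin_mu1 [lin_intros]: "lin pm_scale f \<Longrightarrow> lin pm_scale (\<lambda>x. mu (f x) y)"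
  by (rule lin_compose[of _ "\<lambda>x. mu x y"]) (use bilin_mu in \<open>simp_all add: bilin_def\<close>)

lemma lin_mu2 [lin_intros]: "lin pm_scale f \<Longrightarrow> lin pm_scale (\<lambda>x. mu y (f x))"
  by (rule lin_compose[of _ "\<lambda>x. mu y x"]) (use bilin_mu in \<open>simp_all add: bilin_def\<close>)

lemma lin_coact [lin_intros]: "lin pm_scale f \<Longrightarrow> lin pm_scale (\<lambda>x. coact (f x))"
  by (rule lin_compose[OF coact_linear])

lemma act_in_graded:
  assumes "x \<in> graded n" "1 \<le> n" "j \<in> graded_perms"
  shows "act x (bv j) \<in> graded (n + fst j)"
proof (rule lin_in_subspace_graded[of _ "\<lambda>x. act x (bv j)", OF _ _ assms(1)])
  fix b :: biword assume "b \<in> graded_perms" "fst b = n"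
  with act_graded[of b j] assms show "act (bv b) (bv j) \<in> graded (n + fst j)" by simp
qed (simp, intro lin_intros)

lemma act_one_plus: "x \<in> gperm_plus \<Longrightarrow> act x one = x"
  by (rule lin_eq_on_plus[of pm_scale "\<lambda>x. act x one" "\<lambda>x. x"], (intro lin_intros)+) (auto simp: act_one)

text \<open>The projection onto the coinvariants along \<open>act A A\<close>, defined by solving
  \<open>x = \<Sum> act (proj x\<^sub>0) x\<^sub>1\<close> for the leading term \<open>proj x\<close>.\<close>

definition proj_basis :: "biword \<Rightarrow> gperm_vec" where
  "proj_basis = wfrec (measure fst) (\<lambda>f b. if b \<in> plus_basis
     then bv b - lext pm_scale (\<lambda>(i, j). act (f i) (bv j)) (red (bv b)) else 0)"

definition proj :: "gperm_vec \<Rightarrow> gperm_vec" where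
  "proj = lext pm_scale proj_basis"

lemma lin_proj [lin_intros]: "lin pm_scale f \<Longrightarrow> lin pm_scale (\<lambda>x. proj (f x))"
  unfolding proj_def by (intro lin_intros) simp

text \<open>The recursion is well founded because the reduced coaction only splits off strictly
  shorter left factors.\<close>

lemma proj_basis_eq: "proj_basis b = (if b \<in> plus_basis
     then bv b - lext pm_scale (\<lambda>(i, j). act (proj_basis i) (bv j)) (red (bv b)) else 0)"
proof -
  let ?T = "\<lambda>f b. if b \<in> plus_basis
     then bv b - lext pm_scale (\<lambda>(i, j). act (f i) (bv j)) (red (bv b)) else 0"
  have "adm_wf (measure fst) ?T"
    unfolding adm_wf_def
  proof (intro allI impI)
    fix f g :: "biword \<Rightarrow> gperm_vec" and b :: biword
    assume eq: "\<forall>z. (z, b) \<in> measure fst \<longrightarrow> f z = g z"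
    show "?T f b =
          ?T g b"
    proof (cases "b \<in> plus_basis")
      case True
      have "lext pm_scale (\<lambda>(i, j). act (f i) (bv j)) (red (bv b)) =
            lext pm_scale (\<lambda>(i, j). act (g i) (bv j)) (red (bv b))"
        by (rule lext_cong_on[OF red_span[OF True]]) (use eq in \<open>auto dest: proper_pairsD\<close>)
      then show ?thesis by simp
    qed auto
  qed
  from fun_cong[OF wfrec_fixpoint[OF wf_measure this], of b] show ?thesis
    unfolding proj_basis_def .
qed

lemma proj_rec:
  assumes "b \<in> plus_basis"
  shows "proj (bv b) = bv b - psw (red (bv b)) (\<lambda>x y. act (proj x) y)"
  using proj_basis_eq[of b] assms by (simp add: proj_def sw_def)

lemma proj_outside: assumes "b \<notin> plus_basis" shows "proj (bv b) = 0"
proof -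
  have "proj_basis b = 0" by (rule trans[OF proj_basis_eq]) (rule if_not_P[OF assms])
  then show ?thesis by (simp add: proj_def)
qed

lemma proj_graded: "b \<in> plus_basis \<Longrightarrow> proj (bv b) \<in> graded (fst b)"
proof (induction "fst b" arbitrary: b rule: less_induct)
  case less
  have "psw (red (bv b)) (\<lambda>x y. act (proj x) y) \<in> graded (fst b)"
  proof (rule sw_in_subspace[OF _ _ red_span[OF less.prems]])
    fix i j assume "(i, j) \<in> proper_pairs (fst b)"
    then have ij: "i \<in> plus_basis" "j \<in> graded_perms" "fst i < fst b" "fst i + fst j = fst b" by (auto dest: proper_pairsD)
    from act_in_graded[OF less.hyps[OF ij(3,1)] _ ij(2)] ij show "act (proj (bv i)) (bv j) \<in> graded (fst b)"
      by simp
  qed simp_all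
  then show ?case using less.prems by (simp add: proj_rec pm.subspace_diff basis_in_graded)
qed

lemma proj_in_plus: "proj x \<in> gperm_plus"
proof -
  have "proj (bv b) \<in> gperm_plus" for b
    using proj_graded[of b] graded_subset[of "fst b"] proj_outside[of b]
    by (cases "b \<in> plus_basis") (auto simp: pm.subspace_0)
  moreover have "x \<in> pm.span (range bv)" by (rule in_span_keys) simp
  ultimately show ?thesis
    by (intro lin_in_subspace[of pm_scale gperm_plus "\<lambda>x. proj x" x "range bv"] lin_intros) auto
qed

text \<open>This is the recursion for \<open>proj\<close> solved for \<open>x\<close>: the summand x
  \<otimes> 1 of the coaction contributes \<open>proj x\<close>.\<close>

lemma reconstruct: "x \<in> gperm_plus \<Longrightarrow> psw (coact x) (\<lambda>u v. act (proj u) v) = x"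
proof (rule lin_eq_on_plus[of pm_scale "\<lambda>x. psw (coact x) (\<lambda>u v. act (proj u) v)" "\<lambda>x. x"])
  fix b assume b: "b \<in> plus_basis"
  show "psw (coact (bv b)) (\<lambda>u v. act (proj u) v) = bv b"
    using act_one_plus[OF proj_in_plus, of "bv b"]
    by (simp add: coact_basis[OF b] sw_add proj_rec[OF b])
qed (intro lin_intros; simp)+

lemma act_in_plus:
  assumes "i \<in> plus_basis" "j \<in> graded_perms" shows "act (bv i) (bv j) \<in> gperm_plus"
  using act_graded[OF assms] graded_subset[of "fst i + fst j"] assms by auto

lemma coact_basis_span:
  assumes "i \<in> plus_basis" shows "coact (bv i) \<in> pm.span (bv ` (plus_basis \<times> graded_perms))"
  unfolding coact_basis[OF assms]
proof (rule pm.span_add)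
  show "bv (i, unit_word) \<in> pm.span (bv ` (plus_basis \<times> graded_perms))"
    by (rule pm.span_base) (use assms in auto)
  have "bv ` proper_pairs (fst i) \<subseteq> bv ` (plus_basis \<times> graded_perms)"
    by (auto simp: proper_pairs_def)
  from subsetD[OF pm.span_mono[OF this] red_span[OF assms]]
  show "red (bv i) \<in> pm.span (bv ` (plus_basis \<times> graded_perms))" .
qed

lemma coact_span:
  assumes "x \<in> gperm_plus" shows "coact x \<in> pm.span (bv ` (plus_basis \<times> graded_perms))"
proof (rule lin_in_subspace[OF _ pm_vector_space lin_coact[OF lin_id] assms[unfolded gperm_plus_eq]])
  fix v assume "v \<in> (bv ` plus_basis :: gperm_vec set)"
  then show "coact v \<in> pm.span (bv ` (plus_basis \<times> graded_perms))"
    using coact_basis_span by blast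
qed simp

text \<open>Expanding \<open>reconstruct\<close> for \<open>act m h\<close> by
  \<open>coact_act\<close> gives summands \<open>act (proj (act m1 h1)) (mu m2 h2)\<close>. Those
  with \<open>h1 = 1\<close> add up to \<open>act m h\<close> itself. Of the others, induction on
  the total length leaves only \<open>proj (act m h)\<close>, which must therefore be zero.\<close>

lemma proj_act_basis:
  "i \<in> plus_basis \<Longrightarrow> j \<in> plus_basis \<Longrightarrow> proj (act (bv i) (bv j)) = 0"
proof (induction "fst i + fst j" arbitrary: i j rule: less_induct)
  case less
  note i = less.prems(1) and j = less.prems(2)
  let ?m = "bv i" and ?h = "bv j"
  let ?K = "\<lambda>m1 m2 h1 h2. act (proj (act m1 h1)) (mu m2 h2)"
  let ?S = psw
  have IH: "?K (bv i') m2 (bv j') h2 = 0"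
    if "i' \<in> plus_basis" "j' \<in> plus_basis" "fst i' + fst j' < fst i + fst j" for i' j' m2 h2
    using less.hyps[OF that(3) that(1,2)] lin_0[OF lin_act1[OF lin_id]] by simp
  have zero: "?S z (\<lambda>x1 x2. 0 :: gperm_vec) = 0" for z :: "gperm_tensor"
    by (simp add: sw_def lext_def)
  have jg: "j \<in> graded_perms" using j by simp
  have full: "full_cop ?h = bv (unit_word, j) + (bv (j, unit_word) + cop ne_both ?h)"
    by (simp only: full_cop_eq[OF jg] ne_left_cop[OF j])
  have nb: "cop ne_both ?h \<in> pm.span (bv ` proper_pairs (fst j))"
    by (rule cop_proper_span[OF jg]) (simp_all add: ne_both_def)
  have red_h: "?S (cop ne_both ?h) (?K (bv i') m2) = 0" if "i' \<in> plus_basis" "fst i' \<le> fst i" for i' m2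
  proof -
    have "?S (cop ne_both ?h) (?K (bv i') m2) = ?S (cop ne_both ?h) (\<lambda>_ _. 0)"
    proof (rule sw_cong[OF nb])
      fix k l assume "(k, l) \<in> proper_pairs (fst j)"
      from proper_pairsD[OF this] that have "k \<in> plus_basis" "fst i' + fst k < fst i + fst j" by auto
      from IH[OF that(1) this] show "?K (bv i') m2 (bv k) (bv l) = 0" .
    qed
    then show ?thesis by (simp only: zero)
  qed
  have co_m: "coact ?m = bv (i, unit_word) + red ?m" by (rule coact_basis[OF i])
  note span_m = coact_basis_span[OF i]
  have "act ?m ?h = ?S (coact (act ?m ?h)) (\<lambda>u v. act (proj u) v)"
    using reconstruct[OF act_in_plus[OF i jg]] by simp
  also have "\<dots> = ?S (coact ?m) (\<lambda>m1 m2. ?S (full_cop ?h) (?K m1 m2))"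
  proof -
    have b: "bilin pm_scale (\<lambda>u v. act (proj u) v)" by (intro bilinI lin_intros)
    show ?thesis
      unfolding coact_act
        sw_sw[OF pm_vector_space]
        sw_tens[OF pm_vector_space b] by (rule refl)
  qed
  also have "\<dots> = ?S (coact ?m) (\<lambda>m1 m2. ?K m1 m2 one ?h) +
      ?S (coact ?m) (\<lambda>m1 m2. ?K m1 m2 ?h one + ?S (cop ne_both ?h) (?K m1 m2))"
    by (simp add: full sw_add sw_fun_add)
  \<comment> \<open>By associativity \<open>h\<close> is applied last, and
    \<open>reconstruct\<close> for \<open>m\<close> then returns \<open>act m h\<close>, which
    cancels against the left-hand side.\<close>
  also have "?S (coact ?m) (\<lambda>m1 m2. ?K m1 m2 one ?h) = ?S (coact ?m) (\<lambda>m1 m2. act (act (proj m1) m2) ?h)"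
    by (rule sw_cong[OF span_m]) (auto simp: act_one act_act)
  also have "\<dots> = act ?m ?h"
    by (subst (2) reconstruct[of ?m, symmetric])
       (use i in \<open>auto simp: gperm_plus_eq pm.span_base lin_sw[OF pm_vector_space pm_vector_space lin_act1[OF lin_id]]\<close>)
  \<comment> \<open>Here \<open>h1\<close> has positive length, so the induction hypothesis applies
    unless \<open>m1\<close> is \<open>m\<close> and \<open>h1\<close> is \<open>h\<close>.\<close>
  also have "?S (coact ?m) (\<lambda>m1 m2. ?K m1 m2 ?h one + ?S (cop ne_both ?h) (?K m1 m2)) = proj (act ?m ?h)"
  proof -
    have "?S (red ?m) (\<lambda>m1 m2. ?K m1 m2 ?h one + ?S (cop ne_both ?h) (?K m1 m2)) = ?S (red ?m) (\<lambda>m1 m2. 0)"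
    proof (rule sw_cong[OF red_span[OF i]])
      fix k l assume "(k, l) \<in> proper_pairs (fst i)"
      from proper_pairsD[OF this] have k: "k \<in> plus_basis" "fst k + fst j < fst i + fst j" "fst k \<le> fst i" by auto
      from IH[OF k(1) j k(2)] red_h[OF k(1,3)]
      show "?K (bv k) (bv l) ?h one + ?S (cop ne_both ?h) (?K (bv k) (bv l)) = 0"
        by (simp only: add_0)
    qed
    moreover have "?K ?m one ?h one = proj (act ?m ?h)"
      by (simp add: mu_one act_one_plus[OF proj_in_plus])
    ultimately show ?thesis using red_h[OF i, of one] by (simp add: co_m sw_add zero)
  qed
  finally show ?case by simp
qed

lemma proj_act:
  assumes "x \<in> gperm_plus" "y \<in> gperm_plus" shows "proj (act x y) = 0"
proof (rule lin_eq_on_plus[of pm_scale "\<lambda>x. proj (act x y)" "\<lambda>x. 0", OF _ _ assms(1)])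
  fix i assume i: "i \<in> plus_basis"
  show "proj (act (bv i) y) = 0"
    by (rule lin_eq_on_plus[of pm_scale "\<lambda>y. proj (act (bv i) y)" "\<lambda>x. 0", OF _ _ assms(2)])
       ((intro lin_intros; simp)+, use i proj_act_basis in blast)
qed (intro lin_intros; simp)+

text \<open>Applying the coaction to \<open>reconstruct\<close> and using coinvariance of the
  shorter \<open>proj x0\<close> expresses \<open>coact x\<close> as \<open>coact (proj x)\<close>
  plus the sum of \<open>?\<Psi>\<close> over \<open>red x\<close>. The sum of
  \<open>?\<Psi>\<close> over all of \<open>coact x\<close> is again \<open>coact x\<close>, and the
  term by which the two sums differ is \<open>tens (proj x) one\<close>.\<close>

lemma coact_proj_basis:
  "b \<in> plus_basis \<Longrightarrow> coact (proj (bv b)) = tens (proj (bv b)) one"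
proof (induction "fst b" arbitrary: b rule: less_induct)
  case less
  note b = less.prems
  let ?S = psw
  let ?x = "bv b"
  let ?\<Psi> = "\<lambda>x0 x1. ?S (full_cop x1) (\<lambda>h1 h2. tens (act (proj x0) h1) h2)"
  let ?\<Phi> = "\<lambda>z h. ?S z (\<lambda>m1 m2. ?S (full_cop h) (\<lambda>h1 h2. tens (act m1 h1) (mu m2 h2)))"
  have xp: "?x \<in> gperm_plus" using b by (auto simp: gperm_plus_eq intro: pm.span_base)
  have span_h: "full_cop (bv j) \<in> pm.span (bv ` (graded_perms \<times> graded_perms))" if "j \<in> graded_perms" for j
    using cop_span[OF that, of "\<lambda>_ _. True"] by (rule subsetD[OF pm.span_mono, rotated]) auto
  have \<Phi>_tens: "?\<Phi> (tens (proj (bv i)) one) (bv j) = ?\<Psi> (bv i) (bv j)"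
    if "j \<in> graded_perms" for i j
  proof -
    have "bilin pm_scale (\<lambda>m1 m2. ?S (full_cop (bv j)) (\<lambda>h1 h2. tens (act m1 h1) (mu m2 h2)))"
      by (intro bilinI lin_intros; simp)
    then have "?\<Phi> (tens (proj (bv i)) one) (bv j) =
        ?S (full_cop (bv j)) (\<lambda>h1 h2. tens (act (proj (bv i)) h1) (mu one h2))"
      by (rule sw_tens[OF pm_vector_space])
    also have "\<dots> = ?\<Psi> (bv i) (bv j)"
      by (rule sw_cong[OF span_h[OF that]]) (simp add: one_mu)
    finally show ?thesis .
  qed
  have \<Phi>_one: "?\<Phi> z one = z" if "z \<in> pm.span (bv ` (plus_basis \<times> graded_perms))" for z
  proof -
    have "?\<Phi> z one = ?S z tens"
      by (rule sw_cong[OF that]) (simp add: full_cop_one act_one mu_one)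
    then show ?thesis by simp
  qed
  have co: "coact ?x = bv (b, unit_word) + red ?x" by (rule coact_basis[OF b])
  have "coact ?x = coact (?S (coact ?x) (\<lambda>u v. act (proj u) v))" by (simp add: reconstruct[OF xp])
  also have "\<dots> = ?S (coact ?x) (\<lambda>u v. ?\<Phi> (coact (proj u)) v)"
    unfolding lin_sw[OF pm_vector_space pm_vector_space lin_coact[OF lin_id]] coact_act ..
  also have "\<dots> = coact (proj ?x) + ?S (red ?x) (\<lambda>u v. ?\<Phi> (coact (proj u)) v)"
    unfolding co sw_add[OF pm_vector_space] sw_basis_vec[OF pm_vector_space] \<Phi>_one[OF coact_span[OF proj_in_plus]] ..
  also have "?S (red ?x) (\<lambda>u v. ?\<Phi> (coact (proj u)) v) = ?S (red ?x) ?\<Psi>"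
  proof (rule sw_cong[OF red_span[OF b]])
    fix k l assume "(k, l) \<in> proper_pairs (fst b)"
    from proper_pairsD[OF this] have "k \<in> plus_basis" "l \<in> graded_perms" "fst k < fst b" by auto
    with less.hyps[of k] \<Phi>_tens[of l k]
    show "?\<Phi> (coact (proj (bv k))) (bv l) = ?\<Psi> (bv k) (bv l)" by (simp only:)
  qed
  also have "\<dots> = ?S (coact ?x) ?\<Psi> - tens (proj ?x) one"
    by (simp add: co sw_add full_cop_one act_one_plus[OF proj_in_plus])
  \<comment> \<open>Coassociativity moves the second cut to the left factor, where
    \<open>reconstruct\<close> applies.\<close>
  also have "?S (coact ?x) ?\<Psi> = ?S (coact ?x) (\<lambda>u v. ?S (coact u) (\<lambda>u1 u2. tens (act (proj u1) u2) v))"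
    by (rule coact_coassoc[symmetric])
  also have "\<dots> = ?S (coact ?x) (\<lambda>u v. tens u v)"
  proof (rule sw_cong[OF coact_span[OF xp]])
    fix i j assume "(i, j) \<in> plus_basis \<times> graded_perms"
    then have "(bv i :: gperm_vec) \<in> gperm_plus" by (auto simp: gperm_plus_eq intro: pm.span_base)
    from reconstruct[OF this]
    show "?S (coact (bv i)) (\<lambda>u1 u2. tens (act (proj u1) u2) (bv j)) = tens (bv i) (bv j)"
      by (simp add: lin_sw[OF pm_vector_space pm_vector_space lin_tens1[OF lin_id], symmetric])
  qed
  finally show ?case by simp
qed

lemma coact_proj: "coact (proj x) = tens (proj x) one"
proof (rule lin_eqI[of pm_scale "\<lambda>x. coact (proj x)" "\<lambda>x. tens (proj x) one"])
  fix b
  show "coact (proj (bv b)) = tens (proj (bv b)) one"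
  proof (cases "b \<in> plus_basis")
    case False
    have "tens (0 :: gperm_vec) one = 0" by (rule lin_0[of pm_scale "\<lambda>x. tens x one"], intro lin_intros)
    then show ?thesis using proj_outside[OF False] lin_0[OF coact_linear] by (simp only:)
  qed (rule coact_proj_basis)
qed (intro lin_intros)+

lemma proj_coinvariant:
  assumes "x \<in> gperm_plus" "coact x = tens x one" shows "proj x = x"
proof -
  have "psw (tens x one) (\<lambda>u v. act (proj u) v) = act (proj x) one"
    by (intro sw_tens bilinI lin_intros) simp
  then show ?thesis using reconstruct[OF assms(1)] assms(2) act_one_plus[OF proj_in_plus] by simp
qed

end

section \<open>The projection onto the primitive elements\<close>

lemma in_gperm_plus: "b \<in> plus_basis \<Longrightarrow> bv b \<in> gperm_plus"
  unfolding gperm_plus_eq by (rule pm.span_base) auto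

lemma lin_range_in_subspace:
  assumes "pm.subspace U" "lin pm_scale f" "\<And>i. f (bv i) \<in> U" shows "f x \<in> U"
proof -
  have "x \<in> pm.span (range bv)" by (rule in_span_keys) blast
  from lin_in_subspace[OF assms(1) pm_vector_space assms(2) this] assms(3) show ?thesis by blast
qed

lemma bilin_in_subspace:
  assumes "pm.subspace U" "bilin pm_scale B" "\<And>i j. B (bv i) (bv j) \<in> U" shows "B x y \<in> U"
proof -
  have "B (bv i) y \<in> U" for i
    by (rule lin_range_in_subspace[OF assms(1), of "B (bv i)"]) (use assms(2,3) in \<open>simp_all add: bilin_def\<close>)
  then show ?thesis
    by (rule lin_range_in_subspace[OF assms(1), of "\<lambda>x. B x y", rotated]) (use assms(2) in \<open>simp add: bilin_def\<close>)
qed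

lemma bilin_prd: "bilin pm_scale (prd R)"
  by (intro bilinI lin_intros)

lemma prec_in_plus: "x \<lhd> y \<in> gperm_plus"
proof -
  have *: "bv i \<lhd> bv j \<in> gperm_plus" for i j
  proof (cases "i \<in> plus_basis \<and> j \<in> graded_perms")
    case True
    then show ?thesis using prd_graded[of i j startl] graded_subset[of "fst i + fst j"] by auto
  next
    case False
    then have "bv i \<lhd> bv j = 0" using prec_outside[of i] prd_outside2[of j startl] by blast
    then show ?thesis by (simp only: pm.subspace_0[OF subspace_gperm_plus])
  qed
  show ?thesis by (rule bilin_in_subspace[OF subspace_gperm_plus bilin_prd *])
qed

lemma succ_in_plus: "x \<rhd> y \<in> gperm_plus"
proof -
  have *: "bv i \<rhd> bv j \<in> gperm_plus" for i j
  proof (cases "j \<in> plus_basis \<and> i \<in> graded_perms")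
    case True
    then show ?thesis using prd_graded[of i j startr] graded_subset[of "fst i + fst j"] by auto
  next
    case False
    then have "bv i \<rhd> bv j = 0" using succ_outside[of j] prd_outside1[of i startr] by blast
    then show ?thesis by (simp only: pm.subspace_0[OF subspace_gperm_plus])
  qed
  show ?thesis by (rule bilin_in_subspace[OF subspace_gperm_plus bilin_prd *])
qed

interpretation R: hopf_module "prd startl" mul "cop min_left" "cop min_left_ne"
proof
  show "lin pm_scale (cop min_left)" by (rule lin_cop[OF lin_id])
  show "cop min_left_ne (bv b) \<in> pm.span (bv ` proper_pairs (fst b))" if "b \<in> plus_basis" for b
    by (rule cop_proper_span) (use that in \<open>auto simp: min_left_ne_def min_left_def\<close>)
  show "bv i \<lhd> bv j \<in> graded (fst i + fst j)" if "i \<in> plus_basis" "j \<in> graded_perms" for i j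
    using prd_graded that by blast
qed (simp_all add: bilin_prd prec_prec min_cop_prec min_left_coassoc min_left_cop)

text \<open>The left action by \<succ> is read as a right action of the opposite algebra. Exchanging
  two Sweedler sums brings \<open>cop_succ\<close> into the order required by the locale.\<close>

interpretation L: hopf_module "\<lambda>m h. h \<rhd> m" "\<lambda>h k. mul k h" "cop ne_left" "cop ne_both"
proof
  show "lin pm_scale (cop ne_left)" by (rule lin_cop[OF lin_id])
  show "cop ne_both (bv b) \<in> pm.span (bv ` proper_pairs (fst b))" if "b \<in> plus_basis" for b
    by (rule cop_proper_span) (use that in \<open>auto simp: ne_both_def\<close>)
  show "bv j \<rhd> bv i \<in> graded (fst i + fst j)" if "i \<in> plus_basis" "j \<in> graded_perms" for i j
    using prd_graded[of j i startr] that by (simp add: add.commute)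
  show "bilin pm_scale (\<lambda>m h. h \<rhd> m)" "bilin pm_scale (\<lambda>h k. mul k h)"
    by (intro bilinI lin_intros)+
  show "cop ne_left (h \<rhd> m) = psw (cop ne_left m) (\<lambda>m1 m2. psw (full_cop h)
      (\<lambda>h1 h2. tens (h1 \<rhd> m1) (mul h2 m2)))" for m h
    unfolding cop_succ by (rule sw_swap) simp
qed (simp_all add: mul_succ ne_left_coassoc ne_left_cop)

lemma cop_plus_eq:
  assumes "x \<in> gperm_plus"
  shows "cop ne_left x = tens x one + cop ne_both x" "cop min_left x = tens x one + cop min_left_ne x"
proof -
  show "cop ne_left x = tens x one + cop ne_both x"
    by (rule lin_eq_on_plus[of pm_scale "\<lambda>x. cop ne_left x" "\<lambda>x. tens x one + cop ne_both x", OF _ _ assms], (intro lin_intros; simp)+)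
       (simp add: ne_left_cop)
  show "cop min_left x = tens x one + cop min_left_ne x"
    by (rule lin_eq_on_plus[of pm_scale "\<lambda>x. cop min_left x" "\<lambda>x. tens x one + cop min_left_ne x", OF _ _ assms], (intro lin_intros; simp)+)
       (simp add: min_left_cop)
qed

lemma cop_proper_plus_span:
  assumes "x \<in> gperm_plus" "\<And>u v. Q u v \<Longrightarrow> u \<noteq> [] \<and> v \<noteq> []"
  shows "cop Q x \<in> pm.span (bv ` (plus_basis \<times> plus_basis))"
proof (rule lin_in_subspace[OF _ pm_vector_space lin_cop[OF lin_id] assms(1)[unfolded gperm_plus_eq]])
  fix v assume "v \<in> (bv ` plus_basis :: gperm_vec set)"
  then obtain i where i: "i \<in> plus_basis" "v = bv i" by auto
  have "bv ` proper_pairs (fst i) \<subseteq> bv ` (plus_basis \<times> plus_basis)" by (auto simp: proper_pairs_def)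
  moreover have "cop Q (bv i) \<in> pm.span (bv ` proper_pairs (fst i))"
    by (rule cop_proper_span) (use i assms(2) in auto)
  ultimately show "cop Q v \<in> pm.span (bv ` (plus_basis \<times> plus_basis))"
    using pm.span_mono i(2) by blast
qed simp

definition prim_proj :: "gperm_vec \<Rightarrow> gperm_vec" where
  "prim_proj x = L.proj (R.proj x)"

text \<open>The common coinvariants of the two Hopf modules. In this form the results on
  coinvariants apply directly; the agreement with \<open>prim_dend\<close> is
  \<open>prim_dend_eq\<close>.\<close>

definition primitive :: "gperm_vec set" where
  "primitive = {x \<in> gperm_plus. cop min_left x = tens x one \<and> cop ne_left x = tens x one}"

lemma lin_prim_proj [lin_intros]: "lin pm_scale f \<Longrightarrow> lin pm_scale (\<lambda>x. prim_proj (f x))"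
  unfolding prim_proj_def by (intro lin_intros)

text \<open>If \<open>\<Delta>\<^sub>\<prec> w = 0\<close>, the proper cuts of \<open>w\<close> are
  those of \<open>\<Delta>\<^sub>\<succ>\<close>, so \<open>L.proj w\<close> differs from
  \<open>w\<close> by the sum of \<open>v \<succ> L.proj u\<close> over
  \<open>\<Delta>\<^sub>\<succ> w\<close>. Applying \<open>\<Delta>\<^sub>\<prec>\<close> to this
  sum cuts only \<open>v\<close>, and \<open>min_right_coassoc\<close> rewrites the result as a sum
  over \<open>\<Delta>\<^sub>\<prec> w\<close>, which is zero.\<close>

lemma min_cop_L_proj:
  assumes w: "w \<in> gperm_plus" "cop min_left w = tens w one"
  shows "cop min_left (L.proj w) = tens (L.proj w) one"
proof -
  let ?S = psw
  have ml: "cop min_left_ne w = 0" using cop_plus_eq(2)[OF w(1)] w(2) by simp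
  have "w = ?S (tens w one) (\<lambda>u v. v \<rhd> L.proj u) + ?S (cop ne_both w) (\<lambda>u v. v \<rhd> L.proj u)"
    using L.reconstruct[OF w(1)] by (simp add: cop_plus_eq[OF w(1)] sw_add)
  also have "?S (tens w one) (\<lambda>u v. v \<rhd> L.proj u) = one \<rhd> L.proj w"
    by (intro sw_tens bilinI lin_intros) simp
  also have "\<dots> = L.proj w" by (rule L.act_one_plus[OF L.proj_in_plus])
  finally have "w = L.proj w + ?S (cop ne_both w) (\<lambda>u v. v \<rhd> L.proj u)" .
  moreover have "cop ne_both w = cop min_right w" unfolding ne_both_cop[of w] ml by simp
  ultimately have pw: "L.proj w = w - ?S (cop min_right w) (\<lambda>u v. v \<rhd> L.proj u)"
    by (metis add_diff_cancel_right')
  \<comment> \<open>\<open>L.proj u\<close> is coinvariant, so in the coproduct of the product only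
    \<open>v\<close> is cut.\<close>
  have key: "cop min_left_ne (bv v \<rhd> L.proj u) = ?S (cop min_left_ne (bv v)) (\<lambda>v1 v2. tens (v1 \<rhd> L.proj u) v2)"
    if v: "v \<in> plus_basis" for u v
  proof -
    let ?p = "L.proj u"
    have nb: "cop min_left_ne (bv v) \<in> pm.span (bv ` (plus_basis \<times> plus_basis))"
      by (rule cop_proper_plus_span[OF in_gperm_plus[OF v]]) (simp_all add: min_left_ne_def min_left_def)
    have "tens (bv v \<rhd> ?p) one + cop min_left_ne (bv v \<rhd> ?p) = cop min_left (bv v \<rhd> ?p)"
      by (rule cop_plus_eq(2)[OF succ_in_plus, symmetric])
    also have "\<dots> = ?S (cop min_left (bv v)) (\<lambda>v1 v2. ?S (cop ne_left ?p) (\<lambda>y1 y2. tens (v1 \<rhd> y1) (mul v2 y2)))"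
      unfolding succ_startr'[OF v, symmetric] by (rule min_cop_succ)
    also have "\<dots> = ?S (cop min_left (bv v)) (\<lambda>v1 v2. tens (v1 \<rhd> ?p) (mul v2 one))"
    proof -
      have "?S (cop ne_left ?p) (\<lambda>y1 y2. tens (v1 \<rhd> y1) (mul v2 y2)) = tens (v1 \<rhd> ?p) (mul v2 one)" for v1 v2
        unfolding L.coact_proj by (intro sw_tens bilinI lin_intros) simp
      then show ?thesis by simp
    qed
    also have "\<dots> = tens (bv v \<rhd> ?p) one + ?S (cop min_left_ne (bv v)) (\<lambda>v1 v2. tens (v1 \<rhd> ?p) (mul v2 one))"
      by (simp add: min_left_cop[OF v] sw_add)
    also have "?S (cop min_left_ne (bv v)) (\<lambda>v1 v2. tens (v1 \<rhd> ?p) (mul v2 one)) =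
        ?S (cop min_left_ne (bv v)) (\<lambda>v1 v2. tens (v1 \<rhd> ?p) v2)"
      by (rule sw_cong[OF nb]) simp
    finally show ?thesis by simp
  qed
  have mr: "cop min_right w \<in> pm.span (bv ` (plus_basis \<times> plus_basis))"
    by (rule cop_proper_plus_span[OF w(1)]) (simp_all add: min_right_def)
  have "cop min_left_ne (?S (cop min_right w) (\<lambda>u v. v \<rhd> L.proj u)) =
      ?S (cop min_right w) (\<lambda>u v. cop min_left_ne (v \<rhd> L.proj u))"
    by (rule lin_sw[OF pm_vector_space pm_vector_space lin_cop[OF lin_id]])
  also have "\<dots> = ?S (cop min_right w) (\<lambda>u v. ?S (cop min_left_ne v) (\<lambda>v1 v2. tens (v1 \<rhd> L.proj u) v2))"
    by (rule sw_cong[OF mr]) (use key in blast)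
  also have "\<dots> = ?S (cop min_left_ne w) (\<lambda>u v. ?S (cop min_right u) (\<lambda>u1 u2. tens (u2 \<rhd> L.proj u1) v))"
    by (rule min_right_coassoc[symmetric]) simp
  also have "\<dots> = 0" by (simp add: ml)
  finally have "cop min_left_ne (L.proj w) = 0"
    unfolding pw lin_sub[OF lin_cop[OF lin_id]] using ml by simp
  then show ?thesis using cop_plus_eq(2)[OF L.proj_in_plus, of w] by simp
qed

lemma prim_proj_primitive: "prim_proj x \<in> primitive"
  unfolding primitive_def prim_proj_def
  using L.proj_in_plus L.coact_proj min_cop_L_proj[OF R.proj_in_plus R.coact_proj] by blast

lemma prim_proj_id: "x \<in> primitive \<Longrightarrow> prim_proj x = x"
  by (simp add: primitive_def prim_proj_def R.proj_coinvariant L.proj_coinvariant)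

lemma prim_proj_prec: "x \<in> gperm_plus \<Longrightarrow> y \<in> gperm_plus \<Longrightarrow> prim_proj (x \<lhd> y) = 0"
  unfolding prim_proj_def using R.proj_act lin_0[OF L.lin_proj[OF lin_id]] by simp

section \<open>The primitive projection on products with \<succ>\<close>

definition succ_span :: "gperm_vec set" where
  "succ_span = pm.span {x \<rhd> y | x y. x \<in> gperm_plus \<and> y \<in> gperm_plus}"

lemma succ_span_prec: "x \<in> succ_span \<Longrightarrow> x \<lhd> h \<in> succ_span"
  unfolding succ_span_def
proof (rule lin_in_subspace[OF _ pm_vector_space lin_prd1[OF lin_id]])
  fix z :: "gperm_vec" assume "z \<in> {x \<rhd> y | x y. x \<in> gperm_plus \<and> y \<in> gperm_plus}"
  then obtain x y where "z = x \<rhd> y" "x \<in> gperm_plus" "y \<in> gperm_plus" by blast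
  then have "z \<lhd> h = x \<rhd> (y \<lhd> h)" by (simp only: succ_prec)
  with \<open>x \<in> gperm_plus\<close> show "z \<lhd> h \<in> pm.span {x \<rhd> y | x y. x \<in> gperm_plus \<and> y \<in> gperm_plus}"
    using prec_in_plus by (blast intro: pm.span_base)
qed simp_all

text \<open>Expand \<open>R.reconstruct\<close> for \<open>x \<succ> y\<close> by
  \<open>min_cop_succ\<close> and solve for the leading term. All other summands are
  \<open>R.proj (x1 \<succ> y1) \<prec> h\<close> with \<open>x1\<close> and \<open>y1\<close> of
  smaller total length; they lie in \<open>succ_span\<close> by induction, since that space is
  closed under \<prec> from the right.\<close>

lemma R_proj_succ_basis:
  "i \<in> plus_basis \<Longrightarrow> j \<in> plus_basis \<Longrightarrow> R.proj (bv i \<rhd> bv j) \<in> succ_span"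
proof (induction "fst i + fst j" arbitrary: i j rule: less_induct)
  case less
  note i = less.prems(1) and j = less.prems(2)
  let ?x = "bv i" and ?y = "bv j"
  let ?S = psw
  let ?K = "\<lambda>x1 x2 y1 y2. R.proj (x1 \<rhd> y1) \<lhd> mul x2 y2"
  have sub: "pm.subspace succ_span" by (simp add: succ_span_def)
  have b: "bilin pm_scale (\<lambda>u v. R.proj u \<lhd> v)" by (intro bilinI lin_intros)
  have nj: "cop ne_both ?y \<in> pm.span (bv ` proper_pairs (fst j))" using j by (rule L.red_span)
  have ni: "cop min_left_ne ?x \<in> pm.span (bv ` proper_pairs (fst i))" using i by (rule R.red_span)
  have IH: "?K (bv k) x2 (bv l) y2 \<in> succ_span"
    if "k \<in> plus_basis" "l \<in> plus_basis" "fst k + fst l < fst i + fst j" for k l x2 y2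
    using less.hyps[OF that(3,1,2)] by (rule succ_span_prec)
  have in_j: "?S (cop ne_both ?y) (?K (bv k) x2) \<in> succ_span" if "k \<in> plus_basis" "fst k \<le> fst i" for k x2
  proof (rule sw_in_subspace[OF sub pm_vector_space nj])
    fix l m assume "(l, m) \<in> proper_pairs (fst j)"
    from proper_pairsD[OF this] that have "l \<in> plus_basis" "fst k + fst l < fst i + fst j" by auto
    from IH[OF that(1) this] show "?K (bv k) x2 (bv l) (bv m) \<in> succ_span" .
  qed
  have "?x \<rhd> ?y = ?S (cop min_left (?x \<rhd> ?y)) (\<lambda>u v. R.proj u \<lhd> v)"
    by (rule R.reconstruct[OF succ_in_plus, symmetric])
  also have "\<dots> = ?S (cop min_left ?x) (\<lambda>x1 x2. ?S (cop ne_left ?y) (?K x1 x2))"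
    unfolding succ_startr'[OF i, symmetric] min_cop_succ
      sw_sw[OF pm_vector_space]
      sw_tens[OF pm_vector_space b] ..
  also have "\<dots> = R.proj (?x \<rhd> ?y) + ?S (cop ne_both ?y) (?K ?x one) +
      ?S (cop min_left_ne ?x) (\<lambda>x1 x2. ?K x1 x2 ?y one + ?S (cop ne_both ?y) (?K x1 x2))"
    by (simp add: min_left_cop[OF i] ne_left_cop[OF j] sw_add R.act_one_plus[OF R.proj_in_plus])
  finally have eq: "R.proj (?x \<rhd> ?y) = ?x \<rhd> ?y - ?S (cop ne_both ?y) (?K ?x one) -
      ?S (cop min_left_ne ?x) (\<lambda>x1 x2. ?K x1 x2 ?y one + ?S (cop ne_both ?y) (?K x1 x2))"
    by (simp add: algebra_simps)
  have "?S (cop min_left_ne ?x) (\<lambda>x1 x2. ?K x1 x2 ?y one + ?S (cop ne_both ?y) (?K x1 x2)) \<in> succ_span"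
  proof (rule sw_in_subspace[OF sub pm_vector_space ni])
    fix k l assume "(k, l) \<in> proper_pairs (fst i)"
    from proper_pairsD[OF this] have k: "k \<in> plus_basis" "fst k + fst j < fst i + fst j" "fst k \<le> fst i" by auto
    show "?K (bv k) (bv l) ?y one + ?S (cop ne_both ?y) (?K (bv k) (bv l)) \<in> succ_span"
      by (intro pm.subspace_add[OF sub] IH[OF k(1) j k(2)] in_j[OF k(1,3)])
  qed
  moreover have "?x \<rhd> ?y \<in> succ_span"
    unfolding succ_span_def by (rule pm.span_base) (use in_gperm_plus i j in blast)
  ultimately show ?case unfolding eq
    using in_j[OF i] by (intro pm.subspace_diff[OF sub]) simp_all
qed

lemma prim_proj_succ:
  assumes "x \<in> gperm_plus" "y \<in> gperm_plus" shows "prim_proj (x \<rhd> y) = 0"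
proof -
  have L0: "L.proj z = 0" if "z \<in> succ_span" for z
    by (rule lin_eq_on_span[OF L.lin_proj[OF lin_id] lin_zero[OF pm_vector_space] that[unfolded succ_span_def]])
       (auto simp: L.proj_act)
  have "prim_proj (bv i \<rhd> bv j) = 0" if "i \<in> plus_basis" "j \<in> plus_basis" for i j
    unfolding prim_proj_def using R_proj_succ_basis[OF that] by (rule L0)
  then have "prim_proj (bv i \<rhd> y) = 0" if "i \<in> plus_basis" for i
    using that by (intro lin_eq_on_plus[of pm_scale "\<lambda>y. prim_proj (bv i \<rhd> y)" "\<lambda>x. 0", OF _ _ assms(2)] lin_intros) simp_all
  then show ?thesis
    by (intro lin_eq_on_plus[of pm_scale "\<lambda>x. prim_proj (x \<rhd> y)" "\<lambda>x. 0", OF _ _ assms(1)] lin_intros) simp_all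
qed

section \<open>Generation by the primitive elements\<close>

text \<open>The strict bounds on the outer factors make induction on the length possible. Both outer
  factors may be the unit, so a primitive element is itself such a form.\<close>

definition normal_forms :: "nat \<Rightarrow> gperm_vec set" where
  "normal_forms n = pm.span {bv i \<rhd> (v \<lhd> bv j) | i j v.
     v \<in> primitive \<and> i \<in> graded_perms \<and> j \<in> graded_perms \<and> fst i < n \<and> fst j < n}"

lemma subspace_normal_forms [simp]: "pm.subspace (normal_forms n)"
  by (simp add: normal_forms_def)

lemma lin_eq_on_normal_forms:
  assumes "lin t f" "lin t h" "x \<in> normal_forms n"
    "\<And>i j v. v \<in> primitive \<Longrightarrow> i \<in> graded_perms \<Longrightarrow> j \<in> graded_perms \<Longrightarrow> fst i < n \<Longrightarrow> fst j < n \<Longrightarrow>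
      f (bv i \<rhd> (v \<lhd> bv j)) = h (bv i \<rhd> (v \<lhd> bv j))"
  shows "f x = h x"
  by (rule lin_eq_on_span[OF assms(1,2) assms(3)[unfolded normal_forms_def]]) (use assms(4) in blast)

lemma lin_in_subspace_normal_forms:
  assumes "module.subspace t U" "vector_space t" "lin t f" "x \<in> normal_forms n"
    "\<And>i j v. v \<in> primitive \<Longrightarrow> i \<in> graded_perms \<Longrightarrow> j \<in> graded_perms \<Longrightarrow> fst i < n \<Longrightarrow> fst j < n \<Longrightarrow>
      f (bv i \<rhd> (v \<lhd> bv j)) \<in> U"
  shows "f x \<in> U"
  by (rule lin_in_subspace[OF assms(1-3) assms(4)[unfolded normal_forms_def]]) (use assms(5) in blast)

lemma normal_formsI:
  "v \<in> primitive \<Longrightarrow> i \<in> graded_perms \<Longrightarrow> j \<in> graded_perms \<Longrightarrow> fst i < n \<Longrightarrow> fst j < n \<Longrightarrow>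
   bv i \<rhd> (v \<lhd> bv j) \<in> normal_forms n"
  unfolding normal_forms_def by (rule pm.span_base) blast

lemma primitive_normal_forms: assumes "v \<in> primitive" "1 \<le> n" shows "v \<in> normal_forms n"
proof -
  have "v \<in> gperm_plus" using assms by (simp add: primitive_def)
  then have "one \<rhd> (v \<lhd> one) = v" using R.act_one_plus L.act_one_plus by simp
  moreover have "one \<rhd> (v \<lhd> one) \<in> normal_forms n" by (rule normal_formsI) (use assms in simp_all)
  ultimately show ?thesis by simp
qed

text \<open>The axioms absorb the new factor into the right one, \<open>(l \<succ> (v \<prec> r))
  \<prec> h = l \<succ> (v \<prec> (r * h))\<close>, so only the bound on the lengths grows.\<close>

lemma normal_forms_prec:
  assumes "x \<in> normal_forms m" "j \<in> graded_perms" "m + fst j \<le> n" shows "x \<lhd> bv j \<in> normal_forms n"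
proof (rule lin_in_subspace_normal_forms[OF _ pm_vector_space lin_prd1[OF lin_id] assms(1)])
  fix i k v
  assume z: "v \<in> primitive" "i \<in> graded_perms" "k \<in> graded_perms" "fst i < m" "fst k < m"
  have "mul (bv k) (bv j) \<in> graded (fst k + fst j)" by (rule prd_graded[OF z(3) assms(2)])
  then have "bv i \<rhd> (v \<lhd> mul (bv k) (bv j)) \<in> normal_forms n"
  proof (rule lin_in_subspace_graded[of _ "\<lambda>h. bv i \<rhd> (v \<lhd> h)", rotated 2])
    show "lin pm_scale (\<lambda>h. bv i \<rhd> (v \<lhd> h))" by (intro lin_intros)
    show "bv i \<rhd> (v \<lhd> bv b) \<in> normal_forms n" if "b \<in> graded_perms" "fst b = fst k + fst j" for b
      using that z assms by (intro normal_formsI) simp_all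
  qed simp
  then show "bv i \<rhd> (v \<lhd> bv k) \<lhd> bv j \<in> normal_forms n" by (simp add: succ_prec prec_prec)
qed simp

lemma normal_forms_succ:
  assumes "x \<in> normal_forms m" "j \<in> graded_perms" "m + fst j \<le> n" shows "bv j \<rhd> x \<in> normal_forms n"
proof (rule lin_in_subspace_normal_forms[OF _ pm_vector_space lin_prd2[OF lin_id] assms(1)])
  fix i k v
  assume z: "v \<in> primitive" "i \<in> graded_perms" "k \<in> graded_perms" "fst i < m" "fst k < m"
  have "mul (bv j) (bv i) \<in> graded (fst j + fst i)" by (rule prd_graded[OF assms(2) z(2)])
  then have "mul (bv j) (bv i) \<rhd> (v \<lhd> bv k) \<in> normal_forms n"
  proof (rule lin_in_subspace_graded[of _ "\<lambda>h. h \<rhd> (v \<lhd> bv k)", rotated 2])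
    show "lin pm_scale (\<lambda>h. h \<rhd> (v \<lhd> bv k))" by (intro lin_intros)
    show "bv b \<rhd> (v \<lhd> bv k) \<in> normal_forms n" if "b \<in> graded_perms" "fst b = fst j + fst i" for b
      using that z assms by (intro normal_formsI) simp_all
  qed simp
  then show "bv j \<rhd> (bv i \<rhd> (v \<lhd> bv k)) \<in> normal_forms n" by (simp add: mul_succ)
qed simp

lemma graded_normal_forms:
  assumes "\<And>b. b \<in> graded_perms \<Longrightarrow> fst b = n \<Longrightarrow> bv b \<in> normal_forms n" "x \<in> graded n"
  shows "x \<in> normal_forms n"
  by (rule lin_in_subspace_graded[OF _ lin_id assms(2)]) (use assms(1) in simp_all)

text \<open>Writing \<open>e\<close> and \<open>e'\<close> for the two projections,
  \<open>x = (x - e x) + (e x - e' (e x)) + e' (e x)\<close>. The two differences are sums of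
  products of a shorter projected element with a factor of \<open>S\<close>, to which induction
  applies, and the last term is primitive.\<close>

lemma basis_normal_forms: "b \<in> plus_basis \<Longrightarrow> bv b \<in> normal_forms (fst b)"
proof (induction "fst b" arbitrary: b rule: less_induct)
  case less
  note b = less.prems
  have IH: "x \<in> normal_forms m" if "x \<in> graded m" "1 \<le> m" "m < fst b" for x m
  proof (rule graded_normal_forms[OF _ that(1)])
    fix c :: biword assume "c \<in> graded_perms" "fst c = m"
    with less.hyps[of c] that show "bv c \<in> normal_forms m" by simp
  qed
  let ?x = "bv b" and ?y = "R.proj (bv b)"
  have "psw (cop min_left_ne ?x) (\<lambda>u v. R.proj u \<lhd> v) \<in> normal_forms (fst b)"
  proof (rule sw_in_subspace[OF _ pm_vector_space R.red_span[OF b]])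
    fix k l assume "(k, l) \<in> proper_pairs (fst b)"
    from proper_pairsD[OF this] have kl: "k \<in> plus_basis" "l \<in> graded_perms" "fst k < fst b" "1 \<le> fst k" "fst k + fst l \<le> fst b" by auto
    show "R.proj (bv k) \<lhd> bv l \<in> normal_forms (fst b)"
      by (rule normal_forms_prec[OF IH[OF R.proj_graded[OF kl(1)] kl(4,3)] kl(2,5)])
  qed simp
  then have 1: "?x - ?y \<in> normal_forms (fst b)" by (simp add: R.proj_rec[OF b])
  have "?y - L.proj ?y \<in> normal_forms (fst b)"
  proof (rule lin_in_subspace_graded[of _ "\<lambda>y. y - L.proj y", OF _ _ R.proj_graded[OF b]])
    fix c :: biword assume "c \<in> graded_perms" "fst c = fst b"
    with b have c: "c \<in> plus_basis" "fst c = fst b" by auto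
    have "psw (cop ne_both (bv c)) (\<lambda>u v. v \<rhd> L.proj u) \<in> normal_forms (fst b)"
    proof (rule sw_in_subspace[OF _ pm_vector_space L.red_span[OF c(1)]])
      fix k l assume "(k, l) \<in> proper_pairs (fst c)"
      from proper_pairsD[OF this] have kl: "k \<in> plus_basis" "l \<in> graded_perms" "fst k < fst b" "1 \<le> fst k" "fst k + fst l \<le> fst b"
        using c(2) by auto
      show "bv l \<rhd> L.proj (bv k) \<in> normal_forms (fst b)"
        by (rule normal_forms_succ[OF IH[OF L.proj_graded[OF kl(1)] kl(4,3)] kl(2,5)])
    qed simp
    then show "bv c - L.proj (bv c) \<in> normal_forms (fst b)" by (simp add: L.proj_rec[OF c(1)])
  qed (simp, (intro lin_intros; simp))
  moreover have "L.proj ?y \<in> normal_forms (fst b)"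
    using primitive_normal_forms[OF prim_proj_primitive[of ?x]] b by (simp add: prim_proj_def)
  ultimately have "?y \<in> normal_forms (fst b)" using pm.subspace_add[OF subspace_normal_forms] by fastforce
  from pm.subspace_add[OF subspace_normal_forms 1 this] show ?case by simp
qed

section \<open>The antipode\<close>

text \<open>The inverse of the antipode in the usual convention: \<open>\<Sum> x\<^sub>2 * S x\<^sub>1\<close>, and not \<open>\<Sum> S x\<^sub>1 * x\<^sub>2\<close>, is the
  counit.\<close>

definition antipode_basis :: "biword \<Rightarrow> gperm_vec" where
  "antipode_basis = wfrec (measure fst) (\<lambda>f b. if b \<in> plus_basis
     then - bv b - lext pm_scale (\<lambda>(i, j). mul (bv j) (f i)) (cop ne_both (bv b)) else bv b)"

definition antipode :: "gperm_vec \<Rightarrow> gperm_vec" where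
  "antipode = lext pm_scale antipode_basis"

lemma lin_antipode [lin_intros]: "lin pm_scale f \<Longrightarrow> lin pm_scale (\<lambda>x. antipode (f x))"
  unfolding antipode_def by (intro lin_intros) simp

lemma antipode_basis_eq: "antipode_basis b = (if b \<in> plus_basis
     then - bv b - lext pm_scale (\<lambda>(i, j). mul (bv j) (antipode_basis i)) (cop ne_both (bv b)) else bv b)"
proof -
  let ?T = "\<lambda>f b. if b \<in> plus_basis
     then - bv b - lext pm_scale (\<lambda>(i, j). mul (bv j) (f i)) (cop ne_both (bv b)) else bv b"
  have "adm_wf (measure fst) ?T"
    unfolding adm_wf_def
  proof (intro allI impI)
    fix f g :: "biword \<Rightarrow> gperm_vec" and b :: biword
    assume eq: "\<forall>z. (z, b) \<in> measure fst \<longrightarrow> f z = g z"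
    show "?T f b =
          ?T g b"
    proof (cases "b \<in> plus_basis")
      case True
      have "lext pm_scale (\<lambda>(i, j). mul (bv j) (f i)) (cop ne_both (bv b)) =
            lext pm_scale (\<lambda>(i, j). mul (bv j) (g i)) (cop ne_both (bv b))"
        by (rule lext_cong_on[OF L.red_span[OF True]]) (use eq in \<open>auto dest: proper_pairsD\<close>)
      then show ?thesis by simp
    qed auto
  qed
  from fun_cong[OF wfrec_fixpoint[OF wf_measure this], of b] show ?thesis
    unfolding antipode_basis_def .
qed

lemma antipode_rec:
  assumes "b \<in> plus_basis"
  shows "antipode (bv b) = - bv b - psw (cop ne_both (bv b)) (\<lambda>u v. mul v (antipode u))"
  using antipode_basis_eq[of b] assms by (simp add: antipode_def sw_def)

lemma antipode_one: "antipode one = one"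
  using antipode_basis_eq[of unit_word] by (simp add: antipode_def)

lemma antipode_graded: "b \<in> graded_perms \<Longrightarrow> antipode (bv b) \<in> graded (fst b)"
proof (induction "fst b" arbitrary: b rule: less_induct)
  case less
  show ?case
  proof (cases "b \<in> plus_basis")
    case False
    then show ?thesis
      using antipode_one basis_in_graded[OF unit_word_graded_perms] graded_perms_cases[OF less.prems] by metis
  next
    case True
    have "psw (cop ne_both (bv b)) (\<lambda>u v. mul v (antipode u)) \<in> graded (fst b)"
    proof (rule sw_in_subspace[OF _ pm_vector_space L.red_span[OF True]])
      fix i j assume "(i, j) \<in> proper_pairs (fst b)"
      from proper_pairsD[OF this] have ij: "i \<in> graded_perms" "j \<in> graded_perms" "fst i < fst b" "fst i + fst j = fst b" by auto
      show "mul (bv j) (antipode (bv i)) \<in> graded (fst b)"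
      proof (rule lin_in_subspace_graded[OF _ lin_prd2[OF lin_id] less.hyps[OF ij(3,1)]])
        fix c :: biword assume "c \<in> graded_perms" "fst c = fst i"
        with prd_graded[OF ij(2), of c "\<lambda>_ _ _. True"] ij show "mul (bv j) (bv c) \<in> graded (fst b)"
          by (simp add: add.commute)
      qed simp
    qed simp
    then show ?thesis
      unfolding antipode_rec[OF True]
      by (intro pm.subspace_diff pm.subspace_neg subspace_graded basis_in_graded less.prems)
  qed
qed

lemma antipode_inverse:
  assumes "b \<in> graded_perms"
  shows "psw (full_cop (bv b)) (\<lambda>u v. mul v (antipode u)) = (if b = unit_word then one else 0)"
  using graded_perms_cases[OF assms]
proof cases
  case 1
  then show ?thesis by (simp add: full_cop_one antipode_one)
next
  case 2
  then have ne: "b \<noteq> unit_word" by auto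
  have "mul one (antipode (bv b)) = antipode (bv b)"
  proof -
    have "mul one x = x" if "x \<in> graded n" for x n
      by (rule lin_eq_on_span[OF lin_prd2[OF lin_id] lin_id that[unfolded graded_def]]) auto
    then show ?thesis using antipode_graded[OF assms] by blast
  qed
  then show ?thesis using ne assms
    by (simp add: full_cop_eq[OF assms] ne_left_cop[OF 2] sw_add antipode_one antipode_rec[OF 2])
qed

section \<open>The universal property\<close>

lemma lin_lookup: assumes "vector_space t" shows "lin t (\<lambda>x. t (Poly_Mapping.lookup x i) z)"
proof -
  interpret vector_space t by fact
  show ?thesis by (rule linI) (simp_all add: lookup_add scale_left_distrib)
qed

lemma lookup_basis_vec: "Poly_Mapping.lookup (bv i) j = (if i = j then 1 else 0)"
  by (simp add: basis_vec_def lookup_single when_def)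

lemma lookup_graded_unit: "x \<in> graded n \<Longrightarrow> 1 \<le> n \<Longrightarrow> Poly_Mapping.lookup x unit_word = 0"
  unfolding graded_def by (rule span_basis_lookup) auto

lemma cop_ne_span:
  assumes "b \<in> graded_perms" "\<And>u v. Q u v \<Longrightarrow> u \<noteq> []"
  shows "cop Q (bv b) \<in> pm.span (bv ` {(i, j). i \<in> plus_basis \<and> j \<in> graded_perms \<and> fst i + fst j = fst b})"
  unfolding cop_eq_word[OF assms(1)]
proof (intro pm.span_sum, clarify)
  fix u v assume uv: "(u, v) \<in> splits (enc b)" "Q u v"
  show "bv (nrm u, nrm v) \<in> pm.span (bv ` {(i, j). i \<in> plus_basis \<and> j \<in> graded_perms \<and> fst i + fst j = fst b})"
    using splits_valid[OF valid_enc[OF assms(1)] uv(1)] assms(2)[OF uv(2)] nrm_in_plus_basis nrm_graded_perms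
    by (intro pm.span_base imageI) simp
qed

lemma mul_graded:
  assumes "j \<in> graded_perms" "x \<in> graded m" shows "mul (bv j) x \<in> graded (fst j + m)"
  by (rule lin_in_subspace_graded[OF _ lin_prd2[OF lin_id] assms(2)]) (use prd_graded[OF assms(1)] in auto)

lemma lext_cong_graded:
  "x \<in> graded n \<Longrightarrow> (\<And>i. fst i = n \<Longrightarrow> f i = f' i) \<Longrightarrow> lext t f x = lext t f' x"
  unfolding graded_def by (erule lext_cong_on) simp

lemma sw_zero: assumes "vector_space t" shows "sw t z (\<lambda>_ _. 0) = 0"
proof -
  interpret vector_space t by fact
  show ?thesis by (simp add: sw_def lext_def case_prod_beta)
qed

text \<open>If \<open>C\<close> vanishes on right factors of positive length, only the cut with
  empty right factor survives. This is the counit law in the form in which the antipode identity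
  feeds it.\<close>

lemma full_cop_counit:
  assumes "vector_space t" "j \<in> graded_perms" "\<And>u k. k \<in> plus_basis \<Longrightarrow> C u (bv k) = 0"
  shows "sw t (full_cop (bv j)) C = C (bv j) one"
  using graded_perms_cases[OF assms(2)]
proof cases
  case 1
  then show ?thesis by (simp add: full_cop_one assms(1))
next
  case 2
  have "cop ne_both (bv j) \<in> pm.span (bv ` proper_pairs (fst j))"
    by (rule cop_proper_span[OF assms(2)]) (simp_all add: ne_both_def)
  then have "sw t (cop ne_both (bv j)) C = sw t (cop ne_both (bv j)) (\<lambda>_ _. 0)"
    by (rule sw_cong) (use assms(3) in \<open>simp add: proper_pairs_def\<close>)
  then show ?thesis
    using assms(3)[OF 2] by (simp add: full_cop_eq[OF assms(2)] ne_left_cop[OF 2] sw_add assms(1) sw_zero)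
qed

lemma ne_left_span: "cop ne_left z \<in> pm.span (bv ` (plus_basis \<times> UNIV))"
proof (rule lin_range_in_subspace[OF _ lin_cop[OF lin_id]])
  fix b
  show "cop ne_left (bv b) \<in> pm.span (bv ` (plus_basis \<times> UNIV))"
  proof (cases "b \<in> graded_perms")
    case True
    have "pm.span (bv ` {(i, j). i \<in> plus_basis \<and> j \<in> graded_perms \<and> fst i + fst j = fst b}) \<subseteq>
        pm.span (bv ` (plus_basis \<times> UNIV))" by (rule pm.span_mono) auto
    with cop_ne_span[OF True, of ne_left] show ?thesis by (auto simp: ne_left_def)
  qed (simp add: pm.span_zero)
qed simp

lemma cop_ne_plus_span:
  assumes "x \<in> gperm_plus" "\<And>u v. Q u v \<Longrightarrow> u \<noteq> []"
  shows "cop Q x \<in> pm.span (bv ` (plus_basis \<times> graded_perms))"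
proof (rule lin_in_subspace[OF _ pm_vector_space lin_cop[OF lin_id] assms(1)[unfolded gperm_plus_eq]])
  fix v assume "v \<in> (bv ` plus_basis :: gperm_vec set)"
  then obtain b where b: "b \<in> graded_perms" "v = bv b" by auto
  have "pm.span (bv ` {(i, j). i \<in> plus_basis \<and> j \<in> graded_perms \<and> fst i + fst j = fst b}) \<subseteq>
        pm.span (bv ` (plus_basis \<times> graded_perms))" by (rule pm.span_mono) auto
  with cop_ne_span[OF b(1), of Q] assms(2) show "cop Q v \<in> pm.span (bv ` (plus_basis \<times> graded_perms))"
    unfolding b(2) by blast
qed simp

lemma prec_one_plus: assumes "x \<in> gperm_plus" shows "x \<lhd> one = x"
  by (rule lin_eq_on_plus[of pm_scale "\<lambda>x. x \<lhd> one" "\<lambda>x. x", OF _ _ assms], (intro lin_intros)+) (rule prec_one)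

lemma one_succ_plus: assumes "x \<in> gperm_plus" shows "one \<rhd> x = x"
  by (rule lin_eq_on_plus[of pm_scale "\<lambda>x. one \<rhd> x" "\<lambda>x. x", OF _ _ assms], (intro lin_intros)+) (rule one_succ)

text \<open>An algebra on the whole type; one carried by a subspace is brought into this form by a
  projection. The map \<open>g\<close> will be \<open>f\<close> composed with
  \<open>prim_proj\<close>, which extends \<open>f\<close> and vanishes on products.\<close>

locale dendriform_target = dendriform_algebra scale UNIV lprod rprod
  for scale :: "rat \<Rightarrow> 'b::ab_group_add \<Rightarrow> 'b"
    and lprod :: "'b \<Rightarrow> 'b \<Rightarrow> 'b"  (infixl \<open>\<prec>\<close> 70)
    and rprod :: "'b \<Rightarrow> 'b \<Rightarrow> 'b"  (infixl \<open>\<succ>\<close> 70) +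
  fixes g :: "gperm_vec \<Rightarrow> 'b"
  assumes g_linear: "lin scale g"
    and g_prec: "x \<in> gperm_plus \<Longrightarrow> y \<in> gperm_plus \<Longrightarrow> g (x \<lhd> y) = 0"
    and g_succ: "x \<in> gperm_plus \<Longrightarrow> y \<in> gperm_plus \<Longrightarrow> g (x \<rhd> y) = 0"
begin

lemma vs [simp]: "vector_space scale"
  by (rule vector_space_axioms)

lemma prod_linear:
  "(x + y) \<prec> z = x \<prec> z + y \<prec> z" "z \<prec> (x + y) = z \<prec> x + z \<prec> y"
  "(x + y) \<succ> z = x \<succ> z + y \<succ> z" "z \<succ> (x + y) = z \<succ> x + z \<succ> y"
  "scale c x \<prec> z = scale c (x \<prec> z)" "z \<prec> scale c x = scale c (z \<prec> x)"
  "scale c x \<succ> z = scale c (x \<succ> z)" "z \<succ> scale c x = scale c (z \<succ> x)"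
  using lprod_bilinear rprod_bilinear by (simp_all add: bilinear_on_def linear_on_def)

lemma prod_0 [simp]: "0 \<prec> z = 0" "z \<prec> 0 = 0" "0 \<succ> z = 0" "z \<succ> 0 = 0"
  using prod_linear(5)[of 0 0 z] prod_linear(6)[of z 0 0] prod_linear(7)[of 0 0 z] prod_linear(8)[of z 0 0]
  by simp_all

lemma lin_lprod1 [lin_intros]: "lin scale f \<Longrightarrow> lin scale (\<lambda>x. f x \<prec> y)"
  by (rule linI) (simp_all add: lin_plus lin_smult prod_linear)
lemma lin_lprod2 [lin_intros]: "lin scale f \<Longrightarrow> lin scale (\<lambda>x. y \<prec> f x)"
  by (rule linI) (simp_all add: lin_plus lin_smult prod_linear)
lemma lin_rprod1 [lin_intros]: "lin scale f \<Longrightarrow> lin scale (\<lambda>x. f x \<succ> y)"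
  by (rule linI) (simp_all add: lin_plus lin_smult prod_linear)
lemma lin_rprod2 [lin_intros]: "lin scale f \<Longrightarrow> lin scale (\<lambda>x. y \<succ> f x)"
  by (rule linI) (simp_all add: lin_plus lin_smult prod_linear)

lemma lin_g [lin_intros]: "lin pm_scale f \<Longrightarrow> lin scale (\<lambda>x. g (f x))"
  by (rule lin_compose[OF g_linear])

text \<open>\<open>lact f u z\<close> and \<open>ract f z u\<close> are \<open>f u \<succ> z\<close> and \<open>z \<prec> f u\<close>, where the unit of \<open>S\<close> acts as identity
  although the target algebra need not have a unit.\<close>

definition lact :: "(gperm_vec \<Rightarrow> 'b) \<Rightarrow> gperm_vec \<Rightarrow> 'b \<Rightarrow> 'b" where
  "lact f u z = scale (Poly_Mapping.lookup u unit_word) z + f u \<succ> z"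

definition ract :: "(gperm_vec \<Rightarrow> 'b) \<Rightarrow> 'b \<Rightarrow> gperm_vec \<Rightarrow> 'b" where
  "ract f z u = scale (Poly_Mapping.lookup u unit_word) z + z \<prec> f u"

text \<open>The homomorphism is defined by recursion on the length. On \<open>x = l \<succ> (v \<prec> r)\<close> with \<open>v\<close> primitive,
  cutting \<open>x\<close> into \<open>x\<^sub>1, x\<^sub>2, x\<^sub>3, x\<^sub>4\<close> and applying \<open>g\<close> to \<open>x\<^sub>1\<close> gives \<open>g v\<close>, \<open>r\<^sub>1\<close>, \<open>r\<^sub>2\<close> and \<open>l * r\<^sub>3\<close>;
  the antipode then recovers \<open>l\<close> and \<open>r\<close>.\<close>

definition cut3 :: "(gperm_vec \<Rightarrow> 'b) \<Rightarrow> gperm_vec \<Rightarrow> gperm_vec \<Rightarrow> gperm_vec \<Rightarrow> 'b" where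
  "cut3 f x4 x1 x' = sw scale (full_cop x') (\<lambda>x2 x3. lact f (mul x4 (antipode x3)) (ract f (g x1) x2))"

definition cut2 :: "(gperm_vec \<Rightarrow> 'b) \<Rightarrow> gperm_vec \<Rightarrow> gperm_vec \<Rightarrow> 'b" where
  "cut2 f x0 x4 = sw scale (cop min_left x0) (cut3 f x4)"

definition hom_basis :: "biword \<Rightarrow> 'b" where
  "hom_basis = wfrec (measure fst) (\<lambda>f b. sw scale (cop ne_left (bv b)) (cut2 (lext scale f)))"

definition hom :: "gperm_vec \<Rightarrow> 'b" where
  "hom = lext scale hom_basis"

lemma lin_hom: "lin scale hom"
  unfolding hom_def by (rule lin_lext) simp

lemma lin_hom' [lin_intros]: "lin pm_scale f \<Longrightarrow> lin scale (\<lambda>x. hom (f x))"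
  by (rule lin_compose[OF lin_hom])

text \<open>Justifies the recursion. The piece \<open>x1\<close> is nonempty, so \<open>x4\<close>
  and \<open>x'\<close> together are shorter than the whole word; since \<open>mul\<close> and
  \<open>antipode\<close> preserve the length, \<open>f\<close> is called on shorter arguments
  only.\<close>

lemma cut3_cong:
  assumes eq: "\<And>z. fst z < n \<Longrightarrow> f z = f' z" and i: "i \<in> graded_perms" "k \<in> graded_perms" "fst i + fst k < n"
  shows "cut3 (lext scale f) (bv i) x1 (bv k) = cut3 (lext scale f') (bv i) x1 (bv k)"
  unfolding cut3_def
proof (rule sw_cong[OF cop_span[OF i(2)]])
  fix i2 i3 assume "(i2, i3) \<in> {(i, j). i \<in> graded_perms \<and> j \<in> graded_perms \<and> fst i + fst j = fst k}"
  then have i2: "i2 \<in> graded_perms" "i3 \<in> graded_perms" "fst i2 + fst i3 = fst k" by auto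
  have "lext scale f (mul (bv i) (antipode (bv i3))) = lext scale f' (mul (bv i) (antipode (bv i3)))"
    by (rule lext_cong_graded[OF mul_graded[OF i(1) antipode_graded[OF i2(2)]]]) (use i i2 eq in auto)
  moreover have "f i2 = f' i2" by (rule eq) (use i i2 in auto)
  ultimately show "lact (lext scale f) (mul (bv i) (antipode (bv i3))) (ract (lext scale f) (g x1) (bv i2)) =
      lact (lext scale f') (mul (bv i) (antipode (bv i3))) (ract (lext scale f') (g x1) (bv i2))"
    by (simp add: lact_def ract_def)
qed

lemma hom_basis_eq: "hom_basis b = sw scale (cop ne_left (bv b)) (cut2 hom)"
proof -
  let ?T = "\<lambda>f b. sw scale (cop ne_left (bv b)) (cut2 (lext scale f))"
  have "adm_wf (measure fst) ?T" unfolding adm_wf_def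
  proof (intro allI impI)
    fix f f' :: "biword \<Rightarrow> 'b" and b :: biword
    assume "\<forall>z. (z, b) \<in> measure fst \<longrightarrow> f z = f' z"
    then have eq: "f z = f' z" if "fst z < fst b" for z using that by (simp only: in_measure)
    show "?T f b = ?T f' b"
    proof (cases "b \<in> graded_perms")
      case True
      show ?thesis
      proof (rule sw_cong[OF cop_ne_span[OF True]])
        fix i0 i4 assume "(i0, i4) \<in> {(i, j). i \<in> plus_basis \<and> j \<in> graded_perms \<and> fst i + fst j = fst b}"
        then have i0: "i0 \<in> graded_perms" "i4 \<in> graded_perms" "fst i0 + fst i4 = fst b" by auto
        show "cut2 (lext scale f) (bv i0) (bv i4) = cut2 (lext scale f') (bv i0) (bv i4)"
          unfolding cut2_def
        proof (rule sw_cong[OF cop_ne_span[OF i0(1)]])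
          fix i1 i' assume "(i1, i') \<in> {(i, j). i \<in> plus_basis \<and> j \<in> graded_perms \<and> fst i + fst j = fst i0}"
          then have k: "i' \<in> graded_perms" "fst i4 + fst i' < fst b" using i0 by auto
          show "cut3 (lext scale f) (bv i4) (bv i1) (bv i') = cut3 (lext scale f') (bv i4) (bv i1) (bv i')"
            by (rule cut3_cong[where n = "fst b", OF _ i0(2) k]) (rule eq)
        qed (simp add: min_left_def)
      qed (simp add: ne_left_def)
    qed simp
  qed
  from fun_cong[OF wfrec_fixpoint[OF wf_measure this], of b] show ?thesis
    unfolding hom_basis_def hom_def .
qed

lemma lin_lact1 [lin_intros]: "lin pm_scale f \<Longrightarrow> lin scale (\<lambda>x. lact hom (f x) z)"
  unfolding lact_def
  by (intro lin_add vs lin_intros lin_compose[of scale "\<lambda>x. scale (Poly_Mapping.lookup x unit_word) z" f] lin_lookup)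

lemma lin_lact2 [lin_intros]: "lin scale h \<Longrightarrow> lin scale (\<lambda>x. lact hom u (h x))"
  unfolding lact_def by (intro lin_intros vs)

lemma lin_ract1 [lin_intros]: "lin scale h \<Longrightarrow> lin scale (\<lambda>x. ract hom (h x) u)"
  unfolding ract_def by (intro lin_intros vs)

lemma lin_ract2 [lin_intros]: "lin pm_scale f \<Longrightarrow> lin scale (\<lambda>x. ract hom z (f x))"
  unfolding ract_def
  by (intro lin_add vs lin_intros lin_compose[of scale "\<lambda>x. scale (Poly_Mapping.lookup x unit_word) z" f] lin_lookup)

lemma hom_eq: "hom x = sw scale (cop ne_left x) (cut2 hom)"
  by (rule lin_eqI[OF lin_hom lin_sw1[OF vs lin_cop[OF lin_id]]]) (subst hom_basis_eq[symmetric], simp add: hom_def)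

lemma lin_cut3 [lin_intros]:
  "lin pm_scale f \<Longrightarrow> lin scale (\<lambda>z. cut3 hom (f z) x y)"
  "lin pm_scale f \<Longrightarrow> lin scale (\<lambda>z. cut3 hom x (f z) y)"
  "lin pm_scale f \<Longrightarrow> lin scale (\<lambda>z. cut3 hom x y (f z))"
  unfolding cut3_def by (intro lin_intros vs; assumption)+

lemma lin_cut2 [lin_intros]:
  "lin pm_scale f \<Longrightarrow> lin scale (\<lambda>z. cut2 hom (f z) x)"
  "lin pm_scale f \<Longrightarrow> lin scale (\<lambda>z. cut2 hom x (f z))"
  unfolding cut2_def by (intro lin_intros vs; assumption)+

section \<open>Evaluation of the homomorphism on normal forms\<close>

lemma cut3_zero: "g x1 = 0 \<Longrightarrow> cut3 hom x4 x1 x' = 0"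
  by (simp add: cut3_def ract_def lact_def sw_zero)

text \<open>By \<open>min_cop_succ\<close> the first piece of every cut is a product with \<succ> of
  two elements of \<open>A\<close>, where \<open>g\<close> vanishes.\<close>

lemma cut2_succ:
  assumes i: "i \<in> plus_basis" shows "cut2 hom (bv i \<rhd> z) x4 = 0"
proof -
  have "cop min_left (bv i \<rhd> z) = psw (cop min_left (bv i)) (\<lambda>x1 x2. psw (cop ne_left z)
      (\<lambda>y1 y2. tens (x1 \<rhd> y1) (mul x2 y2)))"
    unfolding succ_startr'[OF i, symmetric] by (rule min_cop_succ)
  then have "cut2 hom (bv i \<rhd> z) x4 = sw scale (cop min_left (bv i)) (\<lambda>x1 x2. sw scale (cop ne_left z)
      (\<lambda>y1 y2. cut3 hom x4 (x1 \<rhd> y1) (mul x2 y2)))"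
    using sw_tens[OF vs, of "cut3 hom x4"]
    by (simp add: cut2_def sw_sw[OF vs] bilin_def lin_cut3[OF lin_id])
  also have "\<dots> = sw scale (cop min_left (bv i)) (\<lambda>x1 x2. sw scale (cop ne_left z) (\<lambda>y1 y2. 0))"
  proof (rule sw_cong[OF cop_ne_plus_span[OF in_gperm_plus[OF i]]])
    fix k l assume k: "(k, l) \<in> plus_basis \<times> graded_perms"
    have z: "cop ne_left z \<in> pm.span (bv ` (plus_basis \<times> UNIV))" by (rule ne_left_span)
    show "sw scale (cop ne_left z) (\<lambda>y1 y2. cut3 hom x4 (bv k \<rhd> y1) (mul (bv l) y2)) = sw scale (cop ne_left z) (\<lambda>y1 y2. 0)"
      by (rule sw_cong[OF z]) (use k in_gperm_plus g_succ in \<open>blast intro: cut3_zero\<close>)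
  qed (simp add: min_left_def)
  finally show ?thesis by (simp add: sw_zero)
qed

lemma cop_prec_primitive:
  assumes "v \<in> primitive"
  shows "cop min_left (v \<lhd> y) = psw (full_cop y) (\<lambda>y1 y2. tens (v \<lhd> y1) (mul one y2))"
    "cop ne_left (v \<lhd> y) = psw (full_cop y) (\<lambda>y1 y2. tens (v \<lhd> y1) (mul one y2))"
proof -
  have b: "bilin pm_scale (\<lambda>x1 x2. psw (full_cop y) (\<lambda>y1 y2. tens (x1 \<lhd> y1) (mul x2 y2)))"
    by (intro bilinI lin_intros; simp)
  show "cop min_left (v \<lhd> y) = psw (full_cop y) (\<lambda>y1 y2. tens (v \<lhd> y1) (mul one y2))"
    "cop ne_left (v \<lhd> y) = psw (full_cop y) (\<lambda>y1 y2. tens (v \<lhd> y1) (mul one y2))"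
    using assms sw_tens[OF pm_vector_space b, of v one] by (simp_all add: primitive_def cop_prec min_cop_prec)
qed

text \<open>A primitive \<open>v\<close> is not cut, so the first piece is
  \<open>v \<prec> y1\<close>. It is killed by \<open>g\<close> unless \<open>y1\<close> is the
  unit, which leaves all of \<open>bv j\<close> to the second piece.\<close>

lemma cut2_prec_primitive:
  assumes v: "v \<in> primitive" and j: "j \<in> graded_perms"
  shows "cut2 hom (v \<lhd> bv j) x4 = cut3 hom x4 v (bv j)"
proof -
  have vp: "v \<in> gperm_plus" using v by (simp add: primitive_def)
  have "cut2 hom (v \<lhd> bv j) x4 = sw scale (full_cop (bv j)) (\<lambda>y1 y2. cut3 hom x4 (v \<lhd> y1) (mul one y2))"
    using sw_tens[OF vs, of "cut3 hom x4"]
    by (simp add: cut2_def cop_prec_primitive[OF v] sw_sw[OF vs] bilin_def lin_cut3[OF lin_id])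
  also have "\<dots> = cut3 hom x4 (v \<lhd> one) (mul one (bv j)) +
      sw scale (cop ne_left (bv j)) (\<lambda>y1 y2. cut3 hom x4 (v \<lhd> y1) (mul one y2))"
    by (simp add: full_cop_eq[OF j] sw_add)
  also have "sw scale (cop ne_left (bv j)) (\<lambda>y1 y2. cut3 hom x4 (v \<lhd> y1) (mul one y2)) =
      sw scale (cop ne_left (bv j)) (\<lambda>y1 y2. 0)"
    by (rule sw_cong[OF ne_left_span]) (use vp in_gperm_plus g_prec in \<open>blast intro: cut3_zero\<close>)
  finally show ?thesis by (simp add: sw_zero prec_one_plus[OF vp] j)
qed

text \<open>The only surviving cuts leave \<open>v\<close> as the first piece. With \<open>r\<close>
  cut into \<open>r1\<close>, \<open>r2\<close>, \<open>r3\<close>, what remains is the sum of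
  \<open>lact hom (l * r3 * antipode r2) (ract hom (g v) r1)\<close>, and the antipode identity
  collapses \<open>r3 * antipode r2\<close> to the counit, so that \<open>r1\<close> becomes
  \<open>r\<close>.\<close>

lemma hom_normal_form:
  assumes i: "i \<in> graded_perms" and j: "j \<in> graded_perms" and v: "v \<in> primitive"
  shows "hom (bv i \<rhd> (v \<lhd> bv j)) = lact hom (bv i) (ract hom (g v) (bv j))"
proof -
  let ?l = "bv i" and ?r = "bv j"
  let ?z = "v \<lhd> ?r"
  let ?S = "\<lambda>z. sw scale z"
  have vp: "v \<in> gperm_plus" using v by (simp add: primitive_def)
  have b2: "bilin scale (cut2 hom)" by (simp add: bilin_def lin_cut2[OF lin_id])
  have co: "cop ne_left ?z \<in> pm.span (bv ` (plus_basis \<times> UNIV))" by (rule ne_left_span)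
  have full: "full_cop ?r \<in> pm.span (bv ` (graded_perms \<times> graded_perms))"
    using cop_span[OF j, of "\<lambda>_ _. True"] by (rule subsetD[OF pm.span_mono, rotated]) auto
  have "hom (?l \<rhd> ?z) = ?S (full_cop ?l) (\<lambda>x1 x2. ?S (cop ne_left ?z) (\<lambda>y1 y2. cut2 hom (x1 \<rhd> y1) (mul x2 y2)))"
    by (subst hom_eq) (simp only: cop_succ sw_sw[OF vs] sw_tens[OF vs b2])
  also have "\<dots> = ?S (cop ne_left ?z) (\<lambda>y1 y2. cut2 hom (one \<rhd> y1) (mul ?l y2)) +
      ?S (cop ne_left ?l) (\<lambda>x1 x2. ?S (cop ne_left ?z) (\<lambda>y1 y2. cut2 hom (x1 \<rhd> y1) (mul x2 y2)))"
    by (simp add: full_cop_eq[OF i] sw_add)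
  \<comment> \<open>Here \<open>x1\<close> has positive length and \<open>cut2_succ\<close> applies:
    the whole of \<open>l\<close> must go to the last piece.\<close>
  also have "?S (cop ne_left ?l) (\<lambda>x1 x2. ?S (cop ne_left ?z) (\<lambda>y1 y2. cut2 hom (x1 \<rhd> y1) (mul x2 y2))) =
      ?S (cop ne_left ?l) (\<lambda>x1 x2. 0)"
    by (rule sw_cong[OF ne_left_span]) (simp add: cut2_succ sw_zero)
  also have "\<dots> = 0" by (simp add: sw_zero)
  also have "?S (cop ne_left ?z) (\<lambda>y1 y2. cut2 hom (one \<rhd> y1) (mul ?l y2)) = ?S (cop ne_left ?z) (\<lambda>y1 y2. cut2 hom y1 (mul ?l y2))"
    by (rule sw_cong[OF co]) simp
  also have "\<dots> = ?S (full_cop ?r) (\<lambda>y1 y2. cut2 hom (v \<lhd> y1) (mul ?l (mul one y2)))"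
  proof -
    have "bilin scale (\<lambda>y1 y2. cut2 hom y1 (mul ?l y2))" by (intro bilinI lin_intros)
    from sw_tens[OF vs this] show ?thesis
      unfolding cop_prec_primitive(2)[OF v] sw_sw[OF vs] by simp
  qed
  also have "\<dots> = ?S (full_cop ?r) (\<lambda>y1 y2. cut3 hom (mul ?l y2) v y1)"
    by (rule sw_cong[OF full]) (simp add: cut2_prec_primitive[OF v])
  also have "\<dots> = ?S (full_cop ?r) (\<lambda>y1 y2. ?S (full_cop y1) (\<lambda>x2 x3. lact hom (mul ?l (mul y2 (antipode x3))) (ract hom (g v) x2)))"
    by (simp add: cut3_def mul_assoc)
  \<comment> \<open>Coassociativity joins the last two pieces of \<open>r\<close>, in the order in
    which \<open>antipode_inverse\<close> needs them: the later piece times the antipode of the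
    earlier one.\<close>
  also have "\<dots> = ?S (full_cop ?r) (\<lambda>x2 z. ?S (full_cop z) (\<lambda>x3 y2. lact hom (mul ?l (mul y2 (antipode x3))) (ract hom (g v) x2)))"
    by (rule full_coassoc) simp
  also have "\<dots> = ?S (full_cop ?r) (\<lambda>x2 z. lact hom (mul ?l (psw (full_cop z) (\<lambda>x3 y2. mul y2 (antipode x3)))) (ract hom (g v) x2))"
  proof -
    have *: "lin scale (\<lambda>x. lact hom (mul ?l x) y)" for y by (intro lin_intros)
    show ?thesis by (simp only: lin_sw[OF pm_vector_space vs *])
  qed
  also have "\<dots> = lact hom (mul ?l (psw (full_cop one) (\<lambda>x3 y2. mul y2 (antipode x3)))) (ract hom (g v) ?r)"
  proof (rule full_cop_counit[OF vs j])
    fix u :: "gperm_vec" and k :: biword assume k: "k \<in> plus_basis"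
    then have "k \<noteq> unit_word" by auto
    then have "psw (full_cop (bv k)) (\<lambda>x3 y2. mul y2 (antipode x3)) = 0"
      using antipode_inverse[of k] k by simp
    moreover have "lact hom 0 y = 0" for y
      by (rule lin_0[of scale "\<lambda>x. lact hom x y"]) (intro lin_intros)
    ultimately show "lact hom (mul ?l (psw (full_cop (bv k)) (\<lambda>x3 y2. mul y2 (antipode x3)))) (ract hom (g v) u) = 0"
      by simp
  qed
  also have "\<dots> = lact hom ?l (ract hom (g v) ?r)"
    using antipode_inverse[of unit_word] i by simp
  finally show ?thesis by simp
qed

lemma hom_one: "hom one = 0"
  by (simp add: hom_eq ne_left_outside)

lemma act_one: "lact hom one z = z" "ract hom z one = z"
  by (simp_all add: lact_def ract_def hom_one lookup_basis_vec)

lemma act_plus: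
  "b \<in> plus_basis \<Longrightarrow> lact hom (bv b) z = hom (bv b) \<succ> z"
  "b \<in> plus_basis \<Longrightarrow> ract hom z (bv b) = z \<prec> hom (bv b)"
  by (auto simp: lact_def ract_def lookup_basis_vec)

lemma hom_primitive: assumes "v \<in> primitive" shows "hom v = g v"
proof -
  have "v \<in> gperm_plus" using assms by (simp add: primitive_def)
  then have "one \<rhd> (v \<lhd> one) = v" by (simp add: prec_one_plus one_succ_plus)
  with hom_normal_form[OF _ _ assms, of unit_word unit_word] show ?thesis by (simp add: act_one)
qed

section \<open>Multiplicativity of the homomorphism\<close>

lemma hom_normal_form':
  assumes "h \<in> graded m" "k \<in> graded n" "v \<in> primitive"
  shows "hom (h \<rhd> (v \<lhd> k)) = lact hom h (ract hom (g v) k)"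
proof -
  have "hom (bv i \<rhd> (v \<lhd> k)) = lact hom (bv i) (ract hom (g v) k)" if "i \<in> graded_perms" for i
    by (rule lin_eq_on_span[of scale "\<lambda>k. hom (bv i \<rhd> (v \<lhd> k))" "\<lambda>k. lact hom (bv i) (ract hom (g v) k)",
          OF _ _ assms(2)[unfolded graded_def]])
       ((intro lin_intros)+, use hom_normal_form[OF that _ assms(3)] in blast)
  then show ?thesis
    by (intro lin_eq_on_span[of scale "\<lambda>h. hom (h \<rhd> (v \<lhd> k))" "\<lambda>h. lact hom h (ract hom (g v) k)",
          OF _ _ assms(1)[unfolded graded_def]] lin_intros) blast
qed

lemma lact_prec: "lact hom u w \<prec> c = lact hom u (w \<prec> c)"
  by (simp add: lact_def prod_linear dend_middle)

text \<open>If \<open>hom\<close> is multiplicative below total length \<open>n\<close>, the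
  dendriform axioms of the target make \<open>lact\<close> and \<open>ract\<close> actions of
  \<open>S\<close> in that range. The assumption is the induction hypothesis of
  \<open>hom_basis_prod\<close>.\<close>

lemma act_mul:
  assumes "\<And>x y. x \<in> plus_basis \<Longrightarrow> y \<in> plus_basis \<Longrightarrow> fst x + fst y < n \<Longrightarrow>
      hom (bv x \<lhd> bv y) = hom (bv x) \<prec> hom (bv y) \<and>
      hom (bv x \<rhd> bv y) = hom (bv x) \<succ> hom (bv y)"
    and i: "i \<in> graded_perms" and j: "j \<in> graded_perms" and n: "fst i + fst j < n"
  shows "lact hom (mul (bv i) (bv j)) z = lact hom (bv i) (lact hom (bv j) z)"
    "ract hom z (mul (bv i) (bv j)) = ract hom (ract hom z (bv i)) (bv j)"
proof -
  have "lact hom (mul (bv i) (bv j)) z = lact hom (bv i) (lact hom (bv j) z) \<and>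
    ract hom z (mul (bv i) (bv j)) = ract hom (ract hom z (bv i)) (bv j)"
    using graded_perms_cases[OF i]
  proof cases
    case 1 then show ?thesis using j by (simp add: act_one)
  next
    case i: 2
    show ?thesis using graded_perms_cases[OF j]
    proof cases
      case 1 then show ?thesis using \<open>i \<in> graded_perms\<close> by (simp add: act_one)
    next
      case j': 2
      have "mul (bv i) (bv j) \<in> graded (fst i + fst j)"
        by (rule prd_graded) (use i j in auto)
      then have "Poly_Mapping.lookup (mul (bv i) (bv j)) unit_word = 0"
        by (rule lookup_graded_unit) (use i in auto)
      moreover have "hom (mul (bv i) (bv j)) =
          hom (bv i) \<prec> hom (bv j) + hom (bv i) \<succ> hom (bv j)"
        unfolding mul_eq_prec_succ[OF i] lin_plus[OF lin_hom] using assms(1)[OF i j' n] by simp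
      ultimately have "lact hom (mul (bv i) (bv j)) z = hom (bv i) \<succ> (hom (bv j) \<succ> z)"
        "ract hom z (mul (bv i) (bv j)) = (z \<prec> hom (bv i)) \<prec> hom (bv j)"
        by (simp_all add: lact_def ract_def dend_right dend_left)
      then show ?thesis by (simp only: act_plus[OF i] act_plus[OF j'])
    qed
  qed
  then show "lact hom (mul (bv i) (bv j)) z = lact hom (bv i) (lact hom (bv j) z)"
    "ract hom z (mul (bv i) (bv j)) = ract hom (ract hom z (bv i)) (bv j)" by blast+
qed

text \<open>For \<prec> the left factor is written in normal forms and the right factor
  \<open>y\<close> is absorbed into \<open>r\<close>; as \<open>r\<close> is shorter than the left
  factor, \<open>act_mul\<close> applies to \<open>r\<close> and \<open>y\<close>. For \<succ> the
  right factor is expanded and the left one is absorbed into \<open>l\<close>.\<close>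

lemma hom_basis_prod:
  "x \<in> plus_basis \<Longrightarrow> y \<in> plus_basis \<Longrightarrow>
    hom (bv x \<lhd> bv y) = hom (bv x) \<prec> hom (bv y) \<and>
    hom (bv x \<rhd> bv y) = hom (bv x) \<succ> hom (bv y)"
proof (induction "fst x + fst y" arbitrary: x y rule: less_induct)
  case less
  note x = less.prems(1) and y = less.prems(2)
  have lm: "lact hom (mul (bv i) (bv j)) z = lact hom (bv i) (lact hom (bv j) z)"
    "ract hom z (mul (bv i) (bv j)) = ract hom (ract hom z (bv i)) (bv j)"
    if "i \<in> graded_perms" "j \<in> graded_perms" "fst i + fst j < fst x + fst y" for i j z
    by (rule act_mul[where n = "fst x + fst y"], erule (2) less.hyps[rotated], (rule that)+)+
  have "hom (bv x \<lhd> bv y) = hom (bv x) \<prec> hom (bv y)"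
  proof (rule lin_eq_on_normal_forms[of scale "\<lambda>x. hom (x \<lhd> bv y)" "\<lambda>x. hom x \<prec> hom (bv y)",
        OF _ _ basis_normal_forms[OF x]])
    fix i k v
    assume w: "v \<in> primitive" "i \<in> graded_perms" "k \<in> graded_perms" "fst i < fst x" "fst k < fst x"
    let ?w = "bv i \<rhd> (v \<lhd> bv k)"
    have yg: "y \<in> graded_perms" using y by simp
    have "hom (?w \<lhd> bv y) = hom (bv i \<rhd> (v \<lhd> mul (bv k) (bv y)))"
      by (simp only: succ_prec prec_prec)
    also have "\<dots> = lact hom (bv i) (ract hom (g v) (mul (bv k) (bv y)))"
      by (rule hom_normal_form'[OF basis_in_graded[OF w(2)] prd_graded[OF w(3) yg] w(1)])
    also have "\<dots> = lact hom (bv i) (ract hom (g v) (bv k) \<prec> hom (bv y))"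
      using lm(2)[OF w(3) yg, of "g v"] w(5) by (simp only: act_plus[OF y] add_less_cancel_right)
    also have "\<dots> = hom ?w \<prec> hom (bv y)"
      by (simp only: hom_normal_form[OF w(2,3,1)] lact_prec)
    finally show "hom (?w \<lhd> bv y) = hom ?w \<prec> hom (bv y)" .
  qed (intro lin_intros)+
  moreover have "hom (bv x \<rhd> bv y) = hom (bv x) \<succ> hom (bv y)"
  proof (rule lin_eq_on_normal_forms[of scale "\<lambda>y. hom (bv x \<rhd> y)" "\<lambda>y. hom (bv x) \<succ> hom y",
        OF _ _ basis_normal_forms[OF y]])
    fix i k v
    assume w: "v \<in> primitive" "i \<in> graded_perms" "k \<in> graded_perms" "fst i < fst y" "fst k < fst y"
    let ?w = "bv i \<rhd> (v \<lhd> bv k)"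
    have xg: "x \<in> graded_perms" using x by simp
    have "hom (bv x \<rhd> ?w) = hom (mul (bv x) (bv i) \<rhd> (v \<lhd> bv k))"
      by (simp only: mul_succ)
    also have "\<dots> = lact hom (mul (bv x) (bv i)) (ract hom (g v) (bv k))"
      by (rule hom_normal_form'[OF prd_graded[OF xg w(2)] basis_in_graded[OF w(3)] w(1)])
    also have "\<dots> = hom (bv x) \<succ> lact hom (bv i) (ract hom (g v) (bv k))"
      using lm(1)[OF xg w(2)] w(4) by (simp only: act_plus[OF x] add_less_cancel_left)
    also have "\<dots> = hom (bv x) \<succ> hom ?w"
      by (simp only: hom_normal_form[OF w(2,3,1)])
    finally show "hom (bv x \<rhd> ?w) = hom (bv x) \<succ> hom ?w" .
  qed (intro lin_intros)+
  ultimately show ?case ..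
qed

lemma hom_prod:
  assumes "x \<in> gperm_plus" "y \<in> gperm_plus"
  shows "hom (x \<lhd> y) = hom x \<prec> hom y" "hom (x \<rhd> y) = hom x \<succ> hom y"
proof -
  have l: "hom (bv i \<lhd> y) = hom (bv i) \<prec> hom y" if "i \<in> plus_basis" for i
    by (rule lin_eq_on_plus[of scale "\<lambda>y. hom (bv i \<lhd> y)" "\<lambda>y. hom (bv i) \<prec> hom y", OF _ _ assms(2)])
       ((intro lin_intros)+, use hom_basis_prod that in blast)
  have r: "hom (bv i \<rhd> y) = hom (bv i) \<succ> hom y" if "i \<in> plus_basis" for i
    by (rule lin_eq_on_plus[of scale "\<lambda>y. hom (bv i \<rhd> y)" "\<lambda>y. hom (bv i) \<succ> hom y", OF _ _ assms(2)])
       ((intro lin_intros)+, use hom_basis_prod that in blast)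
  show "hom (x \<lhd> y) = hom x \<prec> hom y"
    by (rule lin_eq_on_plus[of scale "\<lambda>x. hom (x \<lhd> y)" "\<lambda>x. hom x \<prec> hom y", OF _ _ assms(1)])
       ((intro lin_intros)+, rule l)
  show "hom (x \<rhd> y) = hom x \<succ> hom y"
    by (rule lin_eq_on_plus[of scale "\<lambda>x. hom (x \<rhd> y)" "\<lambda>x. hom x \<succ> hom y", OF _ _ assms(1)])
       ((intro lin_intros)+, rule r)
qed

lemma hom_in_subspace:
  assumes U: "subspace U" and g: "\<And>v. v \<in> primitive \<Longrightarrow> g v \<in> U"
    and closed: "\<And>x y. x \<prec> y \<in> U" "\<And>x y. x \<succ> y \<in> U" and x: "x \<in> gperm_plus"
  shows "hom x \<in> U"
proof -
  have basis: "hom (bv b) \<in> U" if "b \<in> plus_basis" for b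
  proof (rule lin_in_subspace_normal_forms[OF U vs lin_hom basis_normal_forms[OF that]])
    fix i j v assume w: "v \<in> primitive" "i \<in> graded_perms" "j \<in> graded_perms"
    show "hom (bv i \<rhd> (v \<lhd> bv j)) \<in> U"
      unfolding hom_normal_form[OF w(2,3,1)] lact_def ract_def
      by (intro subspace_add[OF U] subspace_scale[OF U] closed g w(1))
  qed
  show ?thesis
    by (rule lin_in_subspace[OF U vs lin_hom x[unfolded gperm_plus_eq]]) (use basis in blast)
qed

end

section \<open>Shuffles as permutations\<close>

definition shuffle_perms :: "nat \<Rightarrow> nat \<Rightarrow> (nat \<Rightarrow> nat) set" where
  "shuffle_perms k l = {\<alpha>. \<alpha> permutes {1..k+l} \<and> strict_mono_on {1..k} \<alpha> \<and> strict_mono_on {k+1..k+l} \<alpha>}"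

text \<open>Letter number \<open>m\<close> of \<open>c\<close> moves to position
  \<open>\<alpha> m\<close>, which is composition with the inverse of \<alpha>; the
  \<open>- 1\<close> accounts for list indices.\<close>

definition shuffle_word :: "'a list \<Rightarrow> (nat \<Rightarrow> nat) \<Rightarrow> 'a list" where
  "shuffle_word c \<alpha> = map (\<lambda>m. c ! (inv \<alpha> m - 1)) [1..<Suc (length c)]"

lemma nth_shuffle_word: "i < length c \<Longrightarrow> shuffle_word c \<alpha> ! i = c ! (inv \<alpha> (Suc i) - 1)"
  by (simp add: shuffle_word_def del: upt_Suc)

lemma length_shuffle_word [simp]: "length (shuffle_word c \<alpha>) = length c"
  by (simp add: shuffle_word_def del: upt_Suc)

lemma filter_eq_map_nth: "filter P w = map ((!) w) (filter (\<lambda>p. P (w ! p)) [0..<length w])"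
  by (subst map_nth[symmetric]) (simp add: filter_map o_def del: map_nth)

lemma filter_upt_image:
  assumes "strict_mono_on {i..<j} \<alpha>" "\<alpha> ` {i..<j} = {m \<in> {1..n}. P m}"
  shows "filter P [1..<Suc n] = map \<alpha> [i..<j]"
proof (rule sorted_distinct_set_unique)
  show "sorted (map \<alpha> [i..<j])"
    unfolding sorted_iff_nth_mono_less
    using strict_mono_onD[OF assms(1)] by (auto intro!: less_imp_le)
  show "distinct (map \<alpha> [i..<j])"
    using strict_mono_on_imp_inj_on[OF assms(1)] by (simp add: distinct_map)
  show "set (filter P [1..<Suc n]) = set (map \<alpha> [i..<j])"
    using assms(2) by (auto simp del: upt_Suc)
  show "sorted (filter P [1..<Suc n])"
    using sorted_filter[of "\<lambda>x. x" "[1..<Suc n]" P] by (simp del: upt_Suc)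
qed (simp del: upt_Suc)

lemma filter_shuffle_word:
  assumes p: "\<alpha> permutes {1..length c}" and m: "strict_mono_on {i..<j} \<alpha>" and ij: "{i..<j} \<subseteq> {1..length c}"
    and P: "\<And>m. m \<in> {1..length c} \<Longrightarrow> P (c ! (m - 1)) \<longleftrightarrow> m \<in> {i..<j}"
  shows "filter P (shuffle_word c \<alpha>) = map (\<lambda>m. c ! (m - 1)) [i..<j]"
proof -
  let ?n = "length c"
  have inv: "inv \<alpha> (\<alpha> m) = m" "\<alpha> (inv \<alpha> m) = m" for m using permutes_inverses[OF p] by auto
  have P': "P (c ! (inv \<alpha> m - 1)) \<longleftrightarrow> inv \<alpha> m \<in> {i..<j}" if "m \<in> {1..?n}" for m
    using P[of "inv \<alpha> m"] permutes_in_image[OF permutes_inv[OF p], of m] that by blast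
  have "filter P (shuffle_word c \<alpha>) = map (\<lambda>m. c ! (inv \<alpha> m - 1)) (filter (\<lambda>m. P (c ! (inv \<alpha> m - 1))) [1..<Suc ?n])"
    by (simp add: shuffle_word_def filter_map o_def del: upt_Suc)
  also have "filter (\<lambda>m. P (c ! (inv \<alpha> m - 1))) [1..<Suc ?n] = map \<alpha> [i..<j]"
  proof (rule filter_upt_image[OF m], intro equalityI subsetI)
    fix x assume "x \<in> \<alpha> ` {i..<j}"
    then obtain y where y: "x = \<alpha> y" "y \<in> {i..<j}" by blast
    then have x: "x \<in> {1..?n}" using ij permutes_in_image[OF p, of y] by blast
    moreover have "inv \<alpha> x \<in> {i..<j}" unfolding y(1) inv by (rule y(2))
    ultimately show "x \<in> {m \<in> {1..?n}. P (c ! (inv \<alpha> m - 1))}" using P' by blast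
  next
    fix x assume "x \<in> {m \<in> {1..?n}. P (c ! (inv \<alpha> m - 1))}"
    then have "inv \<alpha> x \<in> {i..<j}" using P' by blast
    then show "x \<in> \<alpha> ` {i..<j}" using inv(2)[of x] by (metis image_eqI)
  qed
  finally show ?thesis by (simp add: inv o_def)
qed

lemma shuffle_word_in_shuffles:
  assumes d: "distinct (a @ b)" and \<alpha>: "\<alpha> \<in> shuffle_perms (length a) (length b)"
  shows "shuffle_word (a @ b) \<alpha> \<in> shuffles a b"
proof -
  let ?k = "length a" and ?n = "length (a @ b)" and ?c = "a @ b"
  have p: "\<alpha> permutes {1..?n}" and m: "strict_mono_on {1..<Suc ?k} \<alpha>" "strict_mono_on {Suc ?k..<Suc ?n} \<alpha>"
    using \<alpha> by (simp_all add: shuffle_perms_def atLeastLessThanSuc_atLeastAtMost)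
  have fa: "?c ! (m - 1) \<in> set a \<longleftrightarrow> m \<le> ?k" if "m \<in> {1..?n}" for m
  proof (cases "m \<le> ?k")
    case True
    then have "m - 1 < ?k" using that by auto
    then show ?thesis using True by (simp add: nth_append)
  next
    case False
    then have "?c ! (m - 1) = b ! (m - 1 - ?k)" "m - 1 - ?k < length b"
      using that by (auto simp: nth_append)
    then have "?c ! (m - 1) \<in> set b" by simp
    then show ?thesis using False d by auto
  qed
  have "filter (\<lambda>x. x \<in> set a) (shuffle_word ?c \<alpha>) = map (\<lambda>m. ?c ! (m - 1)) [1..<Suc ?k]"
    by (rule filter_shuffle_word[OF p m(1)]) (use fa in auto)
  also have "\<dots> = a"
    by (rule nth_equalityI) (simp_all add: nth_append del: upt_Suc)
  finally have 1: "filter (\<lambda>x. x \<in> set a) (shuffle_word ?c \<alpha>) = a" .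
  have "filter (\<lambda>x. x \<notin> set a) (shuffle_word ?c \<alpha>) = map (\<lambda>m. ?c ! (m - 1)) [Suc ?k..<Suc ?n]"
    by (rule filter_shuffle_word[OF p m(2)]) (use fa in auto)
  also have "\<dots> = b"
    by (rule nth_equalityI) (simp_all add: nth_append del: upt_Suc)
  finally have 2: "filter (\<lambda>x. x \<notin> set a) (shuffle_word ?c \<alpha>) = b" .
  have "set a \<inter> set b = {}" using d by simp
  from shuffles_iff_filter[OF this] 1 2 show ?thesis by blast
qed

lemma shuffle_word_inj:
  assumes "distinct c" "length c = k + l"
  shows "inj_on (shuffle_word c) (shuffle_perms k l)"
proof (rule inj_onI)
  fix \<alpha> \<beta> assume \<alpha>: "\<alpha> \<in> shuffle_perms k l" and \<beta>: "\<beta> \<in> shuffle_perms k l"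
    and eq: "shuffle_word c \<alpha> = shuffle_word c \<beta>"
  have p: "\<alpha> permutes {1..k+l}" "\<beta> permutes {1..k+l}" using \<alpha> \<beta> by (simp_all add: shuffle_perms_def)
  have "inv \<alpha> m = inv \<beta> m" for m
  proof (cases "m \<in> {1..k+l}")
    case True
    have r: "inv \<alpha> m \<in> {1..k+l}" "inv \<beta> m \<in> {1..k+l}"
      using True permutes_in_image[OF permutes_inv[OF p(1)]] permutes_in_image[OF permutes_inv[OF p(2)]] by simp_all
    have "shuffle_word c \<alpha> ! (m - 1) = shuffle_word c \<beta> ! (m - 1)" using eq by simp
    then have "c ! (inv \<alpha> m - 1) = c ! (inv \<beta> m - 1)"
      using True assms(2) by (cases m) (simp_all add: nth_shuffle_word)
    then have "inv \<alpha> m - 1 = inv \<beta> m - 1"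
      using r assms by (subst (asm) nth_eq_iff_index_eq) auto
    then show ?thesis using r by (simp add: eq_diff_iff)
  next
    case False
    then show ?thesis using permutes_not_in[OF permutes_inv[OF p(1)]] permutes_not_in[OF permutes_inv[OF p(2)]] by metis
  qed
  then have "inv \<alpha> = inv \<beta>" by blast
  then show "\<alpha> = \<beta>" using permutes_inv_inv[OF p(1)] permutes_inv_inv[OF p(2)] by metis
qed

lemma shuffle_word_surj:
  assumes d: "distinct (a @ b)" and w: "w \<in> shuffles a b"
  shows "\<exists>\<alpha>\<in>shuffle_perms (length a) (length b). shuffle_word (a @ b) \<alpha> = w"
proof -
  let ?k = "length a" and ?n = "length (a @ b)" and ?c = "a @ b"
  have disj: "set a \<inter> set b = {}" using d by simp
  have len: "length w = ?n" using length_shuffles[OF w] by simp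
  \<comment> \<open>The positions in \<open>w\<close> of the letters of \<open>a\<close> and of
    \<open>b\<close>, each in increasing order. Concatenated, they list the values of the required
    permutation, up to the shift between counting from 0 and from 1.\<close>
  define ia where "ia = filter (\<lambda>p. w ! p \<in> set a) [0..<?n]"
  define ib where "ib = filter (\<lambda>p. w ! p \<notin> set a) [0..<?n]"
  have ab: "a = map ((!) w) ia" "b = map ((!) w) ib"
    using w filter_eq_map_nth[of "\<lambda>x. x \<in> set a" w] filter_eq_map_nth[of "\<lambda>x. x \<notin> set a" w]
    unfolding shuffles_iff_filter[OF disj] len ia_def ib_def by simp_all
  have li: "length ia = ?k" "length ib = length b" using ab by (metis length_map)+
  define I where "I = ia @ ib"
  have I: "distinct I" "set I = {0..<?n}" "length I = ?n"
    using li by (auto simp: I_def ia_def ib_def)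
  have c: "?c = map ((!) w) I" using ab by (simp add: I_def)
  define \<alpha> where "\<alpha> m = (if m \<in> {1..?n} then Suc (I ! (m - 1)) else m)" for m
  have bij: "bij_betw \<alpha> {1..?n} {1..?n}"
  proof -
    have "inj_on \<alpha> {1..?n}"
    proof (rule inj_onI)
      fix x y assume xy: "x \<in> {1..?n}" "y \<in> {1..?n}" "\<alpha> x = \<alpha> y"
      then have "I ! (x - 1) = I ! (y - 1)" by (simp add: \<alpha>_def)
      then have "x - 1 = y - 1" using xy I by (subst (asm) nth_eq_iff_index_eq) auto
      then show "x = y" using xy by (simp add: eq_diff_iff)
    qed
    moreover have "\<alpha> ` {1..?n} \<subseteq> {1..?n}"
    proof (rule image_subsetI)
      fix x assume x: "x \<in> {1..?n}"
      then have "I ! (x - 1) \<in> set I" using I by (intro nth_mem) auto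
      then show "\<alpha> x \<in> {1..?n}" using x I by (simp add: \<alpha>_def)
    qed
    ultimately show ?thesis by (simp add: bij_betw_def endo_inj_surj)
  qed
  have p: "\<alpha> permutes {1..?n}"
    by (rule bij_imp_permutes[OF bij]) (auto simp: \<alpha>_def)
  have s: "sorted_wrt (<) ia" "sorted_wrt (<) ib"
    unfolding ia_def ib_def by (rule sorted_wrt_filter, simp)+
  have "strict_mono_on {1..?k} \<alpha>"
  proof (rule strict_mono_onI)
    fix x y assume xy: "x \<in> {1..?k}" "y \<in> {1..?k}" "x < y"
    then have "ia ! (x - 1) < ia ! (y - 1)" using li by (intro sorted_wrt_nth_less[OF s(1)]) auto
    then show "\<alpha> x < \<alpha> y" using xy li by (auto simp: \<alpha>_def I_def nth_append)
  qed
  moreover have "strict_mono_on {?k+1..?k+length b} \<alpha>"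
  proof (rule strict_mono_onI)
    fix x y assume xy: "x \<in> {?k+1..?k+length b}" "y \<in> {?k+1..?k+length b}" "x < y"
    then have "ib ! (x - 1 - ?k) < ib ! (y - 1 - ?k)" using li by (intro sorted_wrt_nth_less[OF s(2)]) auto
    then show "\<alpha> x < \<alpha> y" using xy li by (auto simp: \<alpha>_def I_def nth_append)
  qed
  ultimately have "\<alpha> \<in> shuffle_perms ?k (length b)" using p by (simp add: shuffle_perms_def)
  moreover have "shuffle_word ?c \<alpha> = w"
  proof (rule nth_equalityI)
    fix i assume "i < length (shuffle_word ?c \<alpha>)"
    then have i: "i < ?n" by simp
    let ?p = "inv \<alpha> (Suc i)"
    have pin: "?p \<in> {1..?n}" using permutes_in_image[OF permutes_inv[OF p], of "Suc i"] i by simp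
    have "\<alpha> ?p = Suc i" using permutes_inverses[OF p] by simp
    with pin have Ip: "I ! (?p - 1) = i" by (simp add: \<alpha>_def)
    have "shuffle_word ?c \<alpha> ! i = ?c ! (?p - 1)"
      using i by (simp add: nth_shuffle_word)
    also have "\<dots> = w ! i"
      unfolding c using pin I Ip by (subst nth_map) auto
    finally show "shuffle_word ?c \<alpha> ! i = w ! i" .
  qed (simp add: len)
  ultimately show ?thesis by blast
qed

lemma shuffle_word_bij:
  assumes "distinct (a @ b)"
  shows "bij_betw (shuffle_word (a @ b)) (shuffle_perms (length a) (length b)) (shuffles a b)"
  unfolding bij_betw_def
  using shuffle_word_inj[OF assms, of "length a" "length b"] shuffle_word_in_shuffles[OF assms] shuffle_word_surj[OF assms]
  by auto

lemma hd_shuffle_word: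
  assumes d: "distinct c" "length c = k + l" and \<alpha>: "\<alpha> \<in> shuffle_perms k l" and j: "j \<in> {1..k+l}"
  shows "hd (shuffle_word c \<alpha>) = c ! (j - 1) \<longleftrightarrow> inv \<alpha> 1 = j"
proof -
  have p: "\<alpha> permutes {1..k+l}" using \<alpha> by (simp add: shuffle_perms_def)
  have r: "inv \<alpha> 1 \<in> {1..k+l}" using permutes_in_image[OF permutes_inv[OF p], of 1] j by simp
  have c: "0 < length c" using j d(2) by auto
  then have "shuffle_word c \<alpha> \<noteq> []" by (simp flip: length_greater_0_conv)
  then have "hd (shuffle_word c \<alpha>) = c ! (inv \<alpha> 1 - 1)"
    using c by (simp add: hd_conv_nth nth_shuffle_word)
  then have "hd (shuffle_word c \<alpha>) = c ! (j - 1) \<longleftrightarrow> inv \<alpha> 1 - 1 = j - 1"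
    using r j d by (subst nth_eq_iff_index_eq[OF d(1), symmetric]) auto
  then show ?thesis using r j by (simp add: eq_diff_iff)
qed

lemma shuffle_term_eq:
  assumes "i \<in> graded_perms" "j \<in> graded_perms" "\<alpha> \<in> shuffle_perms (fst i) (fst j)"
  shows "shuffle_term i j \<alpha> = nrm (shuffle_word (enc i @ relabel (\<lambda>x. x + fst i) (enc j)) \<alpha>)"
proof -
  obtain k \<sigma> d l \<tau> e where ij: "i = (k, \<sigma>, d)" "j = (l, \<tau>, e)" by (metis prod_cases3)
  have p: "\<alpha> permutes {1..k + l}" using assms(3) by (simp add: shuffle_perms_def ij)
  let ?c = "enc i @ relabel (\<lambda>x. x + fst i) (enc j)"
  have c: "?c ! (m - 1) = (perm_tensor k \<sigma> \<tau> m, deg_tensor k d e m)" if "m \<in> {1..k+l}" for m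
  proof (cases "m \<le> k")
    case True
    then have "m - 1 < k" using that by auto
    then show ?thesis using that True by (simp add: ij nth_append nth_enc perm_tensor_def deg_tensor_def)
  next
    case False
    then have "m - 1 - k < l" "Suc (m - 1 - k) = m - k" "\<not> m - 1 < k" using that by auto
    then show ?thesis using that False by (simp add: ij nth_append nth_enc nth_relabel perm_tensor_def deg_tensor_def)
  qed
  have "enc (shuffle_term i j \<alpha>) = shuffle_word ?c \<alpha>"
  proof (rule nth_equalityI)
    fix m assume "m < length (enc (shuffle_term i j \<alpha>))"
    then have m: "Suc m \<in> {1..k+l}" by (simp add: ij shuffle_term_def)
    then have "inv \<alpha> (Suc m) \<in> {1..k+l}" using permutes_in_image[OF permutes_inv[OF p]] by simp
    from c[OF this] m show "enc (shuffle_term i j \<alpha>) ! m = shuffle_word ?c \<alpha> ! m"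
      by (simp add: ij shuffle_term_def nth_enc nth_shuffle_word)
  qed (simp add: ij shuffle_term_def)
  moreover have "shuffle_term i j \<alpha> \<in> graded_perms"
    using assms p by (intro shuffle_term_graded_perms) (simp_all add: ij)
  ultimately show ?thesis by (metis nrm_enc)
qed

lemma enc_shift_distinct:
  assumes "i \<in> graded_perms" "j \<in> graded_perms"
  shows "distinct (enc i @ relabel (\<lambda>x. x + fst i) (enc j))"
proof -
  let ?b = "relabel (\<lambda>x. x + fst i) (enc j)"
  have m: "strict_mono_on (letters (enc j)) (\<lambda>x. x + fst i)" by (simp add: strict_mono_on_def)
  have "valid ?b" using m by (intro valid_relabel valid_enc assms strict_mono_on_imp_inj_on)
  moreover have "letters (enc i) \<inter> letters ?b = {}"
    using letters_enc[OF assms(1)] letters_enc[OF assms(2)] by (auto simp: letters_relabel)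
  ultimately show ?thesis using valid_enc[OF assms(1)] valid_distinct valid_append by blast
qed

text \<open>The condition \<open>inv \<alpha> 1 = m\<close> says that the shuffle begins with letter
  number \<open>m\<close> of the concatenation. The cases \<open>m = 1\<close> and
  \<open>m = fst i + 1\<close> are the first letters of the two words and give \<prec> and
  \<succ>.\<close>

lemma sum_shuffle_terms:
  assumes i: "i \<in> graded_perms" and j: "j \<in> graded_perms" and m: "m \<in> {1..fst i + fst j}"
    and R: "\<And>w. R (enc i) (relabel (\<lambda>x. x + fst i) (enc j)) w \<longleftrightarrow>
      hd w = (enc i @ relabel (\<lambda>x. x + fst i) (enc j)) ! (m - 1)"
  shows "(\<Sum>\<alpha>\<in>shuffles_starting (fst i) (fst j) m. bv (shuffle_term i j \<alpha>)) =
    prd R (bv i) (bv j)"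
proof -
  let ?a = "enc i" and ?b = "relabel (\<lambda>x. x + fst i) (enc j)"
  note d = enc_shift_distinct[OF i j]
  have ss: "shuffles_starting (fst i) (fst j) m = {\<alpha> \<in> shuffle_perms (fst i) (fst j). inv \<alpha> 1 = m}"
    by (auto simp: shuffles_starting_def shuffle_perms_def)
  have bij: "bij_betw (shuffle_word (?a @ ?b)) (shuffle_perms (fst i) (fst j)) (shuffles ?a ?b)"
    using shuffle_word_bij[OF d] by simp
  have hd: "R ?a ?b (shuffle_word (?a @ ?b) \<alpha>) \<longleftrightarrow> inv \<alpha> 1 = m" if "\<alpha> \<in> shuffle_perms (fst i) (fst j)" for \<alpha>
    unfolding R by (rule hd_shuffle_word[OF d _ that m]) simp
  have img: "shuffle_word (?a @ ?b) ` {\<alpha> \<in> shuffle_perms (fst i) (fst j). inv \<alpha> 1 = m} = {w \<in> shuffles ?a ?b. R ?a ?b w}"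
    unfolding bij_betw_imp_surj_on[OF bij, symmetric] using hd by blast
  have "inj_on (shuffle_word (?a @ ?b)) {\<alpha> \<in> shuffle_perms (fst i) (fst j). inv \<alpha> 1 = m}"
    using bij_betw_imp_inj_on[OF bij] by (rule inj_on_subset) auto
  then have "(\<Sum>w\<in>{w \<in> shuffles ?a ?b. R ?a ?b w}. wv w) =
      (\<Sum>\<alpha>\<in>{\<alpha> \<in> shuffle_perms (fst i) (fst j). inv \<alpha> 1 = m}. wv (shuffle_word (?a @ ?b) \<alpha>))"
    unfolding img[symmetric] by (simp add: sum.reindex)
  also have "\<dots> = (\<Sum>\<alpha>\<in>shuffles_starting (fst i) (fst j) m. bv (shuffle_term i j \<alpha>))"
    unfolding ss by (rule sum.cong) (simp_all add: shuffle_term_eq[OF i j])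
  finally show ?thesis using i j by (simp add: prd_def)
qed

lemma bilin_bilinear_ext: "bilin pm_scale (bilinear_ext f)"
  unfolding bilinear_ext_def linear_ext_eq_lext by (intro bilinI lin_intros) simp_all

lemma bilin_eq_on_plus:
  assumes "bilin pm_scale B" "bilin pm_scale C" "x \<in> gperm_plus" "y \<in> gperm_plus"
    "\<And>i j. i \<in> plus_basis \<Longrightarrow> j \<in> plus_basis \<Longrightarrow> B (bv i) (bv j) = C (bv i) (bv j)"
  shows "B x y = C x y"
proof -
  have "B (bv i) y = C (bv i) y" if "i \<in> plus_basis" for i
    by (rule lin_eq_on_plus[of pm_scale "B (bv i)" "C (bv i)", OF _ _ assms(4)])
       (use assms(1,2,5) that in \<open>simp_all add: bilin_def\<close>)
  then show ?thesis
    by (intro lin_eq_on_plus[of pm_scale "\<lambda>x. B x y" "\<lambda>x. C x y", OF _ _ assms(3)])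
       (use assms(1,2) in \<open>simp_all add: bilin_def\<close>)
qed

lemma gperm_prec_eq:
  assumes "x \<in> gperm_plus" "y \<in> gperm_plus" shows "gperm_prec x y = x \<lhd> y"
proof (rule bilin_eq_on_plus[OF _ bilin_prd assms])
  show "bilin pm_scale gperm_prec" unfolding gperm_prec_def by (rule bilin_bilinear_ext)
  fix i j assume ij: "i \<in> plus_basis" "j \<in> plus_basis"
  then have "enc i \<noteq> []" by (metis (no_types, lifting) length_enc list.size(3) mem_Collect_eq not_one_le_zero)
  moreover have "0 < fst i" using ij by simp
  ultimately have "startl (enc i) b w \<longleftrightarrow> hd w = (enc i @ b) ! (1 - 1)" for b w
    by (simp add: startl_def hd_conv_nth nth_append)
  with ij show "gperm_prec (bv i) (bv j) = bv i \<lhd> bv j"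
    unfolding gperm_prec_def bilinear_ext_basis_vec by (intro sum_shuffle_terms) auto
qed

lemma gperm_succ_eq:
  assumes "x \<in> gperm_plus" "y \<in> gperm_plus" shows "gperm_succ x y = x \<rhd> y"
proof (rule bilin_eq_on_plus[OF _ bilin_prd assms])
  show "bilin pm_scale gperm_succ" unfolding gperm_succ_def by (rule bilin_bilinear_ext)
  fix i j assume ij: "i \<in> plus_basis" "j \<in> plus_basis"
  then have ne: "relabel (\<lambda>x. x + fst i) (enc j) \<noteq> []"
    by (metis (no_types, lifting) length_enc list.size(3) mem_Collect_eq not_one_le_zero relabel_Nil(2))
  then have "startr (enc i) (relabel (\<lambda>x. x + fst i) (enc j)) w \<longleftrightarrow>
      hd w = (enc i @ relabel (\<lambda>x. x + fst i) (enc j)) ! (fst i + 1 - 1)" for w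
    by (simp add: startr_def hd_conv_nth nth_append)
  with ij show "gperm_succ (bv i) (bv j) = bv i \<rhd> bv j"
    unfolding gperm_succ_def bilinear_ext_basis_vec by (intro sum_shuffle_terms) auto
qed

section \<open>The primitive elements\<close>

text \<open>The letters are exactly \<open>1, \<dots>, n\<close>, so the smallest letter of the word
  is 1. This translates between the order conditions on words and the position
  \<open>inv \<sigma> 1\<close> in the definition of the coproducts.\<close>

lemma min_left_iff:
  assumes w: "valid (u @ v)" "letters (u @ v) = {1..n}" and ne: "u \<noteq> []" "v \<noteq> []"
  shows "min_left u v \<longleftrightarrow> 1 \<in> letters u" "min_right u v \<longleftrightarrow> 1 \<notin> letters u"
proof -
  have ge: "1 \<le> fst p" if "p \<in> set u \<union> set v" for p
    using w(2) that by (metis atLeastAtMost_iff image_eqI set_append)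
  have "0 < n" using w(2) ne by (cases n) auto
  then have one: "1 \<in> letters u \<union> letters v" using w(2) by (simp add: image_Un)
  have disj: "letters u \<inter> letters v = {}" using w(1) by (simp add: valid_append)
  have dom: "(\<forall>p\<in>set y. \<exists>q\<in>set x. fst q < fst p) \<longleftrightarrow> 1 \<in> letters x"
    if xy: "set x \<union> set y = set u \<union> set v" "letters x \<inter> letters y = {}" for x y :: word
  proof
    assume m: "\<forall>p\<in>set y. \<exists>q\<in>set x. fst q < fst p"
    have "1 \<notin> letters y"
    proof
      assume "1 \<in> letters y"
      then obtain p where "p \<in> set y" "fst p = 1" by auto
      with m obtain q where "q \<in> set x" "fst q < 1" by metis
      moreover from this have "q \<in> set u \<union> set v" using xy(1) by blast
      ultimately show False using ge[of q] by simp
    qed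
    moreover have "1 \<in> letters x \<union> letters y" using one xy(1) by (metis image_Un)
    ultimately show "1 \<in> letters x" by blast
  next
    assume "1 \<in> letters x"
    then obtain q where q: "q \<in> set x" "fst q = 1" by auto
    have "1 < fst p" if p: "p \<in> set y" for p
    proof -
      have "fst p \<noteq> 1" using p q xy(2) by (metis disjoint_iff image_eqI)
      moreover have "p \<in> set u \<union> set v" using p xy(1) by blast
      ultimately show ?thesis using ge[of p] by simp
    qed
    with q show "\<forall>p\<in>set y. \<exists>q\<in>set x. fst q < fst p" by metis
  qed
  show "min_left u v \<longleftrightarrow> 1 \<in> letters u"
    using dom[of u v] disj ne by (simp add: min_left_def)
  have "min_right u v \<longleftrightarrow> 1 \<in> letters v"
    using dom[of v u] disj ne by (simp add: min_right_def Un_commute Int_commute)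
  then show "min_right u v \<longleftrightarrow> 1 \<notin> letters u" using one disj by blast
qed

lemma one_in_letters_take:
  assumes "\<sigma> permutes {1..n}" "1 \<le> n" "i \<le> n"
  shows "1 \<in> letters (take i (enc (n, \<sigma>, d))) \<longleftrightarrow> inv \<sigma> 1 \<le> i"
proof -
  have "inv \<sigma> 1 \<in> {1..n}" using permutes_in_image[OF permutes_inv[OF assms(1)], of 1] assms(2) by simp
  moreover have "letters (take i (enc (n, \<sigma>, d))) = \<sigma> ` {1..i}"
    using assms(3) by (force simp: enc_def take_map take_upt image_image atLeastLessThanSuc_atLeastAtMost simp del: upt_Suc)
  moreover have "1 \<in> \<sigma> ` {1..i} \<longleftrightarrow> inv \<sigma> 1 \<in> {1..i}"
    using permutes_inverses[OF assms(1)] by (metis image_iff)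
  ultimately show ?thesis by simp
qed

lemma sum_segments:
  assumes b: "(n, \<sigma>, d) \<in> graded_perms" and I: "I \<subseteq> {1..n - 1}"
    and Q: "\<And>i. i \<in> {0..n} \<Longrightarrow> Q (take i (enc (n, \<sigma>, d))) (drop i (enc (n, \<sigma>, d))) \<longleftrightarrow> i \<in> I"
  shows "(\<Sum>i\<in>I. bv (std_segment 0 i \<sigma> d, std_segment i (n - i) \<sigma> d)) = cop Q (bv (n, \<sigma>, d))"
proof -
  let ?w = "enc (n, \<sigma>, d)"
  let ?s = "\<lambda>i. (take i ?w, drop i ?w)"
  have "{(u, v). (u, v) \<in> splits ?w \<and> Q u v} = ?s ` I"
    using I Q by (force simp: splits_eq)
  moreover have "inj_on ?s I"
  proof (rule inj_onI)
    fix i j assume ij: "i \<in> I" "j \<in> I" "?s i = ?s j"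
    then have "length (take i ?w) = length (take j ?w)" by simp
    moreover have "i \<in> {1..n - 1}" "j \<in> {1..n - 1}" using ij(1,2) I by blast+
    ultimately show "i = j" by auto
  qed
  ultimately have "cop Q (bv (n, \<sigma>, d)) = (\<Sum>i\<in>I. bv (nrm (take i ?w), nrm (drop i ?w)))"
    by (simp add: cop_eq_word[OF b] sum.reindex)
  also have "\<dots> = (\<Sum>i\<in>I. bv (std_segment 0 i \<sigma> d, std_segment i (n - i) \<sigma> d))"
  proof (rule sum.cong[OF refl])
    fix i assume "i \<in> I"
    then have "i \<in> {1..n - 1}" using I by blast
    then have "i \<le> n" by auto
    then show "bv (nrm (take i ?w), nrm (drop i ?w)) = bv (std_segment 0 i \<sigma> d, std_segment i (n - i) \<sigma> d)"
      using std_segment_eq_nrm[of 0 i n \<sigma> d] std_segment_eq_nrm[of i "n - i" n \<sigma> d] by simp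
  qed
  finally show ?thesis ..
qed

lemma gperm_cop_eq:
  assumes "x \<in> gperm_plus"
  shows "gperm_coprec x = cop min_left_ne x" "gperm_cosucc x = cop min_right x"
proof -
  have b: "gperm_coprec (bv b) = cop min_left_ne (bv b) \<and> gperm_cosucc (bv b) = cop min_right (bv b)"
    if "b \<in> plus_basis" for b
  proof -
    obtain n \<sigma> d where nb: "b = (n, \<sigma>, d)" by (metis prod_cases3)
    have g: "(n, \<sigma>, d) \<in> graded_perms" and n: "1 \<le> n" using that nb by auto
    have p: "\<sigma> permutes {1..n}" using g by (simp add: graded_perms_def)
    have r: "inv \<sigma> 1 \<in> {1..n}" using permutes_in_image[OF permutes_inv[OF p], of 1] n by simp
    let ?w = "enc (n, \<sigma>, d)"
    have ml: "min_left (take i ?w) (drop i ?w) \<longleftrightarrow> inv \<sigma> 1 \<le> i" "min_right (take i ?w) (drop i ?w) \<longleftrightarrow> i < inv \<sigma> 1"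
      if "1 \<le> i" "i < n" for i
    proof -
      have "take i ?w \<noteq> []" "drop i ?w \<noteq> []" using that by (auto simp flip: length_greater_0_conv)
      with min_left_iff[of "take i ?w" "drop i ?w" n] valid_enc[OF g] letters_enc[OF g] one_in_letters_take[OF p n, of i d] that
      show "min_left (take i ?w) (drop i ?w) \<longleftrightarrow> inv \<sigma> 1 \<le> i" "min_right (take i ?w) (drop i ?w) \<longleftrightarrow> i < inv \<sigma> 1"
        by auto
    qed
    have ends: "i = 0 \<or> i = n \<or> 1 \<le> i \<and> i < n" if "i \<in> {0..n}" for i using that by auto
    have e: "take 0 ?w = []" "drop n ?w = []" by simp_all
    have "gperm_coprec (bv b) = cop min_left_ne (bv b)"
      unfolding gperm_coprec_def linear_ext_basis_vec nb prod.case
    proof (rule sum_segments[OF g])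
      show "{inv \<sigma> 1..n - 1} \<subseteq> {1..n - 1}" using r by auto
      show "min_left_ne (take i ?w) (drop i ?w) \<longleftrightarrow> i \<in> {inv \<sigma> 1..n - 1}" if "i \<in> {0..n}" for i
      proof (cases "i = 0 \<or> i = n")
        case True
        then have "\<not> min_left_ne (take i ?w) (drop i ?w)" by (auto simp: min_left_ne_def min_left_def)
        with True r n show ?thesis by auto
      next
        case False
        then have "drop i ?w \<noteq> []" using that by simp
        with False ends[OF that] ml(1)[of i] show ?thesis by (auto simp: min_left_ne_def)
      qed
    qed
    moreover have "gperm_cosucc (bv b) = cop min_right (bv b)"
      unfolding gperm_cosucc_def linear_ext_basis_vec nb prod.case
    proof (rule sum_segments[OF g])
      show "{1..inv \<sigma> 1 - 1} \<subseteq> {1..n - 1}" using r by auto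
      show "min_right (take i ?w) (drop i ?w) \<longleftrightarrow> i \<in> {1..inv \<sigma> 1 - 1}" if "i \<in> {0..n}" for i
      proof (cases "i = 0 \<or> i = n")
        case True
        then have "\<not> min_right (take i ?w) (drop i ?w)" by (auto simp: min_right_def)
        with True r show ?thesis by auto
      next
        case False
        with ends[OF that] ml(2)[of i] show ?thesis by auto
      qed
    qed
    ultimately show ?thesis ..
  qed
  have l: "lin pm_scale gperm_coprec" "lin pm_scale gperm_cosucc"
    by (simp_all add: gperm_coprec_def gperm_cosucc_def linear_ext_eq_lext lin_lext)
  show "gperm_coprec x = cop min_left_ne x"
    by (rule lin_eq_on_plus[OF l(1) lin_cop[OF lin_id] assms]) (use b in blast)
  show "gperm_cosucc x = cop min_right x"
    by (rule lin_eq_on_plus[OF l(2) lin_cop[OF lin_id] assms]) (use b in blast)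
qed

text \<open>One coinvariance condition is the vanishing of \<open>\<Delta>\<^sub>\<prec>\<close>,
  the other that of \<open>\<Delta>\<^sub>\<prec> + \<Delta>\<^sub>\<succ>\<close>; together they
  say that both coproducts vanish.\<close>

lemma prim_dend_eq: "prim_dend = primitive"
proof -
  have "gperm_coprec x = 0 \<and> gperm_cosucc x = 0 \<longleftrightarrow> cop min_left x = tens x one \<and> cop ne_left x = tens x one"
    if "x \<in> gperm_plus" for x
    using that by (auto simp: gperm_cop_eq cop_plus_eq ne_both_cop[of x])
  then show ?thesis by (auto simp: prim_dend_def primitive_def)
qed

section \<open>The free dendriform algebra\<close>

lemma dendriform_gperm: "dendriform_algebra pm_scale gperm_plus gperm_prec gperm_succ"
proof
  note prod_eq = gperm_prec_eq gperm_succ_eq prec_in_plus succ_in_plus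
  have mul: "mul x y = x \<lhd> y + x \<rhd> y" if "x \<in> gperm_plus" for x y
    by (rule lin_eq_on_plus[of pm_scale "\<lambda>x. mul x y" "\<lambda>x. x \<lhd> y + x \<rhd> y", OF _ _ that])
       ((intro lin_intros pm_vector_space)+, rule mul_eq_prec_succ)
  note add_in = pm.subspace_add[OF subspace_gperm_plus]
  show "pm.subspace gperm_plus" by simp
  show "bilinear_on pm_scale gperm_plus gperm_prec" "bilinear_on pm_scale gperm_plus gperm_succ"
    using bilin_bilinear_ext unfolding gperm_prec_def gperm_succ_def bilinear_on_def linear_on_def bilin_def by blast+
  fix x y z assume xyz: "x \<in> gperm_plus" "y \<in> gperm_plus" "z \<in> gperm_plus"
  then show "gperm_prec (gperm_prec x y) z = gperm_prec x (gperm_prec y z + gperm_succ y z)"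
    by (simp add: prod_eq add_in prec_prec mul)
  show "gperm_prec (gperm_succ x y) z = gperm_succ x (gperm_prec y z)"
    using xyz by (simp add: prod_eq succ_prec)
  show "gperm_succ (gperm_prec x y + gperm_succ x y) z = gperm_succ x (gperm_succ y z)"
    using xyz mul[of x y] mul_succ[of x y z] by (simp add: prod_eq add_in)
qed (simp_all add: gperm_prec_eq gperm_succ_eq prec_in_plus succ_in_plus)

lemma subspace_primitive: "pm.subspace primitive"
proof (rule pm.subspaceI)
  have l: "lin pm_scale (\<lambda>x. cop Q x)" "lin pm_scale (\<lambda>x. tens x one)" for Q by (intro lin_intros)+
  show "0 \<in> primitive"
    using lin_0[OF l(2)] by (simp add: primitive_def pm.subspace_0)
  show "x + y \<in> primitive" if "x \<in> primitive" "y \<in> primitive" for x y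
    using that by (simp add: primitive_def pm.subspace_add lin_plus[OF l(1)] lin_plus[OF l(2)])
  show "pm_scale c x \<in> primitive" if "x \<in> primitive" for c x
    using that pm.subspace_scale[OF subspace_gperm_plus, of x c]
    by (simp add: primitive_def lin_smult[OF l(1)] lin_smult[OF l(2)])
qed

text \<open>The outer factors of the normal forms of a basis element are shorter than it or the
  unit, and the unit acts as the identity. By induction, a dendriform subalgebra containing the
  primitive elements is therefore all of \<open>A\<close>; uniqueness rests on this.\<close>

lemma generated_induct:
  assumes U: "pm.subspace U" and V: "\<And>v. v \<in> primitive \<Longrightarrow> v \<in> U"
    and closed: "\<And>x y. x \<in> U \<Longrightarrow> y \<in> U \<Longrightarrow> x \<in> gperm_plus \<Longrightarrow> y \<in> gperm_plus \<Longrightarrow> x \<lhd> y \<in> U \<and> x \<rhd> y \<in> U"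
    and x: "x \<in> gperm_plus"
  shows "x \<in> U"
proof -
  have basis: "b \<in> plus_basis \<Longrightarrow> bv b \<in> U" for b
  proof (induction "fst b" arbitrary: b rule: less_induct)
    case less
    have "bv i \<rhd> (v \<lhd> bv j) \<in> U"
      if v: "v \<in> primitive" and i: "i \<in> graded_perms" "fst i < fst b" and j: "j \<in> graded_perms" "fst j < fst b" for i j v
    proof -
      have vp: "v \<in> gperm_plus" using v by (simp add: primitive_def)
      have vj: "v \<lhd> bv j \<in> U"
        using j(1)
      proof (cases rule: graded_perms_cases)
        case 1 then show ?thesis using V[OF v] prec_one_plus[OF vp] by simp
      next
        case 2
        from closed[OF V[OF v] less.hyps[OF j(2) 2] vp in_gperm_plus[OF 2]] show ?thesis ..
      qed
      show ?thesis
        using i(1)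
      proof (cases rule: graded_perms_cases)
        case 1 then show ?thesis using vj one_succ_plus[OF prec_in_plus] by simp
      next
        case 2
        from closed[OF less.hyps[OF i(2) 2] vj in_gperm_plus[OF 2] prec_in_plus] show ?thesis ..
      qed
    qed
    then have "normal_forms (fst b) \<subseteq> U" unfolding normal_forms_def by (intro pm.span_minimal U) blast
    then show ?case using basis_normal_forms[OF less.prems] by blast
  qed
  show ?thesis using x pm.span_minimal[OF _ U, of "bv ` plus_basis"] basis unfolding gperm_plus_eq by blast
qed

text \<open>A linear left inverse of the inclusion of \<open>B\<close>, with values in
  \<open>B\<close>. It replaces an algebra on a subspace by one on the whole type.\<close>

lemma subspace_projection:
  assumes "vector_space t" "module.subspace t B"
  obtains p where "linear_on t UNIV t p" "\<And>x. p x \<in> B" "\<And>x. x \<in> B \<Longrightarrow> p x = x"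
proof -
  interpret v: vector_space t by fact
  interpret vv: vector_space_pair t t ..
  obtain p where p: "range p \<subseteq> B" "Vector_Spaces.linear t t p" "\<forall>v\<in>B. p (id v) = v"
    using vv.linear_exists_left_inverse_on[OF v.linear_id assms(2)] by auto
  from p(2) interpret p: Vector_Spaces.linear t t p .
  show ?thesis
    by (rule that[of p]) (use p in \<open>auto simp: linear_on_def p.add p.scale\<close>)
qed

theorem corollary16:
  shows "freely_generated_dendriform TYPE('b::ab_group_add)
           pm_scale gperm_plus gperm_prec gperm_succ prim_dend"
  unfolding freely_generated_dendriform_def prim_dend_eq
proof (intro conjI allI impI)
  show "dendriform_algebra pm_scale gperm_plus gperm_prec gperm_succ" by (rule dendriform_gperm)
  show "pm.subspace primitive" by (rule subspace_primitive)
  show "primitive \<subseteq> gperm_plus" by (auto simp: primitive_def)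
  fix t :: "rat \<Rightarrow> 'b \<Rightarrow> 'b" and B l r f
  assume B: "dendriform_algebra t B l r" and f: "f \<in> primitive \<rightarrow> B" "linear_on pm_scale primitive t f"
  interpret B: dendriform_algebra t B l r by (rule B)
  obtain p where p: "linear_on t UNIV t p" "\<And>x. p x \<in> B" "\<And>x. x \<in> B \<Longrightarrow> p x = x"
    using subspace_projection[OF B.vector_space_axioms B.subspace] by blast
  \<comment> \<open>The products are evaluated on projected arguments. Their values lie in
    \<open>B\<close>, where \<open>p\<close> is the identity, so each axiom reduces to the one of
    \<open>B\<close>.\<close>
  define l' where "l' x y = l (p x) (p y)" for x y
  define r' where "r' x y = r (p x) (p y)" for x y
  \<comment> \<open>\<open>prim_proj\<close> is the identity on primitive elements and vanishes on
    products, so \<open>g\<close> extends \<open>f\<close> and satisfies the assumptions of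
    \<open>dendriform_target\<close>.\<close>
  define g where "g x = f (prim_proj x)" for x
  have cl: "l' x y \<in> B" "r' x y \<in> B" for x y
    by (simp_all add: l'_def r'_def B.lprod_closed B.rprod_closed p(2))
  have f0: "f 0 = 0"
    using f(2) pm.subspace_0[OF subspace_primitive] by (metis add_cancel_right_left linear_on_def)
  interpret T: dendriform_target t l' r' g
  proof
    have pl: "p (x + y) = p x + p y" "p (t c x) = t c (p x)" for x y c using p(1) by (auto simp: linear_on_def)
    show "bilinear_on t UNIV l'" "bilinear_on t UNIV r'"
      using B.lprod_bilinear B.rprod_bilinear p(2)
      by (auto simp: bilinear_on_def linear_on_def l'_def r'_def pl)
    fix x y z
    note ax = B.lprod_closed B.rprod_closed p(2,3) B.subspace_add[OF B.subspace]
    show "l' (l' x y) z = l' x (l' y z + r' y z)" by (simp add: l'_def r'_def ax B.dend_left)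
    show "l' (r' x y) z = r' x (l' y z)" by (simp add: l'_def r'_def ax B.dend_middle)
    show "r' (l' x y + r' x y) z = r' x (r' y z)" by (simp add: l'_def r'_def ax B.dend_right)
  next
    show "lin t g"
      using f(2) prim_proj_primitive lin_prim_proj[OF lin_id]
      by (auto simp: linear_on_def g_def)
    show "g (x \<lhd> y) = 0" "g (x \<rhd> y) = 0" if "x \<in> gperm_plus" "y \<in> gperm_plus" for x y
      using that by (simp_all add: g_def prim_proj_prec prim_proj_succ f0)
  qed simp_all
  let ?ok = "\<lambda>F. F \<in> extensional gperm_plus \<and>
    dendriform_hom pm_scale gperm_plus gperm_prec gperm_succ t B l r F \<and> (\<forall>v\<in>primitive. F v = f v)"
  have hom_B: "T.hom x \<in> B" if "x \<in> gperm_plus" for x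
    by (rule T.hom_in_subspace[OF B.subspace _ cl that])
       (use f(1) prim_proj_id in \<open>auto simp: g_def\<close>)
  have ok: "?ok (restrict T.hom gperm_plus)"
    unfolding dendriform_hom_def
  proof (intro conjI ballI)
    show "restrict T.hom gperm_plus \<in> gperm_plus \<rightarrow> B" using hom_B by simp
    show "linear_on pm_scale gperm_plus t (restrict T.hom gperm_plus)"
      using T.lin_hom by (simp add: linear_on_def pm.subspace_add pm.subspace_scale)
    show "restrict T.hom gperm_plus v = f v" if "v \<in> primitive" for v
      using that T.hom_primitive[OF that] prim_proj_id[OF that] by (simp add: primitive_def g_def)
    fix x y assume xy: "x \<in> gperm_plus" "y \<in> gperm_plus"
    then show "restrict T.hom gperm_plus (gperm_prec x y) = l (restrict T.hom gperm_plus x) (restrict T.hom gperm_plus y)"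
      by (simp add: gperm_prec_eq prec_in_plus T.hom_prod l'_def p(3) hom_B)
    show "restrict T.hom gperm_plus (gperm_succ x y) = r (restrict T.hom gperm_plus x) (restrict T.hom gperm_plus y)"
      using xy by (simp add: gperm_succ_eq succ_in_plus T.hom_prod r'_def p(3) hom_B)
  qed simp
  have unique: "F = F'" if F: "?ok F" and F': "?ok F'" for F F'
  proof (rule extensionalityI)
    show "F \<in> extensional gperm_plus" "F' \<in> extensional gperm_plus" using F F' by blast+
    fix x assume x: "x \<in> gperm_plus"
    \<comment> \<open>The equaliser of two homomorphisms is a dendriform subalgebra. It contains the
      generating primitive elements.\<close>
    let ?U = "{x \<in> gperm_plus. F x = F' x}"
    have hF: "linear_on pm_scale gperm_plus t F" "linear_on pm_scale gperm_plus t F'"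
      using F F' by (auto simp: dendriform_hom_def)
    have mF: "F (x \<lhd> y) = l (F x) (F y)" "F (x \<rhd> y) = r (F x) (F y)"
        "F' (x \<lhd> y) = l (F' x) (F' y)" "F' (x \<rhd> y) = r (F' x) (F' y)"
      if "x \<in> gperm_plus" "y \<in> gperm_plus" for x y
      using F F' that by (simp_all add: dendriform_hom_def flip: gperm_prec_eq gperm_succ_eq)
    have z: "0 \<in> gperm_plus" by (simp add: pm.subspace_0)
    have "F 0 = 0" "F' 0 = 0" using hF z by (metis add_cancel_right_left linear_on_def)+
    then have "pm.subspace ?U"
      using hF by (auto intro!: pm.subspaceI simp: linear_on_def pm.subspace_0 pm.subspace_add pm.subspace_scale)
    then have "x \<in> ?U"
    proof (rule generated_induct[OF _ _ _ x])
      show "v \<in> ?U" if "v \<in> primitive" for v using F F' that by (auto simp: primitive_def)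
      show "x \<lhd> y \<in> ?U \<and> x \<rhd> y \<in> ?U" if "x \<in> ?U" "y \<in> ?U" for x y
        using that by (simp add: prec_in_plus succ_in_plus mF)
    qed
    then show "F x = F' x" by simp
  qed
  show "\<exists>!F. ?ok F"
    by (rule ex1I[of ?ok, OF ok]) (rule unique[OF _ ok])
qed

end
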